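(* Let $\lambda,\mu,\nu$ be partitions, and let $c^{\nu}_{\lambda\mu}(a)\in\mathbb{Z}[a]$ be the Littlewood–Richardson polynomials, defined by $s_\lambda(x|\!|a)\,s_\mu(x|\!|a)=\sum_\nu c^{\nu}_{\lambda\mu}(a)\,s_\nu(x|\!|a)$. If $\mu\not\subseteq\nu$, then $c^{\nu}_{\lambda\mu}(a)=0$. If $\mu\subseteq\nu$, then $$c^{\nu}_{\lambda\mu}(a)=\sum_{T}\ \prod_{\substack{\alpha\in\lambda\\ T(\alpha)\ \text{unbarred}}}\left(a_{T(\alpha)-\rho^r(\alpha)_{T(\alpha)}}-a_{T(\alpha)-c(\alpha)}\right),$$ where the sum is over all reverse $\lambda$-tableaux $T$ such that (i) the column word $S^c$ of $T$ takes $\mu$ to $\nu$ and is Yamanouchi when applied to $\mu$, and (ii) the entries of $T$ strictly decrease down each column. (The sum is understood as the sum of its nonzero terms, which are finite in number.)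
   Context: **Compositions and diagrams.** An integer vector is a sequence of integers with finitely many nonzero entries; its length $l(\cdot)$ is the index of its rightmost nonzero entry. A composition is an integer vector with nonnegative entries; a partition is a composition with weakly decreasing entries. Write $\mu\subseteq\nu$ if $\mu_i\le\nu_i$ for all $i$. A composition is identified with its left-justified diagram, with rows numbered from top to bottom; the box in row $i$, column $j$ is $(i,j)$ and has content $c(i,j)=j-i$. **Double symmetric functions.** Let $a=(a_i)_{i\in\mathbb{Z}}$ be variables. $\Lambda_n(a)$ is the ring of symmetric polynomials in $x_1,\dots,x_n$ over $\mathbb{Z}[a]$, filtered by degree in the $x_i$ (the $a_i$ have degree $0$). $\Lambda(a)$ is the inverse limit, in filtered rings, of the $\Lambda_n(a)$ under the maps $\varphi_n:P(x_1,\dots,x_n)\mapsto P(x_1,\dots,x_{n-1},a_n)$. The double complete symmetric function $h_p(x|\!|a)\in\Lambda(a)$, $p\ge1$, is given by the compatible sequence of polynomials $$h_p(x_1,\dots,x_n|\!|a)=\sum_{n\ge i_1\ge\dots\ge i_p\ge1}(x_{i_1}-a_{i_1})(x_{i_2}-a_{i_2-1})\cdots(x_{i_p}-a_{i_p-p+1}),$$ with $h_0(x|\!|a)=1$ and $h_r(x|\!|a)=0$ for $r<0$; $\Lambda(a)$ is the polynomial ring over $\mathbb{Z}[a]$ in the $h_p(x|\!|a)$, $p\ge1$. Let $\tau$ be the ring automorphism of $\Lambda(a)$ with $\tau(a_i)=a_{i+1}$ and $\tau h_p(x|\!|a)=h_p(x|\!|a)+a_{2-p}h_{p-1}(x|\!|a)$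 for $p\ge1$. Put $h_{r,s}=\tau^s h_r(x|\!|a)$. For a partition $\lambda$ with $l=l(\lambda)$, the double Schur function is $s_\lambda(x|\!|a)=\det\big(h_{\lambda_i+j-i,\ j-1}\big)_{1\le i,j\le l}$. The double Schur functions form a basis of $\Lambda(a)$ over $\mathbb{Z}[a]$. **Tableaux.** A reverse $\lambda$-tableau $T$ is a filling of each box of the diagram $\lambda$ with a positive integer, either unbarred ($k$) or barred ($\overline{k}$), such that entries weakly decrease from left to right in each row (bars are ignored in all comparisons; no column condition is included in this definition). $T(\alpha)$ denotes the entry in box $\alpha$, used as an integer in subscripts. The row order on the boxes reads rows from bottom to top, each row from left to right. The column order reads columns from left to right, each column from bottom to top. The row word $S^r$ (resp. column word $S^c$) of $T$ is the sequence of barred entries of $T$, with bars omitted, listed in row order (resp. column order); $S^r(\alpha)$ is the subsequence of $S^r$ consisting of barred entries in boxes up to and including $\alpha$ in row order. A sequence $S=s_1\cdots s_t$ of positive integers is applied to a composition $\mu$ by forming $\mu=\rho^{(0)},\rho^{(1)},\dots,\rho^{(t)}$, where $\rho^{(i)}$ is obtained from $\rho^{(i-1)}$ by adding a box at the end of row $s_i$. One says that $S$ takes $\mu$ to $\nu=\rho^{(t)}$ (or $\nu$ is created from $\mu$ using $S$). $S$ is Yamanouchi when applied to $\mu$ if every $\rho^{(i)}$, $0\le i\le t$, is a partition. The composition $\rho^r(\alpha)$ is the one created from $\mu$ using $S^r(\alpha)$, and $\rho^r(\alpha)_k$ is its $k$-th entry. *)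

theory Defs
  imports
    "HOL-Library.Poly_Mapping"
    "HOL-Library.Function_Algebras"
    "HOL-Library.FuncSet"
    "Jordan_Normal_Form.Determinant"
begin

section \<open>Compositions and diagrams\<close>

text \<open>
  Rows are numbered from 1, so an integer vector with nonnegative entries is a finitely
  supported function on the positive naturals. The value at the unused index 0 is required to
  be 0, so that every composition is represented by exactly one function.
\<close>

definition is_composition :: "(nat \<Rightarrow> nat) \<Rightarrow> bool" where
  "is_composition \<mu> \<longleftrightarrow> \<mu> 0 = 0 \<and> finite {i. \<mu> i \<noteq> 0}"

definition is_partition :: "(nat \<Rightarrow> nat) \<Rightarrow> bool" where
  "is_partition \<mu> \<longleftrightarrow> is_composition \<mu> \<and> (\<forall>i\<ge>1. \<mu> (Suc i) \<le> \<mu> i)"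

definition len :: "(nat \<Rightarrow> nat) \<Rightarrow> nat" where
  "len \<mu> = Max (insert 0 {i. \<mu> i \<noteq> 0})"

definition contained :: "(nat \<Rightarrow> nat) \<Rightarrow> (nat \<Rightarrow> nat) \<Rightarrow> bool" where
  "contained \<mu> \<nu> \<longleftrightarrow> (\<forall>i. \<mu> i \<le> \<nu> i)"

type_synonym box = "nat \<times> nat"

definition diagram :: "(nat \<Rightarrow> nat) \<Rightarrow> box set" where
  "diagram \<mu> = {(i, j). 1 \<le> i \<and> 1 \<le> j \<and> j \<le> \<mu> i}"

definition content :: "box \<Rightarrow> int" where
  "content \<alpha> = int (snd \<alpha>) - int (fst \<alpha>)"

section \<open>Double symmetric functions\<close>

text \<open>
  The coefficient ring \<open>\<int>[a]\<close>, with variables indexed by all integers, and polynomials over it in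
  variables indexed by naturals, of which only those with positive index are used. Both are
  represented as finitely supported maps from monomials to coefficients.
\<close>

type_synonym apoly = "(int \<Rightarrow>\<^sub>0 nat) \<Rightarrow>\<^sub>0 int"
type_synonym xpoly = "(nat \<Rightarrow>\<^sub>0 nat) \<Rightarrow>\<^sub>0 apoly"

definition avar :: "int \<Rightarrow> apoly" where
  "avar i = Poly_Mapping.single (Poly_Mapping.single i 1) 1"

definition xvar :: "nat \<Rightarrow> xpoly" where
  "xvar i = Poly_Mapping.single (Poly_Mapping.single i 1) 1"

definition cst :: "apoly \<Rightarrow> xpoly" where
  "cst c = Poly_Mapping.single 0 c"

definition xsubst :: "(nat \<Rightarrow> xpoly) \<Rightarrow> xpoly \<Rightarrow> xpoly" where
  "xsubst f P =
     (\<Sum>m\<in>Poly_Mapping.keys P. cst (Poly_Mapping.lookup P m) *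
        (\<Prod>i\<in>Poly_Mapping.keys m. f i ^ Poly_Mapping.lookup m i))"

definition symmetric_polys :: "nat \<Rightarrow> xpoly set" where
  "symmetric_polys n =
     {P. (\<forall>m\<in>Poly_Mapping.keys P. Poly_Mapping.keys m \<subseteq> {1..n}) \<and>
         (\<forall>\<pi>. \<pi> permutes {1..n} \<longrightarrow> xsubst (xvar \<circ> \<pi>) P = P)}"

definition xdegree_le :: "nat \<Rightarrow> xpoly \<Rightarrow> bool" where
  "xdegree_le d P \<longleftrightarrow>
     (\<forall>m\<in>Poly_Mapping.keys P. (\<Sum>i\<in>Poly_Mapping.keys m. Poly_Mapping.lookup m i) \<le> d)"

definition restrict_last :: "nat \<Rightarrow> xpoly \<Rightarrow> xpoly" where
  "restrict_last n = xsubst (xvar(n := cst (avar (int n))))"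

text \<open>
  The ring \<open>\<Lambda>(a)\<close>: compatible sequences of symmetric polynomials. The inverse limit is taken in
  filtered rings, so the degrees in the \<open>x\<^sub>i\<close> of the members of a sequence are bounded by a
  common \<open>d\<close>. The ring operations are the pointwise ones on functions.
\<close>

type_synonym xseq = "nat \<Rightarrow> xpoly"

definition Lambda :: "xseq set" where
  "Lambda =
     {P. (\<forall>n. P n \<in> symmetric_polys n) \<and>
         (\<forall>n\<ge>1. restrict_last n (P n) = P (n - 1)) \<and>
         (\<exists>d. \<forall>n. xdegree_le d (P n))}"

definition scalar :: "apoly \<Rightarrow> xseq" where
  "scalar c = (\<lambda>n. cst c)"

text \<open>
  The list \<open>is\<close> is the index sequence \<open>i\<^sub>1 \<ge> \<dots> \<ge> i\<^sub>p\<close> with \<open>is ! k\<close> standing for the index with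
  subscript \<open>k + 1\<close>, so the variable \<open>a\<close> in the corresponding factor has index \<open>is ! k - k\<close>.
\<close>

definition hpoly :: "nat \<Rightarrow> nat \<Rightarrow> xpoly" where
  "hpoly n p =
     (\<Sum>is \<in> {is. length is = p \<and> set is \<subseteq> {1..n} \<and> sorted_wrt (\<ge>) is}.
        \<Prod>k<p. xvar (is ! k) - cst (avar (int (is ! k) - int k)))"

definition hfun :: "int \<Rightarrow> xseq" where
  "hfun r = (if r < 0 then 0 else (\<lambda>n. hpoly n (nat r)))"

text \<open>
  \<open>\<tau>\<close> is the ring automorphism of \<open>\<Lambda>(a)\<close> given on generators; its values outside \<open>Lambda\<close> are
  irrelevant.
\<close>

definition is_shift :: "(xseq \<Rightarrow> xseq) \<Rightarrow> bool" where
  "is_shift \<tau> \<longleftrightarrow>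
     bij_betw \<tau> Lambda Lambda \<and>
     \<tau> 1 = 1 \<and>
     (\<forall>f\<in>Lambda. \<forall>g\<in>Lambda. \<tau> (f + g) = \<tau> f + \<tau> g \<and> \<tau> (f * g) = \<tau> f * \<tau> g) \<and>
     (\<forall>i. \<tau> (scalar (avar i)) = scalar (avar (i + 1))) \<and>
     (\<forall>p\<ge>1. \<tau> (hfun p) = hfun p + scalar (avar (2 - p)) * hfun (p - 1))"

definition hshift :: "(xseq \<Rightarrow> xseq) \<Rightarrow> int \<Rightarrow> nat \<Rightarrow> xseq" where
  "hshift \<tau> r s = (\<tau> ^^ s) (hfun r)"

text \<open>Matrix indices start at 0, hence the shift of the row index of \<open>lam\<close>.\<close>

definition double_schur :: "(xseq \<Rightarrow> xseq) \<Rightarrow> (nat \<Rightarrow> nat) \<Rightarrow> xseq" where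
  "double_schur \<tau> lam =
     det (mat (len lam) (len lam) (\<lambda>(i, j). hshift \<tau> (int (lam (i + 1)) + int j - int i) j))"

text \<open>
  The coefficients in the expansion of \<open>s\<^sub>\<lambda> s\<^sub>\<mu>\<close> in the basis of double Schur functions, as a
  finitely supported family indexed by partitions.
\<close>

definition LR_poly ::
    "(xseq \<Rightarrow> xseq) \<Rightarrow> (nat \<Rightarrow> nat) \<Rightarrow> (nat \<Rightarrow> nat) \<Rightarrow> (nat \<Rightarrow> nat) \<Rightarrow> apoly" where
  "LR_poly \<tau> lam \<mu> =
     (THE c. finite {\<nu>. c \<nu> \<noteq> 0} \<and>
             (\<forall>\<nu>. c \<nu> \<noteq> 0 \<longrightarrow> is_partition \<nu>) \<and>
             double_schur \<tau> lam * double_schur \<tau> \<mu> =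
               (\<Sum>\<nu> | c \<nu> \<noteq> 0. scalar (c \<nu>) * double_schur \<tau> \<nu>))"

section \<open>Tableaux\<close>

datatype entry = Unbarred (val: nat) | Barred (val: nat)

definition is_barred :: "entry \<Rightarrow> bool" where
  "is_barred e \<longleftrightarrow> (\<exists>k. e = Barred k)"

text \<open>
  Fillings are extensional functions (\<open>undefined\<close> outside the diagram), so that distinct functions
  represent distinct tableaux.
\<close>

definition reverse_tableaux :: "(nat \<Rightarrow> nat) \<Rightarrow> (box \<Rightarrow> entry) set" where
  "reverse_tableaux lam =
     {T \<in> diagram lam \<rightarrow>\<^sub>E {e. 1 \<le> val e}.
        \<forall>i j j'. (i, j) \<in> diagram lam \<and> (i, j') \<in> diagram lam \<and> j < j' \<longrightarrow>
          val (T (i, j')) \<le> val (T (i, j))}"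

definition column_strict :: "(nat \<Rightarrow> nat) \<Rightarrow> (box \<Rightarrow> entry) \<Rightarrow> bool" where
  "column_strict lam T \<longleftrightarrow>
     (\<forall>i i' j. (i, j) \<in> diagram lam \<and> (i', j) \<in> diagram lam \<and> i < i' \<longrightarrow>
        val (T (i', j)) < val (T (i, j)))"

definition row_order :: "(nat \<Rightarrow> nat) \<Rightarrow> box list" where
  "row_order lam = [(i, j). i \<leftarrow> rev [1..<len lam + 1], j \<leftarrow> [1..<lam i + 1]]"

text \<open>For a partition, the columns are those numbered \<open>1, \<dots>, lam 1\<close>.\<close>

definition column_order :: "(nat \<Rightarrow> nat) \<Rightarrow> box list" where
  "column_order lam =
     [(i, j). j \<leftarrow> [1..<lam 1 + 1], i \<leftarrow> rev [1..<len lam + 1], (i, j) \<in> diagram lam]"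

definition barred_word :: "(box \<Rightarrow> entry) \<Rightarrow> box list \<Rightarrow> nat list" where
  "barred_word T bs = map val (filter is_barred (map T bs))"

definition column_word :: "(nat \<Rightarrow> nat) \<Rightarrow> (box \<Rightarrow> entry) \<Rightarrow> nat list" where
  "column_word lam T = barred_word T (column_order lam)"

definition row_word_upto :: "(nat \<Rightarrow> nat) \<Rightarrow> (box \<Rightarrow> entry) \<Rightarrow> box \<Rightarrow> nat list" where
  "row_word_upto lam T \<alpha> = barred_word T (takeWhile (\<lambda>\<beta>. \<beta> \<noteq> \<alpha>) (row_order lam) @ [\<alpha>])"

definition add_box :: "nat \<Rightarrow> (nat \<Rightarrow> nat) \<Rightarrow> (nat \<Rightarrow> nat)" where
  "add_box k \<rho> = \<rho>(k := \<rho> k + 1)"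

definition apply_word :: "nat list \<Rightarrow> (nat \<Rightarrow> nat) \<Rightarrow> (nat \<Rightarrow> nat)" where
  "apply_word S \<mu> = fold add_box S \<mu>"

definition yamanouchi :: "nat list \<Rightarrow> (nat \<Rightarrow> nat) \<Rightarrow> bool" where
  "yamanouchi S \<mu> \<longleftrightarrow> (\<forall>i\<le>length S. is_partition (apply_word (take i S) \<mu>))"

definition rho_row ::
    "(nat \<Rightarrow> nat) \<Rightarrow> (nat \<Rightarrow> nat) \<Rightarrow> (box \<Rightarrow> entry) \<Rightarrow> box \<Rightarrow> (nat \<Rightarrow> nat)" where
  "rho_row lam \<mu> T \<alpha> = apply_word (row_word_upto lam T \<alpha>) \<mu>"

definition LR_tableaux ::
    "(nat \<Rightarrow> nat) \<Rightarrow> (nat \<Rightarrow> nat) \<Rightarrow> (nat \<Rightarrow> nat) \<Rightarrow> (box \<Rightarrow> entry) set" where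
  "LR_tableaux lam \<mu> \<nu> =
     {T \<in> reverse_tableaux lam.
        apply_word (column_word lam T) \<mu> = \<nu> \<and>
        yamanouchi (column_word lam T) \<mu> \<and>
        column_strict lam T}"

definition tableau_weight ::
    "(nat \<Rightarrow> nat) \<Rightarrow> (nat \<Rightarrow> nat) \<Rightarrow> (box \<Rightarrow> entry) \<Rightarrow> apoly" where
  "tableau_weight lam \<mu> T =
     (\<Prod>\<alpha> \<in> {\<alpha> \<in> diagram lam. \<not> is_barred (T \<alpha>)}.
        avar (int (val (T \<alpha>)) - int (rho_row lam \<mu> T \<alpha> (val (T \<alpha>)))) -
        avar (int (val (T \<alpha>)) - content \<alpha>))"

end

theory Submission
  imports Defs "HOL-Computational_Algebra.Formal_Power_Series"
begin

text \<open>
  Fix a large \<open>n\<close> and write \<open>A\<^sub>\<nu>\<close> for the alternating sum, over all permutations of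
  \<open>x\<^sub>1, \<dots>, x\<^sub>n\<close>, of the factorial monomial \<open>\<Prod>\<^sub>k \<Prod>\<^sub>c (x\<^sub>k - a\<^sub>c)\<close>, where \<open>c\<close> runs from
  \<open>k + 1 - \<nu>\<^sub>k\<close> to \<open>n\<close>. The Jacobi-Trudi determinant becomes a quotient of alternants:
  \<open>s\<^sub>\<nu> A\<^sub>0 = A\<^sub>\<nu>\<close> (\<open>double_schur_bialternant\<close>). The \<open>A\<^sub>\<nu>\<close> are linearly independent over the
  polynomials in \<open>a\<close> (\<open>alternants_independent\<close>), so the Littlewood-Richardson polynomials are the
  coefficients in the expansion of \<open>s\<^sub>\<lambda> A\<^sub>\<mu>\<close> into alternants. An identity in \<open>Lambda\<close> that holds at
  all large \<open>n\<close> holds at all \<open>n\<close>, because each member of a compatible sequence determines those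
  before it.

  Let \<open>S\<close> be the sum, over all column strict reverse fillings of \<open>\<lambda>\<close> with letters \<open>1, \<dots>, n\<close>, of the
  products of \<open>x\<^sub>k - a\<^bsub>k-c\<^esub>\<close> over the boxes, \<open>k\<close> being the letter and \<open>c\<close> the content. Multiply the
  factorial monomial of \<open>\<mu>\<close> by these factors one box at a time, in column order. If \<open>\<rho>\<close> is the
  current shape, then
  \<open>x\<^sub>k - a\<^bsub>k-c\<^esub> = (x\<^sub>k - a\<^bsub>k-\<rho>(k)\<^esub>) + (a\<^bsub>k-\<rho>(k)\<^esub> - a\<^bsub>k-c\<^esub>)\<close>:
  the first summand extends row \<open>k\<close> of the factorial monomial by one box, the second is a scalar. So
  every box is either barred and moves \<open>\<rho>\<close>, or unbarred and contributes exactly the weight of the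
  theorem. This expands \<open>S A\<^sub>\<mu>\<close> over all barred fillings, and those that are not Yamanouchi
  cancel by Stembridge's argument: when a barred \<open>k\<close> turns a partition into a non-partition, the
  factorial monomial becomes symmetric in \<open>x\<^bsub>k-1\<^esub>\<close> and \<open>x\<^sub>k\<close>; so does the sum of the remaining
  factors over all fillings with the same beginning, by a Bender-Knuth argument; hence the
  alternating sum vanishes (\<open>bad_class_sum\<close>). In the presence of contents, the Bender-Knuth
  involution does not preserve individual terms, only the sum over the two letters in each row is
  symmetric (\<open>free_sum_symmetric\<close>).

  For \<open>\<mu> = 0\<close> only one Yamanouchi tableau has nonzero weight, and the expansion reads
  \<open>S A\<^sub>0 = A\<^sub>\<lambda>\<close>. Therefore \<open>S = s\<^sub>\<lambda>\<close>: the tableau formula for double Schur functions is itself a case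
  of the expansion. Finally, the weights of the theorem refer to the row order, not the column order;
  but boxes of a column strict filling that carry equal letters are met in the same sequence in both
  orders, and the weight of a box with letter \<open>k\<close> depends only on row \<open>k\<close> of the current shape
  (\<open>count_before\<close>).
\<close>

section \<open>Two letters in a row-convex set of boxes\<close>

text \<open>
  The variables are numbered from 0, so that a letter \<open>k\<close> refers to \<open>x (k - 1)\<close>; this makes
  alternants determinants of matrices with the usual index set \<open>{0..<n}\<close>.
\<close>

definition box_factor :: "(int \<Rightarrow> 'r::comm_ring_1) \<Rightarrow> (nat \<Rightarrow> 'r) \<Rightarrow> nat \<Rightarrow> box \<Rightarrow> 'r" where
  "box_factor a x k \<beta> = x (k - 1) - a (int k - content \<beta>)"

text \<open>
  A row with room for \<open>r\<close> letters, each of them the larger or the smaller of two neighbours, reads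
  \<open>p\<close> larger letters and then \<open>r - p\<close> smaller ones. The index of \<open>b\<close> is shifted in the second product
  because lowering the letter by one acts like raising the content by one. Multiplication by \<open>X - Y\<close>
  makes the sum telescope to a difference that changes sign under the exchange of \<open>X\<close> and \<open>Y\<close>.
\<close>

lemma two_letter_row_symmetric:
  fixes X Y :: "'r::idom" and b :: "nat \<Rightarrow> 'r" and r :: nat
  defines "R \<equiv> \<lambda>X Y. \<Sum>p\<le>r. (\<Prod>t<p. X - b t) * (\<Prod>t\<in>{p..<r}. Y - b (Suc t))"
  shows "R X Y = R Y X"
proof (cases "X = Y")
  case False
  have tel: "(X - Y) * R X Y = (\<Prod>t<Suc r. X - b t) - (\<Prod>t<Suc r. Y - b t)" for X Y
  proof -
    define g where "g p = (\<Prod>t<p. X - b t) * (\<Prod>t\<in>{p..<Suc r}. Y - b t)" for p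
    have "(X - Y) * ((\<Prod>t<p. X - b t) * (\<Prod>t\<in>{p..<r}. Y - b (Suc t))) = g (Suc p) - g p"
      if "p \<le> r" for p
    proof -
      have s: "(\<Prod>t\<in>{p..<r}. Y - b (Suc t)) = (\<Prod>t\<in>{Suc p..<Suc r}. Y - b t)"
        by (rule prod.shift_bounds_Suc_ivl[symmetric])
      have s2: "(\<Prod>t\<in>{p..<Suc r}. Y - b t) = (Y - b p) * (\<Prod>t\<in>{Suc p..<Suc r}. Y - b t)"
        by (rule prod.atLeast_Suc_lessThan) (use that in simp)
      show ?thesis unfolding g_def s s2 prod.lessThan_Suc by (simp add: algebra_simps)
    qed
    then have "(X - Y) * R X Y = (\<Sum>p<Suc r. g (Suc p) - g p)"
      unfolding R_def lessThan_Suc_atMost sum_distrib_left by (intro sum.cong) auto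
    also have "\<dots> = g (Suc r) - g 0" by (rule sum_lessThan_telescope)
    finally show ?thesis by (simp add: g_def lessThan_atLeast0)
  qed
  have "(X - Y) * R X Y = (X - Y) * R Y X"
  proof -
    have "(X - Y) * R X Y = - ((Y - X) * R Y X)" unfolding tel by simp
    then show ?thesis by (simp add: algebra_simps)
  qed
  with False show ?thesis by simp
qed simp

text \<open>
  A weakly decreasing choice between two letters on the boxes of \<open>R\<close> is the set of boxes with the
  larger letter, and this set is closed to the left in every row.
\<close>

definition left_closed_subsets :: "box set \<Rightarrow> box set set" where
  "left_closed_subsets R =
     {B. B \<subseteq> R \<and> (\<forall>i j j'. (i, j') \<in> B \<longrightarrow> j < j' \<longrightarrow> (i, j) \<in> R \<longrightarrow> (i, j) \<in> B)}"

definition row_convex :: "box set \<Rightarrow> bool" where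
  "row_convex R \<longleftrightarrow>
     (\<forall>i j j' j''. (i, j) \<in> R \<longrightarrow> (i, j'') \<in> R \<longrightarrow> j < j' \<longrightarrow> j' < j'' \<longrightarrow> (i, j') \<in> R)"

definition free_sum :: "(int \<Rightarrow> 'r::comm_ring_1) \<Rightarrow> int \<Rightarrow> 'r \<Rightarrow> 'r \<Rightarrow> box set \<Rightarrow> 'r" where
  "free_sum a k X Y R =
     (\<Sum>B\<in>left_closed_subsets R.
        (\<Prod>\<beta>\<in>B. X - a (k - content \<beta>)) * (\<Prod>\<beta>\<in>R - B. Y - a (k - 1 - content \<beta>)))"

lemma convex_interval:
  fixes S :: "nat set"
  assumes "finite S" "S \<noteq> {}" and "\<And>j j' j''. j \<in> S \<Longrightarrow> j'' \<in> S \<Longrightarrow> j < j' \<Longrightarrow> j' < j'' \<Longrightarrow> j' \<in> S"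
  obtains j0 r where "S = {j0..<j0 + r}"
proof -
  have "S = {Min S..<Min S + (Suc (Max S) - Min S)}"
  proof
    show "S \<subseteq> {Min S..<Min S + (Suc (Max S) - Min S)}"
    proof
      fix j assume "j \<in> S"
      then have "Min S \<le> j" "j \<le> Max S" using assms(1) by auto
      then show "j \<in> {Min S..<Min S + (Suc (Max S) - Min S)}" by auto
    qed
    show "{Min S..<Min S + (Suc (Max S) - Min S)} \<subseteq> S"
    proof
      fix j assume "j \<in> {Min S..<Min S + (Suc (Max S) - Min S)}"
      then have "Min S \<le> j" "j \<le> Max S" by auto
      moreover have "Min S \<in> S" "Max S \<in> S" using assms by auto
      ultimately show "j \<in> S" using assms(3)[of "Min S" "Max S" j]
        by (cases "j = Min S \<or> j = Max S") auto
    qed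
  qed
  then show ?thesis by (rule that)
qed

lemma free_sum_one_row:
  fixes X Y :: "'r::idom"
  assumes "finite R" "row_convex R" "\<And>\<beta>. \<beta> \<in> R \<Longrightarrow> fst \<beta> = i"
  shows "free_sum a k X Y R = free_sum a k Y X R"
proof (cases "R = {}")
  case True
  have "left_closed_subsets R = {{}}" using True by (auto simp: left_closed_subsets_def)
  then show ?thesis using True by (simp add: free_sum_def)
next
  case False
  define S where "S = snd ` R"
  have RS: "R = Pair i ` S"
    unfolding S_def
  proof
    show "R \<subseteq> Pair i ` snd ` R"
    proof
      fix \<beta> assume b: "\<beta> \<in> R"
      then have "\<beta> = (i, snd \<beta>)" using assms(3)[OF b] by (cases \<beta>) auto
      with b show "\<beta> \<in> Pair i ` snd ` R" by blast
    qed
    show "Pair i ` snd ` R \<subseteq> R"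
    proof
      fix \<beta> assume "\<beta> \<in> Pair i ` snd ` R"
      then obtain \<gamma> where g: "\<gamma> \<in> R" "\<beta> = (i, snd \<gamma>)" by auto
      then show "\<beta> \<in> R" using assms(3)[OF g(1)] by (cases \<gamma>) auto
    qed
  qed
  have S: "finite S" "S \<noteq> {}" using assms(1) False by (auto simp: S_def)
  have conv: "j' \<in> S" if "j \<in> S" "j'' \<in> S" "j < j'" "j' < j''" for j j' j''
    using assms(2) that unfolding row_convex_def RS by blast
  obtain j0 r where Sr: "S = {j0..<j0 + r}" by (rule convex_interval[OF S conv])
  define D where "D p = Pair i ` {j0..<j0 + p}" for p
  have inj: "inj_on D {..r}"
  proof (rule inj_onI)
    fix p q assume "D p = D q"
    then have "card (D p) = card (D q)" by simp
    then show "p = q" by (simp add: D_def card_image inj_on_def)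
  qed
  have LC: "left_closed_subsets R = D ` {..r}"
  proof
    show "D ` {..r} \<subseteq> left_closed_subsets R"
      by (auto simp: left_closed_subsets_def D_def RS Sr)
    show "left_closed_subsets R \<subseteq> D ` {..r}"
    proof
      fix B assume B: "B \<in> left_closed_subsets R"
      then have BR: "B \<subseteq> R" and cl: "\<And>j j'. (i, j') \<in> B \<Longrightarrow> j < j' \<Longrightarrow> (i, j) \<in> R \<Longrightarrow> (i, j) \<in> B"
        by (auto simp: left_closed_subsets_def)
      define T where "T = {j. (i, j) \<in> B}"
      have BT: "B = Pair i ` T" using BR by (auto simp: T_def RS)
      have TS: "T \<subseteq> S" using BR by (auto simp: T_def RS)
      show "B \<in> D ` {..r}"
      proof (cases "T = {}")
        case True
        then have "B = D 0" by (simp add: BT D_def)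
        then show ?thesis by auto
      next
        case False
        have fin: "finite T" using TS S finite_subset by blast
        have mx: "Max T \<in> T" using fin False by simp
        have "T = {j0..<j0 + (Suc (Max T) - j0)}"
        proof
          show "T \<subseteq> {j0..<j0 + (Suc (Max T) - j0)}"
          proof
            fix t assume t: "t \<in> T"
            then have "t \<le> Max T" "t \<ge> j0" using fin TS Sr by auto
            then show "t \<in> {j0..<j0 + (Suc (Max T) - j0)}" by auto
          qed
          show "{j0..<j0 + (Suc (Max T) - j0)} \<subseteq> T"
          proof
            fix t assume "t \<in> {j0..<j0 + (Suc (Max T) - j0)}"
            then have t: "j0 \<le> t" "t \<le> Max T" by auto
            have "Max T \<in> S" using mx TS by auto
            then have "t \<in> S" using t Sr by auto
            then show "t \<in> T" using cl[of "Max T" t] mx t by (cases "t = Max T") (auto simp: T_def RS)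
          qed
        qed
        then have "B = D (Suc (Max T) - j0)" by (simp add: BT D_def)
        moreover have "Suc (Max T) - j0 \<le> r" using subsetD[OF TS mx] unfolding Sr by auto
        ultimately show ?thesis by auto
      qed
    qed
  qed
  define b where "b t = a (k - (int (j0 + t) - int i))" for t
  have val: "free_sum a k X Y R =
      (\<Sum>p\<le>r. (\<Prod>t<p. X - b t) * (\<Prod>t\<in>{p..<r}. Y - b (Suc t)))" for X Y
  proof -
    have "(\<Prod>\<beta>\<in>D p. X - a (k - content \<beta>)) = (\<Prod>t<p. X - b t)" for p
      by (rule prod.reindex_bij_witness[of _ "\<lambda>t. (i, j0 + t)" "\<lambda>\<beta>. snd \<beta> - j0"])
        (auto simp: D_def b_def content_def)
    moreover have "(\<Prod>\<beta>\<in>R - D p. Y - a (k - 1 - content \<beta>)) = (\<Prod>t\<in>{p..<r}. Y - b (Suc t))"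
      if "p \<le> r" for p
      by (rule prod.reindex_bij_witness[of _ "\<lambda>t. (i, j0 + t)" "\<lambda>\<beta>. snd \<beta> - j0"])
        (use that in \<open>auto simp: D_def b_def content_def RS Sr algebra_simps\<close>)
    ultimately show ?thesis
      unfolding free_sum_def LC sum.reindex[OF inj] o_def by (intro sum.cong) auto
  qed
  show ?thesis unfolding val by (rule two_letter_row_symmetric)
qed

text \<open>
  Choices in different rows are independent, which reduces symmetry to a single row.
\<close>

lemma free_sum_Un:
  assumes "finite R" "finite R'" "fst ` R \<inter> fst ` R' = {}"
  shows "free_sum a k X Y (R \<union> R') = free_sum a k X Y R * free_sum a k X Y R'"
proof -
  have disj: "R \<inter> R' = {}" using assms(3) by auto
  let ?f = "\<lambda>R B. (\<Prod>\<beta>\<in>B. X - a (k - content \<beta>)) * (\<Prod>\<beta>\<in>R - B. Y - a (k - 1 - content \<beta>))"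
  have rows: "(i, j) \<in> R \<Longrightarrow> (i, j') \<notin> R'" for i j j'
    using assms(3) by (force simp: image_iff)
  have "free_sum a k X Y (R \<union> R') =
     (\<Sum>(B, B')\<in>left_closed_subsets R \<times> left_closed_subsets R'. ?f R B * ?f R' B')"
    unfolding free_sum_def
  proof (rule sum.reindex_bij_witness[of _ "\<lambda>(B, B'). B \<union> B'" "\<lambda>B. (B \<inter> R, B \<inter> R')"])
    fix B assume B: "B \<in> left_closed_subsets (R \<union> R')"
    then have sub: "B \<subseteq> R \<union> R'" by (auto simp: left_closed_subsets_def)
    then show "(case (B \<inter> R, B \<inter> R') of (B, B') \<Rightarrow> B \<union> B') = B" by auto
    show "(B \<inter> R, B \<inter> R') \<in> left_closed_subsets R \<times> left_closed_subsets R'"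
      using B unfolding left_closed_subsets_def mem_Times_iff fst_conv snd_conv mem_Collect_eq
      by (intro conjI) (simp, meson IntD1 IntI UnI1 IntD2, simp, meson IntD1 IntI UnI2 IntD2)
    have p1: "prod g B = prod g (B \<inter> R) * prod g (B \<inter> R')" for g :: "box \<Rightarrow> 'a"
    proof -
      have "B = (B \<inter> R) \<union> (B \<inter> R')" using sub by auto
      then show ?thesis using prod.union_disjoint[of "B \<inter> R" "B \<inter> R'" g] assms disj by auto
    qed
    have p2: "prod g (R \<union> R' - B) = prod g (R - B \<inter> R) * prod g (R' - B \<inter> R')" for g :: "box \<Rightarrow> 'a"
    proof -
      have "R \<union> R' - B = (R - B \<inter> R) \<union> (R' - B \<inter> R')" by auto
      then show ?thesis using prod.union_disjoint[of "R - B \<inter> R" "R' - B \<inter> R'" g] assms disj by auto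
    qed
    show "(case (B \<inter> R, B \<inter> R') of (B, B') \<Rightarrow> ?f R B * ?f R' B') = ?f (R \<union> R') B"
      unfolding p1 p2 by (simp add: algebra_simps)
  next
    fix b assume "b \<in> left_closed_subsets R \<times> left_closed_subsets R'"
    then obtain B B' where b: "b = (B, B')"
      and B: "B \<in> left_closed_subsets R" "B' \<in> left_closed_subsets R'" by auto
    have sub: "B \<subseteq> R" "B' \<subseteq> R'" using B by (simp_all add: left_closed_subsets_def)
    show "((case b of (B, B') \<Rightarrow> B \<union> B') \<inter> R, (case b of (B, B') \<Rightarrow> B \<union> B') \<inter> R') = b"
      unfolding b using sub disj by auto
    have "(i, j) \<in> B \<union> B'" if "(i, j') \<in> B \<union> B'" "j < j'" "(i, j) \<in> R \<union> R'" for i j j'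
    proof (cases "(i, j') \<in> B")
      case True
      then have "(i, j) \<in> R" using that(3) sub(1) rows by blast
      then show ?thesis using True that(2) B(1) unfolding left_closed_subsets_def by blast
    next
      case False
      then have *: "(i, j') \<in> B'" using that(1) by simp
      then have "(i, j) \<in> R'" using that(3) sub(2) rows by blast
      then show ?thesis using * that(2) B(2) unfolding left_closed_subsets_def by blast
    qed
    then show "(case b of (B, B') \<Rightarrow> B \<union> B') \<in> left_closed_subsets (R \<union> R')"
      unfolding b left_closed_subsets_def using sub by auto
  qed
  also have "\<dots> = free_sum a k X Y R * free_sum a k X Y R'"
    unfolding free_sum_def sum_product sum.cartesian_product by simp
  finally show ?thesis .
qed

lemma free_sum_symmetric:
  fixes X Y :: "'r::idom"
  assumes "finite R" "row_convex R"
  shows "free_sum a k X Y R = free_sum a k Y X R"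
proof -
  have rows: "free_sum a k X Y {\<beta>\<in>R. fst \<beta> \<in> I} = free_sum a k Y X {\<beta>\<in>R. fst \<beta> \<in> I}" if "finite I" for I
    using that
  proof (induction I)
    case empty
    have "{\<beta>\<in>R. fst \<beta> \<in> {}} = {}" by simp
    then show ?case by (metis free_sum_one_row row_convex_def empty_iff finite.emptyI)
  next
    case (insert i I)
    have e: "{\<beta>\<in>R. fst \<beta> \<in> insert i I} = {\<beta>\<in>R. fst \<beta> = i} \<union> {\<beta>\<in>R. fst \<beta> \<in> I}" by auto
    have "row_convex {\<beta>\<in>R. fst \<beta> = i}"
      unfolding row_convex_def
    proof (intro allI impI)
      fix i' j j' j'' assume "(i', j) \<in> {\<beta>\<in>R. fst \<beta> = i}" "(i', j'') \<in> {\<beta>\<in>R. fst \<beta> = i}" "j < j'" "j' < j''"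
      then show "(i', j') \<in> {\<beta>\<in>R. fst \<beta> = i}"
        using assms(2)[unfolded row_convex_def, rule_format, of i' j j'' j'] by auto
    qed
    then have one: "free_sum a k X Y {\<beta>\<in>R. fst \<beta> = i} = free_sum a k Y X {\<beta>\<in>R. fst \<beta> = i}"
      using assms(1) by (intro free_sum_one_row[of _ i]) auto
    have d: "fst ` {\<beta>\<in>R. fst \<beta> = i} \<inter> fst ` {\<beta>\<in>R. fst \<beta> \<in> I} = {}" using insert by auto
    show ?case unfolding e
      using assms(1) by (simp add: free_sum_Un[OF _ _ d] one insert.IH)
  qed
  have all: "{\<beta>\<in>R. fst \<beta> \<in> fst ` R} = R" by auto
  show ?thesis using rows[OF finite_imageI[OF assms(1), of fst]] unfolding all .
qed

section \<open>Column strict fillings and Bender-Knuth classes\<close>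

definition strict_fillings :: "nat \<Rightarrow> (nat \<Rightarrow> nat) \<Rightarrow> (box \<Rightarrow> nat) set" where
  "strict_fillings n lam =
     {U \<in> diagram lam \<rightarrow>\<^sub>E {1..n}.
        (\<forall>i j j'. (i, j) \<in> diagram lam \<longrightarrow> (i, j') \<in> diagram lam \<longrightarrow> j < j' \<longrightarrow> U (i, j') \<le> U (i, j)) \<and>
        (\<forall>i i' j. (i, j) \<in> diagram lam \<longrightarrow> (i', j) \<in> diagram lam \<longrightarrow> i < i' \<longrightarrow> U (i', j) < U (i, j))}"

lemma partition_antimono:
  assumes "is_partition lam" "1 \<le> i" "i \<le> i'"
  shows "lam i' \<le> lam i"
  using assms(3)
proof (induction i' rule: dec_induct)
  case (step m)
  then have "lam (Suc m) \<le> lam m" using assms by (auto simp: is_partition_def)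
  with step show ?case by simp
qed simp

lemma diagram_down_closed:
  assumes "is_partition lam" "(i, j) \<in> diagram lam" "1 \<le> i'" "i' \<le> i" "1 \<le> j'" "j' \<le> j"
  shows "(i', j') \<in> diagram lam"
  using assms partition_antimono[OF assms(1), of i' i] by (auto simp: diagram_def)

lemma finite_diagram: "is_composition lam \<Longrightarrow> finite (diagram lam)"
proof -
  assume c: "is_composition lam"
  have "diagram lam = (SIGMA i:{i. lam i \<noteq> 0}. {1..lam i})"
  proof
    show "diagram lam \<subseteq> (SIGMA i:{i. lam i \<noteq> 0}. {1..lam i})"
      by (auto simp: diagram_def)
    show "(SIGMA i:{i. lam i \<noteq> 0}. {1..lam i}) \<subseteq> diagram lam"
    proof
      fix \<beta> assume "\<beta> \<in> (SIGMA i:{i. lam i \<noteq> 0}. {1..lam i})"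
      then obtain i j where ij: "\<beta> = (i, j)" "lam i \<noteq> 0" "1 \<le> j" "j \<le> lam i" by auto
      then have "i \<noteq> 0" using c by (metis is_composition_def)
      then show "\<beta> \<in> diagram lam" using ij by (auto simp: diagram_def)
    qed
  qed
  then show ?thesis using c by (auto simp: is_composition_def)
qed

lemma finite_diagram_partition: "is_partition lam \<Longrightarrow> finite (diagram lam)"
  by (simp add: is_partition_def finite_diagram)

lemma finite_strict_fillings: "is_partition lam \<Longrightarrow> finite (strict_fillings n lam)"
  by (rule finite_subset[OF _ finite_PiE[of "diagram lam" "\<lambda>_. {1..n}"]])
    (simp_all add: strict_fillings_def finite_diagram_partition Collect_conj_eq)

lemma
  assumes "U \<in> strict_fillings n lam"
  shows strict_fillings_row: "(i, j) \<in> diagram lam \<Longrightarrow> (i, j') \<in> diagram lam \<Longrightarrow> j \<le> j' \<Longrightarrow> U (i, j') \<le> U (i, j)"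
    and strict_fillings_col: "(i, j) \<in> diagram lam \<Longrightarrow> (i', j) \<in> diagram lam \<Longrightarrow> i < i' \<Longrightarrow> U (i', j) < U (i, j)"
    and strict_fillings_range: "\<beta> \<in> diagram lam \<Longrightarrow> 1 \<le> U \<beta> \<and> U \<beta> \<le> n"
    and strict_fillings_ext: "\<beta> \<notin> diagram lam \<Longrightarrow> U \<beta> = undefined"
proof -
  show "U (i, j') \<le> U (i, j)" if "(i, j) \<in> diagram lam" "(i, j') \<in> diagram lam" "j \<le> j'"
    using assms that by (cases "j = j'") (auto simp: strict_fillings_def)
  show "U (i', j) < U (i, j)" if "(i, j) \<in> diagram lam" "(i', j) \<in> diagram lam" "i < i'"
    using assms that unfolding strict_fillings_def by blast
  show "\<beta> \<in> diagram lam \<Longrightarrow> 1 \<le> U \<beta> \<and> U \<beta> \<le> n"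
    using assms by (auto simp: strict_fillings_def PiE_iff)
  have "U \<in> diagram lam \<rightarrow>\<^sub>E {1..n}" using assms by (simp add: strict_fillings_def)
  then show "\<beta> \<notin> diagram lam \<Longrightarrow> U \<beta> = undefined" by (rule PiE_arb)
qed

text \<open>
  Forgetting the difference between \<open>k - 1\<close> and \<open>k\<close>: fillings with the same collapse and the same
  first \<open>j0\<close> columns form one Bender-Knuth class.
\<close>

definition collapse :: "nat \<Rightarrow> nat \<Rightarrow> nat" where
  "collapse k e = (if e = k - 1 then k else e)"

text \<open>
  The columns up to \<open>j0\<close> are frozen. If column \<open>j0\<close> contains the letter \<open>k\<close>, then the frozen part puts
  no constraint on the boxes to its right that are free to change between \<open>k - 1\<close> and \<open>k\<close>; the case \<open>j0 = 0\<close> is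
  the ordinary one, where nothing is frozen.
\<close>

locale bender_knuth =
  fixes n :: nat and lam :: "nat \<Rightarrow> nat" and k j0 :: nat and U0 :: "box \<Rightarrow> nat"
  assumes lam: "is_partition lam"
    and k: "2 \<le> k" "k \<le> n"
    and U0: "U0 \<in> strict_fillings n lam"
    and hit: "j0 = 0 \<or> (\<exists>i0. (i0, j0) \<in> diagram lam \<and> U0 (i0, j0) = k)"
begin

abbreviation "d \<equiv> diagram lam"

definition bk_class :: "(box \<Rightarrow> nat) set" where
  "bk_class = {U \<in> strict_fillings n lam. \<forall>\<beta>\<in>d. (snd \<beta> \<le> j0 \<longrightarrow> U \<beta> = U0 \<beta>) \<and> collapse k (U \<beta>) = collapse k (U0 \<beta>)}"

definition moving :: "box set" where
  "moving = {\<beta> \<in> d. U0 \<beta> = k \<or> U0 \<beta> = k - 1}"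

text \<open>
  A box with letter \<open>k - 1\<close> or \<open>k\<close> is bound if the other of these letters occurs next to it in its
  column, since then column strictness determines both of them. For \<open>i = 1\<close> the box \<open>(i - 1, j)\<close> lies
  outside every diagram.
\<close>

definition free :: "box set" where
  "free = {(i, j). (i, j) \<in> moving \<and> j0 < j \<and> (Suc i, j) \<notin> moving \<and> (i - 1, j) \<notin> moving}"

lemmas row = strict_fillings_row[OF U0]
lemmas col = strict_fillings_col[OF U0]
lemmas down = diagram_down_closed[OF lam]

lemma row_pos: "(i, j) \<in> d \<Longrightarrow> 1 \<le> i \<and> 1 \<le> j"
  by (auto simp: diagram_def)

lemma finite_free: "finite free"
  by (rule finite_subset[OF _ finite_diagram_partition[OF lam]]) (simp add: free_def moving_def subset_iff)

text \<open>
  This and the next lemma say how bound boxes spread along a row: pairs bound downwards sit at its left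
  end, pairs bound upwards at its right end, and the free boxes lie in between.
\<close>

lemma below_moves_left:
  assumes "(i, j1) \<in> moving" "(i, j2) \<in> moving" "j1 < j2" "(Suc i, j2) \<in> moving"
  shows "(Suc i, j1) \<in> moving" "U0 (i, j1) = k" "U0 (i, j2) = k"
proof -
  have d: "(i, j1) \<in> d" "(i, j2) \<in> d" "(Suc i, j2) \<in> d" using assms by (auto simp: moving_def)
  have d': "(Suc i, j1) \<in> d" using down[OF d(3)] row_pos[OF d(1)] assms(3) by auto
  have "U0 (Suc i, j2) \<le> U0 (Suc i, j1)" using row[OF d' d(3)] assms(3) by simp
  moreover have "U0 (Suc i, j1) < U0 (i, j1)" "U0 (Suc i, j2) < U0 (i, j2)"
    using col[OF d(1) d'] col[OF d(2,3)] by simp_all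
  ultimately show "(Suc i, j1) \<in> moving" "U0 (i, j1) = k" "U0 (i, j2) = k"
    using assms d' k by (auto simp: moving_def)
qed

lemma above_moves_right:
  assumes "(Suc i, j1) \<in> moving" "(Suc i, j2) \<in> moving" "j1 < j2" "(i, j1) \<in> moving"
  shows "(i, j2) \<in> moving" "U0 (Suc i, j1) = k - 1" "U0 (Suc i, j2) = k - 1"
proof -
  have d: "(Suc i, j1) \<in> d" "(Suc i, j2) \<in> d" "(i, j1) \<in> d" using assms by (auto simp: moving_def)
  have d': "(i, j2) \<in> d" using down[OF d(2), of i j2] row_pos[OF d(3)] row_pos[OF d(2)] by auto
  have "U0 (i, j2) \<le> U0 (i, j1)" "U0 (Suc i, j2) \<le> U0 (Suc i, j1)"
    using row[OF d(3) d'] row[OF d(1,2)] assms(3) by simp_all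
  moreover have "U0 (Suc i, j1) < U0 (i, j1)" "U0 (Suc i, j2) < U0 (i, j2)"
    using col[OF d(3) d(1)] col[OF d' d(2)] by simp_all
  ultimately show "(i, j2) \<in> moving" "U0 (Suc i, j1) = k - 1" "U0 (Suc i, j2) = k - 1"
    using assms d' k by (auto simp: moving_def)
qed

text \<open>
  The only danger of freezing is a frozen \<open>k - 1\<close> in the row of a box that is to become \<open>k\<close>. It
  propagates to column \<open>j0\<close>, where the letter \<open>k\<close> must stand directly above it; then \<open>k\<close> also stands
  above the box in question, which is therefore bound.
\<close>

lemma frozen_blocks:
  assumes "(i, j1) \<in> d" "j1 \<le> j0" "U0 (i, j1) = k - 1" "(i, j2) \<in> d" "j0 < j2" "U0 (i, j2) = k - 1"
  shows "(i - 1, j2) \<in> moving"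
proof -
  have "j0 \<noteq> 0" using assms row_pos by fastforce
  then obtain i0 where i0: "(i0, j0) \<in> d" "U0 (i0, j0) = k" using hit by auto
  have d: "(i, j0) \<in> d" using down[OF assms(4)] row_pos[OF assms(4)] assms(5) \<open>j0 \<noteq> 0\<close> by auto
  have v: "U0 (i, j0) = k - 1"
    using row[OF assms(1) d assms(2)] row[OF d assms(4)] assms by auto
  have lt: "i0 < i"
  proof (rule ccontr)
    assume "\<not> i0 < i"
    then have "i = i0 \<or> i < i0" by auto
    then show False using col[OF d i0(1)] i0(2) v k by auto
  qed
  \<comment> \<open>No letter lies strictly between \<open>k - 1\<close> and \<open>k\<close>.\<close>
  have eq: "i0 = i - 1"
  proof (rule ccontr)
    assume "i0 \<noteq> i - 1"
    then have i': "i0 < i - 1" using lt by simp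
    have d': "(i - 1, j0) \<in> d" using down[OF d, of "i - 1" j0] i' row_pos[OF d] by auto
    show False using col[OF i0(1) d' i'] col[OF d' d] i' v i0 by auto
  qed
  have d2: "(i0, j2) \<in> d" using down[OF assms(4), of i0 j2] row_pos[OF i0(1)] row_pos[OF assms(4)] lt by auto
  have "U0 (i0, j2) \<le> k" using row[OF i0(1) d2] assms(5) i0(2) by simp
  moreover have "k - 1 < U0 (i0, j2)" using col[OF d2 assms(4) lt] assms(6) by simp
  ultimately show ?thesis using d2 unfolding moving_def eq by auto
qed

lemma row_convex_free: "row_convex free"
  unfolding row_convex_def
proof (intro allI impI)
  fix i j j' j'' assume f: "(i, j) \<in> free" "(i, j'') \<in> free" and j: "j < j'" "j' < j''"
  have m: "(i, j) \<in> moving" "(i, j'') \<in> moving" using f by (auto simp: free_def)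
  then have d: "(i, j) \<in> d" "(i, j'') \<in> d" by (auto simp: moving_def)
  have d': "(i, j') \<in> d" using down[OF d(2), of i j'] row_pos[OF d(1)] j by auto
  have "U0 (i, j') \<le> U0 (i, j)" "U0 (i, j'') \<le> U0 (i, j')" using row[OF d(1) d'] row[OF d' d(2)] j by auto
  then have m': "(i, j') \<in> moving" using m d' k by (auto simp: moving_def)
  have "(Suc i, j') \<notin> moving" using below_moves_left(1)[OF m(1) m' j(1)] f(1) by (auto simp: free_def)
  moreover have "(i - 1, j') \<notin> moving"
  proof
    assume a: "(i - 1, j') \<in> moving"
    obtain i' where "i = Suc i'" using row_pos[OF d(1)] by (cases i) auto
    then show False using above_moves_right(1)[of i' j' j''] m' m(2) j(2) a f(2) by (auto simp: free_def)
  qed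
  ultimately show "(i, j') \<in> free" using m' f(1) j by (auto simp: free_def)
qed

lemma column_pair:
  assumes "(i, j) \<in> moving" "(Suc i, j) \<in> moving"
  shows "U0 (i, j) = k" "U0 (Suc i, j) = k - 1"
  using assms col[of i j "Suc i"] k by (auto simp: moving_def)

text \<open>
  Frozen letters are fixed and bound ones are forced, so a member of the class is determined by its
  letters on the free boxes, from which \<open>refill\<close> recovers it.
\<close>

lemma class_eq_off_free:
  assumes U: "U \<in> bk_class" and b: "\<beta> \<in> d" "\<beta> \<notin> free"
  shows "U \<beta> = U0 \<beta>"
proof -
  have S: "U \<in> strict_fillings n lam" using U by (auto simp: bk_class_def)
  have coll: "collapse k (U \<gamma>) = collapse k (U0 \<gamma>)" if "\<gamma> \<in> d" for \<gamma> using U that by (auto simp: bk_class_def)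
  have mv: "U \<gamma> = k \<or> U \<gamma> = k - 1" if "\<gamma> \<in> moving" for \<gamma>
    using coll[of \<gamma>] that by (auto simp: moving_def collapse_def split: if_splits)
  obtain i j where ij: "\<beta> = (i, j)" by (cases \<beta>)
  consider "\<beta> \<notin> moving" | "j \<le> j0" | "\<beta> \<in> moving" "(Suc i, j) \<in> moving" | "\<beta> \<in> moving" "(i - 1, j) \<in> moving"
    using b ij by (auto simp: free_def)
  then show ?thesis
  proof cases
    case 1
    then show ?thesis using coll[OF b(1)] b(1) by (auto simp: moving_def collapse_def split: if_splits)
  next
    case 2
    then show ?thesis using U b ij by (auto simp: bk_class_def)
  next
    case 3
    then have "U (Suc i, j) < U (i, j)" using strict_fillings_col[OF S, of i j "Suc i"] ij by (auto simp: moving_def)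
    then show ?thesis using mv[OF 3(1)] mv[OF 3(2)] column_pair[of i j] 3 ij by auto
  next
    case 4
    then have d: "(i - 1, j) \<in> d" by (auto simp: moving_def)
    obtain i' where i': "i = Suc i'" using row_pos[OF b(1)[unfolded ij]] by (cases i) auto
    have "U (Suc i', j) < U (i', j)" using strict_fillings_col[OF S, of i' j "Suc i'"] ij d b(1) i' by auto
    then show ?thesis using mv[OF 4(1)] mv[OF 4(2)] column_pair[of i' j] 4 ij i' by auto
  qed
qed

definition refill :: "box set \<Rightarrow> box \<Rightarrow> nat" where
  "refill B = (\<lambda>\<beta>. if \<beta> \<in> free then (if \<beta> \<in> B then k else k - 1) else U0 \<beta>)"

lemma free_moving: "\<beta> \<in> free \<Longrightarrow> \<beta> \<in> moving" by (auto simp: free_def)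
lemma moving_d: "\<beta> \<in> moving \<Longrightarrow> \<beta> \<in> d" by (auto simp: moving_def)

lemma refill_row:
  assumes B: "B \<in> left_closed_subsets free" and d: "(i, j1) \<in> d" "(i, j2) \<in> d" and j: "j1 < j2"
  shows "refill B (i, j2) \<le> refill B (i, j1)"
proof -
  have le: "U0 (i, j2) \<le> U0 (i, j1)" using row[OF d] j by simp
  obtain i' where i': "i = Suc i'" using row_pos[OF d(1)] by (cases i) auto
  consider "(i, j1) \<in> free" "(i, j2) \<in> free" | "(i, j1) \<notin> free" "(i, j2) \<notin> free"
    | "(i, j1) \<in> free" "(i, j2) \<notin> free" | "(i, j1) \<notin> free" "(i, j2) \<in> free" by blast
  then show ?thesis
  proof cases
    case 1
    then have "(i, j1) \<in> B" if "(i, j2) \<in> B"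
      using B j that unfolding left_closed_subsets_def by blast
    then show ?thesis using 1 by (auto simp: refill_def)
  next
    case 2
    then show ?thesis using le by (simp add: refill_def)
  next
    case 3
    have m1: "(i, j1) \<in> moving" using free_moving[OF 3(1)] .
    have "U0 (i, j2) \<noteq> k"
    proof
      assume u: "U0 (i, j2) = k"
      have m2: "(i, j2) \<in> moving" using u d by (auto simp: moving_def)
      have "(Suc i, j2) \<notin> moving" using below_moves_left(1)[OF m1 m2 j] 3(1) by (auto simp: free_def)
      moreover have "(i - 1, j2) \<notin> moving" using column_pair(2)[of i' j2] m2 u k i' by auto
      ultimately show False using 3 m2 j by (auto simp: free_def)
    qed
    then show ?thesis using 3 le m1 k by (auto simp: refill_def moving_def)
  next
    case 4
    have m2: "(i, j2) \<in> moving" using free_moving[OF 4(2)] .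
    have f2: "(Suc i, j2) \<notin> moving" "(i - 1, j2) \<notin> moving" "j0 < j2" using 4(2) by (auto simp: free_def)
    have "U0 (i, j1) \<noteq> k - 1"
    proof
      assume u: "U0 (i, j1) = k - 1"
      have m1: "(i, j1) \<in> moving" using u d by (auto simp: moving_def)
      have u2: "U0 (i, j2) = k - 1" using le u m2 k by (auto simp: moving_def)
      have "\<not> j1 \<le> j0" using frozen_blocks[OF d(1) _ u d(2) f2(3) u2] f2(2) by auto
      moreover have "(i - 1, j1) \<notin> moving" using above_moves_right(1)[of i' j1 j2] m1 m2 j f2 i' by auto
      moreover have "(Suc i, j1) \<notin> moving" using column_pair(1)[of i j1] m1 u k by auto
      ultimately show False using 4 m1 by (auto simp: free_def)
    qed
    then show ?thesis using 4 le m2 k by (auto simp: refill_def moving_def)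
  qed
qed

lemma refill_column:
  assumes d: "(i1, j) \<in> d" "(i2, j) \<in> d" and i: "i1 < i2"
  shows "refill B (i2, j) < refill B (i1, j)"
proof -
  have lt: "U0 (i2, j) < U0 (i1, j)" using col[OF d i] .
  have step: "i2 = Suc i1" if m: "(i1, j) \<in> moving" "(i2, j) \<in> moving"
  proof (rule ccontr)
    assume "i2 \<noteq> Suc i1"
    then have s: "Suc i1 < i2" using i by simp
    have d': "(Suc i1, j) \<in> d" using down[OF d(2), of "Suc i1" j] s row_pos[OF d(2)] by auto
    show False using col[OF d(1) d'] col[OF d' d(2) s] m by (auto simp: moving_def)
  qed
  consider "(i1, j) \<in> free" | "(i2, j) \<in> free" | "(i1, j) \<notin> free" "(i2, j) \<notin> free" by blast
  then show ?thesis
  proof cases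
    case 1
    then have m: "(i1, j) \<in> moving" by (rule free_moving)
    have "(i2, j) \<notin> moving" using step[OF m] 1 by (auto simp: free_def)
    then have "U0 (i2, j) < k - 1" "(i2, j) \<notin> free" using lt m d(2) free_moving by (auto simp: moving_def)
    then show ?thesis using 1 k by (auto simp: refill_def)
  next
    case 2
    then have m: "(i2, j) \<in> moving" by (rule free_moving)
    have "(i1, j) \<notin> moving" using step[OF _ m] 2 by (auto simp: free_def)
    then have "U0 (i1, j) > k" "(i1, j) \<notin> free" using lt m d(1) free_moving by (auto simp: moving_def)
    then show ?thesis using 2 k by (auto simp: refill_def)
  next
    case 3
    then show ?thesis using lt by (simp add: refill_def)
  qed
qed

lemma refill_in_class:
  assumes B: "B \<in> left_closed_subsets free"
  shows "refill B \<in> bk_class"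
proof -
  have "refill B \<in> d \<rightarrow>\<^sub>E {1..n}"
  proof (rule PiE_I)
    fix \<beta> assume "\<beta> \<in> d"
    then show "refill B \<beta> \<in> {1..n}" using strict_fillings_range[OF U0, of \<beta>] k by (auto simp: refill_def)
  next
    fix \<beta> assume "\<beta> \<notin> d"
    moreover from this have "\<beta> \<notin> free" using free_moving moving_d by blast
    ultimately show "refill B \<beta> = undefined"
      using strict_fillings_ext[OF U0, of \<beta>] by (simp add: refill_def)
  qed
  then have "refill B \<in> strict_fillings n lam"
    by (simp add: strict_fillings_def refill_row[OF B] refill_column)
  moreover have "(snd \<beta> \<le> j0 \<longrightarrow> refill B \<beta> = U0 \<beta>) \<and> collapse k (refill B \<beta>) = collapse k (U0 \<beta>)" for \<beta>
    by (auto simp: refill_def free_def moving_def collapse_def)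
  ultimately show ?thesis by (simp add: bk_class_def)
qed

lemma class_letter:
  assumes U: "U \<in> bk_class" and "\<beta> \<in> free"
  shows "U \<beta> = k \<or> U \<beta> = k - 1"
proof -
  have m: "\<beta> \<in> moving" using free_moving[OF assms(2)] .
  then have "collapse k (U \<beta>) = collapse k (U0 \<beta>)" using U moving_d[OF m] by (simp add: bk_class_def)
  moreover have "U0 \<beta> = k \<or> U0 \<beta> = k - 1" using m by (simp add: moving_def)
  ultimately show ?thesis by (auto simp: collapse_def split: if_splits)
qed

lemma bij_class: "bij_betw (\<lambda>U. {\<beta> \<in> free. U \<beta> = k}) bk_class (left_closed_subsets free)"
proof (rule bij_betw_byWitness[of _ refill])
  show "\<forall>U\<in>bk_class. refill {\<beta> \<in> free. U \<beta> = k} = U"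
  proof
    fix U assume U: "U \<in> bk_class"
    show "refill {\<beta> \<in> free. U \<beta> = k} = U"
    proof
      fix \<beta>
      have S: "U \<in> strict_fillings n lam" using U by (auto simp: bk_class_def)
      consider "\<beta> \<in> free" | "\<beta> \<notin> free" "\<beta> \<in> d" | "\<beta> \<notin> free" "\<beta> \<notin> d" by blast
      then show "refill {\<beta> \<in> free. U \<beta> = k} \<beta> = U \<beta>"
      proof cases
        case 1
        then show ?thesis using class_letter[OF U 1] by (auto simp: refill_def)
      next
        case 2
        then show ?thesis using class_eq_off_free[OF U 2(2,1)] by (simp add: refill_def)
      next
        case 3
        then show ?thesis
          using strict_fillings_ext[OF S 3(2)] strict_fillings_ext[OF U0 3(2)] by (simp add: refill_def)
      qed
    qed
  qed
  show "\<forall>B\<in>left_closed_subsets free. {\<beta> \<in> free. refill B \<beta> = k} = B"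
  proof
    fix B assume "B \<in> left_closed_subsets free"
    then have "B \<subseteq> free" by (simp add: left_closed_subsets_def)
    moreover have "refill B \<beta> = k \<longleftrightarrow> \<beta> \<in> B" if "\<beta> \<in> free" for \<beta>
      using that k by (auto simp: refill_def)
    ultimately show "{\<beta> \<in> free. refill B \<beta> = k} = B" by blast
  qed
  show "(\<lambda>U. {\<beta> \<in> free. U \<beta> = k}) ` bk_class \<subseteq> left_closed_subsets free"
  proof (rule image_subsetI)
    fix U assume U: "U \<in> bk_class"
    then have S: "U \<in> strict_fillings n lam" by (auto simp: bk_class_def)
    have "U (i, j) = k" if "(i, j') \<in> free" "U (i, j') = k" "j < j'" "(i, j) \<in> free" for i j j'
    proof -
      have "k \<le> U (i, j)" using strict_fillings_row[OF S, of i j j'] that(2,3)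
          moving_d[OF free_moving[OF that(1)]] moving_d[OF free_moving[OF that(4)]] by simp
      then show ?thesis using class_letter[OF U that(4)] k by auto
    qed
    then show "{\<beta> \<in> free. U \<beta> = k} \<in> left_closed_subsets free" by (auto simp: left_closed_subsets_def)
  qed
  show "refill ` left_closed_subsets free \<subseteq> bk_class" using refill_in_class by blast
qed

text \<open>
  The sum over the class splits into the free boxes, where all left closed choices occur, and a product
  over the remaining boxes that is the same for the whole class.
\<close>

lemma class_sum_eq:
  "(\<Sum>U\<in>bk_class. \<Prod>\<beta>\<in>{\<beta>\<in>d. j0 < snd \<beta>}. box_factor a x (U \<beta>) \<beta>) =
     free_sum a (int k) (x (k - 1)) (x (k - 2)) free *
     (\<Prod>\<beta>\<in>{\<beta>\<in>d. j0 < snd \<beta>} - free. box_factor a x (U0 \<beta>) \<beta>)"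
proof -
  let ?A = "{\<beta>\<in>d. j0 < snd \<beta>}"
  let ?f = "\<lambda>B. (\<Prod>\<beta>\<in>B. x (k - 1) - a (int k - content \<beta>)) *
      (\<Prod>\<beta>\<in>free - B. x (k - 2) - a (int k - 1 - content \<beta>)) * (\<Prod>\<beta>\<in>?A - free. box_factor a x (U0 \<beta>) \<beta>)"
  have fA: "finite ?A" using finite_diagram_partition[OF lam] by simp
  have sub: "free \<subseteq> ?A" by (auto simp: free_def moving_def)
  have "(\<Sum>U\<in>bk_class. \<Prod>\<beta>\<in>?A. box_factor a x (U \<beta>) \<beta>) =
     (\<Sum>U\<in>bk_class. ?f {\<beta> \<in> free. U \<beta> = k})"
  proof (rule sum.cong[OF refl])
    fix U assume U: "U \<in> bk_class"
    let ?B = "{\<beta> \<in> free. U \<beta> = k}"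
    have "(\<Prod>\<beta>\<in>?A. box_factor a x (U \<beta>) \<beta>) =
        (\<Prod>\<beta>\<in>?A - free. box_factor a x (U \<beta>) \<beta>) * (\<Prod>\<beta>\<in>free. box_factor a x (U \<beta>) \<beta>)"
      by (rule prod.subset_diff[OF sub fA])
    also have "(\<Prod>\<beta>\<in>free. box_factor a x (U \<beta>) \<beta>) =
        (\<Prod>\<beta>\<in>free - ?B. box_factor a x (U \<beta>) \<beta>) * (\<Prod>\<beta>\<in>?B. box_factor a x (U \<beta>) \<beta>)"
      by (rule prod.subset_diff) (auto simp: finite_free)
    also have "(\<Prod>\<beta>\<in>?B. box_factor a x (U \<beta>) \<beta>) = (\<Prod>\<beta>\<in>?B. x (k - 1) - a (int k - content \<beta>))"
      by (rule prod.cong) (auto simp: box_factor_def)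
    also have "(\<Prod>\<beta>\<in>free - ?B. box_factor a x (U \<beta>) \<beta>) = (\<Prod>\<beta>\<in>free - ?B. x (k - 2) - a (int k - 1 - content \<beta>))"
    proof (rule prod.cong[OF refl])
      fix \<beta> assume "\<beta> \<in> free - ?B"
      then have "U \<beta> = k - 1" using class_letter[OF U, of \<beta>] by auto
      then show "box_factor a x (U \<beta>) \<beta> = x (k - 2) - a (int k - 1 - content \<beta>)"
        using k by (simp add: box_factor_def numeral_2_eq_2 of_nat_diff)
    qed
    also have "(\<Prod>\<beta>\<in>?A - free. box_factor a x (U \<beta>) \<beta>) = (\<Prod>\<beta>\<in>?A - free. box_factor a x (U0 \<beta>) \<beta>)"
      by (rule prod.cong) (use class_eq_off_free[OF U] in auto)
    finally show "(\<Prod>\<beta>\<in>?A. box_factor a x (U \<beta>) \<beta>) = ?f ?B" by (simp add: mult_ac)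
  qed
  also have "\<dots> = (\<Sum>B\<in>left_closed_subsets free. ?f B)"
    by (rule sum.reindex_bij_betw[OF bij_class])
  finally show ?thesis unfolding free_sum_def by (simp add: sum_distrib_right)
qed

text \<open>
  Exchanges the two boxes of a bound pair. The lower box has content one less and letter one less, so
  the pair contributes \<open>(x\<^sub>k - a\<^bsub>k-c\<^esub>) (x\<^bsub>k-1\<^esub> - a\<^bsub>k-c\<^esub>)\<close>, which is symmetric.
\<close>

definition partner :: "box \<Rightarrow> box" where
  "partner \<beta> = (if \<beta> \<in> moving then (if U0 \<beta> = k then (Suc (fst \<beta>), snd \<beta>) else (fst \<beta> - 1, snd \<beta>)) else \<beta>)"

lemma partner:
  assumes "\<beta> \<in> d" "j0 < snd \<beta>" "\<beta> \<notin> free"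
  shows "partner \<beta> \<in> d" "j0 < snd (partner \<beta>)" "partner \<beta> \<notin> free" "partner (partner \<beta>) = \<beta>"
    "\<beta> \<in> moving \<Longrightarrow> U0 \<beta> = k \<Longrightarrow> U0 (partner \<beta>) = k - 1 \<and> content (partner \<beta>) = content \<beta> - 1"
    "\<beta> \<in> moving \<Longrightarrow> U0 \<beta> \<noteq> k \<Longrightarrow> U0 (partner \<beta>) = k \<and> content (partner \<beta>) = content \<beta> + 1"
proof -
  obtain i j where ij: "\<beta> = (i, j)" by (cases \<beta>)
  obtain i' where i': "i = Suc i'" using row_pos assms(1) ij by (cases i) fastforce+
  have *: "partner \<beta> \<in> d \<and> j0 < snd (partner \<beta>) \<and> partner \<beta> \<notin> free \<and> partner (partner \<beta>) = \<beta> \<and>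
    (\<beta> \<in> moving \<longrightarrow> U0 \<beta> = k \<longrightarrow> U0 (partner \<beta>) = k - 1 \<and> content (partner \<beta>) = content \<beta> - 1) \<and>
    (\<beta> \<in> moving \<longrightarrow> U0 \<beta> \<noteq> k \<longrightarrow> U0 (partner \<beta>) = k \<and> content (partner \<beta>) = content \<beta> + 1)"
  proof -
    consider "\<beta> \<notin> moving" | "\<beta> \<in> moving" "(Suc i, j) \<in> moving" | "\<beta> \<in> moving" "(i', j) \<in> moving"
      using assms ij i' by (auto simp: free_def)
    then show ?thesis
    proof cases
      case 1
      then show ?thesis using assms by (auto simp: partner_def)
    next
      case 2
      have u: "U0 (i, j) = k" "U0 (Suc i, j) = k - 1" using column_pair[of i j] 2 ij by auto
      have p: "partner \<beta> = (Suc i, j)" using 2 u ij by (simp add: partner_def)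
      have p2: "partner (Suc i, j) = (i, j)" using 2 u ij k by (simp add: partner_def)
      show ?thesis unfolding p p2 using 2 u ij k assms(2) moving_d[OF 2(2)] by (auto simp: free_def content_def p2)
    next
      case 3
      have u: "U0 (i', j) = k" "U0 (Suc i', j) = k - 1" using column_pair[of i' j] 3 ij i' by auto
      have p: "partner \<beta> = (i', j)" using 3 u ij i' k by (simp add: partner_def)
      have p2: "partner (i', j) = (i, j)" using 3 u ij i' by (simp add: partner_def)
      show ?thesis unfolding p p2 using 3 u ij k i' assms(2) moving_d[OF 3(2)] by (auto simp: free_def content_def p2)
    qed
  qed
  then show "partner \<beta> \<in> d" "j0 < snd (partner \<beta>)" "partner \<beta> \<notin> free" "partner (partner \<beta>) = \<beta>"
    "\<beta> \<in> moving \<Longrightarrow> U0 \<beta> = k \<Longrightarrow> U0 (partner \<beta>) = k - 1 \<and> content (partner \<beta>) = content \<beta> - 1"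
    "\<beta> \<in> moving \<Longrightarrow> U0 \<beta> \<noteq> k \<Longrightarrow> U0 (partner \<beta>) = k \<and> content (partner \<beta>) = content \<beta> + 1"
    by blast+
qed

text \<open>
  The free boxes contribute symmetrically by \<open>free_sum_symmetric\<close>. Exchanging the two variables
  permutes the factors of the other boxes by \<open>partner\<close>.
\<close>

lemma class_sum_symmetric:
  fixes a :: "int \<Rightarrow> 'r::idom"
  shows "(\<Sum>U\<in>bk_class. \<Prod>\<beta>\<in>{\<beta>\<in>d. j0 < snd \<beta>}. box_factor a (x \<circ> transpose (k - 2) (k - 1)) (U \<beta>) \<beta>) =
   (\<Sum>U\<in>bk_class. \<Prod>\<beta>\<in>{\<beta>\<in>d. j0 < snd \<beta>}. box_factor a x (U \<beta>) \<beta>)"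
proof -
  let ?A = "{\<beta>\<in>d. j0 < snd \<beta>} - free"
  let ?x = "x \<circ> transpose (k - 2) (k - 1)"
  have x: "?x (k - 1) = x (k - 2)" "?x (k - 2) = x (k - 1)" by simp_all
  have "(\<Prod>\<beta>\<in>?A. box_factor a ?x (U0 \<beta>) \<beta>) = (\<Prod>\<beta>\<in>?A. box_factor a x (U0 \<beta>) \<beta>)"
  proof (rule prod.reindex_bij_witness[of _ partner partner])
    fix \<beta> assume "\<beta> \<in> ?A"
    then have b: "\<beta> \<in> d" "j0 < snd \<beta>" "\<beta> \<notin> free" by auto
    note p = partner[OF b]
    show "partner (partner \<beta>) = \<beta>" "partner (partner \<beta>) = \<beta>" by (fact p)+
    show "partner \<beta> \<in> ?A" "partner \<beta> \<in> ?A" using p by auto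
    consider "\<beta> \<notin> moving" | "\<beta> \<in> moving" "U0 \<beta> = k" | "\<beta> \<in> moving" "U0 \<beta> = k - 1"
      by (auto simp: moving_def)
    then show "box_factor a x (U0 (partner \<beta>)) (partner \<beta>) = box_factor a ?x (U0 \<beta>) \<beta>"
    proof cases
      case 1
      then have ne: "U0 \<beta> \<noteq> k" "U0 \<beta> \<noteq> k - 1" using b by (auto simp: moving_def)
      have "1 \<le> U0 \<beta>" using strict_fillings_range[OF U0 b(1)] by simp
      then have "?x (U0 \<beta> - 1) = x (U0 \<beta> - 1)" using ne k by (auto simp: transpose_def)
      then show ?thesis using 1 by (simp add: partner_def box_factor_def)
    next
      case 2
      then show ?thesis using p(5) x k by (simp add: box_factor_def of_nat_diff numeral_2_eq_2)
    next
      case 3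
      then have "U0 \<beta> \<noteq> k" using k by auto
      then show ?thesis using p(6) 3 x k by (simp add: box_factor_def of_nat_diff numeral_2_eq_2 algebra_simps)
    qed
  qed
  then show ?thesis unfolding class_sum_eq x
    using free_sum_symmetric[OF finite_free row_convex_free, of a "int k" "x (k - 1)" "x (k - 2)"]
    by simp
qed

end

section \<open>Alternants and the orders on the boxes\<close>

text \<open>
  Antisymmetrization in \<open>n\<close> variables. Polynomials are represented by functions of the variables, on
  which permutations act by composition.
\<close>

definition alt :: "nat \<Rightarrow> ((nat \<Rightarrow> 'r) \<Rightarrow> 'r) \<Rightarrow> (nat \<Rightarrow> 'r) \<Rightarrow> 'r::comm_ring_1" where
  "alt n f x = (\<Sum>p | p permutes {0..<n}. signof p * f (x \<circ> p))"

lemma alt_add: "alt n (\<lambda>y. f y + g y) x = alt n f x + alt n g x"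
  by (simp add: alt_def distrib_left sum.distrib)

lemma alt_scale: "alt n (\<lambda>y. c * f y) x = c * alt n f x"
  by (simp add: alt_def sum_distrib_left mult.left_commute)

lemma alt_sum: "alt n (\<lambda>y. \<Sum>i\<in>I. f i y) x = (\<Sum>i\<in>I. alt n (f i) x)"
  unfolding alt_def by (simp add: sum_distrib_left) (rule sum.swap)

lemma alt_symmetric_mult:
  assumes "\<And>p. p permutes {0..<n} \<Longrightarrow> s (x \<circ> p) = s x"
  shows "alt n (\<lambda>y. s y * f y) x = s x * alt n f x"
  unfolding alt_def sum_distrib_left using assms by (intro sum.cong) (auto simp: mult_ac)

text \<open>
  The terms of \<open>p\<close> and of \<open>p\<close> composed with the transposition cancel. Choosing \<open>p\<close> with \<open>p i < p j\<close> in
  each pair avoids a division by 2.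
\<close>

lemma alt_eq_0:
  assumes ij: "i < n" "j < n" "i \<noteq> j" and sym: "\<And>y. f (y \<circ> transpose i j) = f y"
  shows "alt n f x = 0"
proof -
  let ?t = "transpose i j"
  let ?P = "{p. p permutes {0..<n}}"
  let ?A = "{p \<in> ?P. p i < p j}" and ?B = "{p \<in> ?P. p j < p i}"
  let ?g = "\<lambda>p. signof p * f (x \<circ> p)"
  have t: "?t permutes {0..<n}" using ij by (intro permutes_swap_id) auto
  have fin: "finite ?P" by (rule finite_permutations) simp
  have "p i \<noteq> p j" if "p permutes {0..<n}" for p
    using permutes_inj[OF that] ij(3) by (auto dest: injD)
  then have P: "?P = ?A \<union> ?B" by (auto simp: neq_iff)
  have "sum ?g ?P = sum ?g (?A \<union> ?B)" by (rule arg_cong[OF P])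
  also have "\<dots> = sum ?g ?A + sum ?g ?B" by (rule sum.union_disjoint) (use fin in auto)
  also have "sum ?g ?B = (\<Sum>p\<in>?A. - ?g p)"
  proof (rule sum.reindex_bij_witness[of _ "\<lambda>p. p \<circ> ?t" "\<lambda>p. p \<circ> ?t"])
    fix p assume p: "p \<in> ?A"
    then have "p \<circ> ?t permutes {0..<n}" by (auto intro: permutes_compose[OF t])
    then show "p \<circ> ?t \<in> ?B" using p by simp
  next
    fix p assume p: "p \<in> ?B"
    then have "p \<circ> ?t permutes {0..<n}" by (auto intro: permutes_compose[OF t])
    then show "p \<circ> ?t \<in> ?A" using p by simp
    have "f (x \<circ> (p \<circ> ?t)) = f (x \<circ> p)" using sym[of "x \<circ> p"] by (simp add: o_assoc)
    moreover have "signof (p \<circ> ?t) = - (signof p :: 'a)"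
      using signof_compose[of p n ?t n] p t ij(3) by (simp add: sign_swap_id)
    ultimately show "- ?g (p \<circ> ?t) = ?g p" by simp
  qed (simp_all add: o_assoc[symmetric])
  also have "sum ?g ?A + (\<Sum>p\<in>?A. - ?g p) = 0" by (simp add: sum_negf)
  finally show ?thesis unfolding alt_def .
qed

definition factorial_monomial :: "(int \<Rightarrow> 'r) \<Rightarrow> nat \<Rightarrow> (nat \<Rightarrow> nat) \<Rightarrow> (nat \<Rightarrow> 'r) \<Rightarrow> 'r::comm_ring_1" where
  "factorial_monomial a n \<rho> x = (\<Prod>i<n. \<Prod>c\<in>{int i + 2 - int (\<rho> (Suc i))..int n}. x i - a c)"

definition alternant :: "(int \<Rightarrow> 'r) \<Rightarrow> nat \<Rightarrow> (nat \<Rightarrow> nat) \<Rightarrow> (nat \<Rightarrow> 'r) \<Rightarrow> 'r::comm_ring_1" where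
  "alternant a n \<rho> = alt n (factorial_monomial a n \<rho>)"

lemma factorial_monomial_add_box:
  assumes k: "1 \<le> k" "k \<le> n"
  shows "(x (k - 1) - a (int k - int (\<rho> k))) * factorial_monomial a n \<rho> x = factorial_monomial a n (add_box k \<rho>) x"
proof -
  let ?f = "\<lambda>\<rho> i. \<Prod>c\<in>{int i + 2 - int (\<rho> (Suc i))..int n}. x i - a c"
  have split: "factorial_monomial a n \<rho> x = ?f \<rho> (k - 1) * (\<Prod>i\<in>{..<n} - {k - 1}. ?f \<rho> i)" for \<rho>
    unfolding factorial_monomial_def by (rule prod.remove) (use k in auto)
  have "{int k - int (\<rho> k)..int n} = insert (int k - int (\<rho> k)) {int k + 1 - int (\<rho> k)..int n}"
    using k by auto
  then have "?f (add_box k \<rho>) (k - 1) = (x (k - 1) - a (int k - int (\<rho> k))) * ?f \<rho> (k - 1)"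
    using k by (simp add: add_box_def of_nat_diff algebra_simps)
  moreover have "(\<Prod>i\<in>{..<n} - {k - 1}. ?f (add_box k \<rho>) i) = (\<Prod>i\<in>{..<n} - {k - 1}. ?f \<rho> i)"
    by (rule prod.cong) (use k in \<open>auto simp: add_box_def\<close>)
  ultimately show ?thesis unfolding split by (simp add: mult_ac)
qed

text \<open>
  The roots of row \<open>k\<close> begin at \<open>k + 1 - \<rho>\<^sub>k\<close>; under the hypothesis rows \<open>k - 1\<close> and \<open>k\<close> have the
  same roots.
\<close>

lemma factorial_monomial_symmetric:
  assumes k: "2 \<le> k" "k \<le> n" and \<rho>: "\<rho> k = Suc (\<rho> (k - 1))"
  shows "factorial_monomial a n \<rho> (x \<circ> transpose (k - 2) (k - 1)) = factorial_monomial a n \<rho> x"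
proof -
  let ?t = "transpose (k - 2) (k - 1)"
  have "factorial_monomial a n \<rho> (x \<circ> ?t) = (\<Prod>i<n. \<Prod>c\<in>{int (?t i) + 2 - int (\<rho> (Suc (?t i)))..int n}. x (?t i) - a c)"
    unfolding factorial_monomial_def o_def
  proof (intro prod.cong refl)
    fix i
    have kk: "Suc (k - 2) = k - 1" "Suc (k - 1) = k" using k by auto
    have "int (?t i) - int (\<rho> (Suc (?t i))) = int i - int (\<rho> (Suc i))"
      unfolding transpose_def using k \<rho> by (auto simp: kk of_nat_diff)
    then show "{int i + 2 - int (\<rho> (Suc i))..int n} = {int (?t i) + 2 - int (\<rho> (Suc (?t i)))..int n}"
      by (simp add: algebra_simps)
  qed
  also have "\<dots> = factorial_monomial a n \<rho> x"
    unfolding factorial_monomial_def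
    by (rule prod.reindex_bij_betw, rule bij_betw_byWitness[of _ ?t]) (use k in \<open>auto simp: transpose_def\<close>)
  finally show ?thesis .
qed

lemma invariant_adjacent_imp_symmetric:
  fixes f :: "(nat \<Rightarrow> 'r) \<Rightarrow> 's"
  assumes adj: "\<And>i y. Suc i < n \<Longrightarrow> f (y \<circ> transpose i (Suc i)) = f y" and p: "p permutes {0..<n}"
  shows "f (x \<circ> p) = f x"
proof -
  have tr: "f (y \<circ> transpose i (i + Suc m)) = f y" if "i + Suc m < n" for i m y
    using that
  proof (induction m arbitrary: y)
    case 0
    then show ?case using adj[of i y] by (simp add: o_def)
  next
    case (Suc m)
    \<comment> \<open>A transposition is a conjugate of a shorter one by an adjacent one.\<close>
    let ?s = "transpose (i + Suc m) (Suc (i + Suc m))" and ?u = "transpose i (i + Suc m)"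
    have "transpose i (i + Suc (Suc m)) = ?s \<circ> ?u \<circ> ?s"
      by (auto simp: fun_eq_iff transpose_def)
    then have "f (y \<circ> transpose i (i + Suc (Suc m))) = f ((y \<circ> ?s \<circ> ?u) \<circ> ?s)" by (simp add: o_assoc)
    also have "\<dots> = f ((y \<circ> ?s) \<circ> ?u)" using adj[of "i + Suc m"] Suc.prems by simp
    also have "\<dots> = f (y \<circ> ?s)" by (rule Suc.IH) (use Suc.prems in simp)
    also have "\<dots> = f y" by (rule adj) (use Suc.prems in simp)
    finally show ?case .
  qed
  have tr': "f (y \<circ> transpose i j) = f y" if ij: "i < n" "j < n" for i j y
  proof (cases i j rule: linorder_cases)
    case less
    then obtain m where "j = i + Suc m" using less_imp_Suc_add by auto
    then show ?thesis using tr[of i m y] ij by simp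
  next
    case greater
    then obtain m where "i = j + Suc m" using less_imp_Suc_add by auto
    then show ?thesis using tr[of j m y] ij by (simp add: transpose_commute)
  qed simp
  have "\<forall>x. f (x \<circ> p) = f x"
    using p finite_atLeastLessThan
  proof (induction p rule: permutes_induct)
    case (swap i j p)
    show ?case
    proof
      fix x
      have "f (x \<circ> (transpose i j \<circ> p)) = f ((x \<circ> transpose i j) \<circ> p)" by (simp add: o_assoc)
      also have "\<dots> = f (x \<circ> transpose i j)" using swap by blast
      also have "\<dots> = f x" by (rule tr') (use swap in auto)
      finally show "f (x \<circ> (transpose i j \<circ> p)) = f x" .
    qed
  qed simp_all
  then show ?thesis by blast
qed

definition column_before :: "box \<Rightarrow> box \<Rightarrow> bool" where
  "column_before \<beta> \<gamma> \<longleftrightarrow> snd \<beta> < snd \<gamma> \<or> (snd \<beta> = snd \<gamma> \<and> fst \<gamma> < fst \<beta>)"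

definition row_before :: "box \<Rightarrow> box \<Rightarrow> bool" where
  "row_before \<beta> \<gamma> \<longleftrightarrow> fst \<gamma> < fst \<beta> \<or> (fst \<beta> = fst \<gamma> \<and> snd \<beta> < snd \<gamma>)"

lemma sorted_wrt_concat_map:
  assumes "sorted_wrt (\<lambda>x y. \<forall>u\<in>set (f x). \<forall>v\<in>set (f y). R u v) xs" "\<And>x. x \<in> set xs \<Longrightarrow> sorted_wrt R (f x)"
  shows "sorted_wrt R (concat (map f xs))"
  using assms by (induction xs) (auto simp: sorted_wrt_append)

lemma sorted_wrt_less_upt: "sorted_wrt (<) [m..<k]"
  by (simp add: sorted_wrt_upt)

lemma sorted_wrt_greater_rev_upt: "sorted_wrt (\<lambda>x y. y < x) (rev [m..<k])"
  by (simp add: sorted_wrt_rev sorted_wrt_upt)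

lemma sorted_column_order: "sorted_wrt column_before (column_order lam)"
  unfolding column_order_def
proof (intro sorted_wrt_concat_map)
  show "sorted_wrt (\<lambda>x y. \<forall>u\<in>set (concat (map (\<lambda>i. if (i, x) \<in> diagram lam then [(i, x)] else []) (rev [1..<len lam + 1]))).
     \<forall>v\<in>set (concat (map (\<lambda>i. if (i, y) \<in> diagram lam then [(i, y)] else []) (rev [1..<len lam + 1]))). column_before u v) [1..<lam 1 + 1]"
    by (rule sorted_wrt_mono_rel[OF _ sorted_wrt_less_upt]) (auto simp: column_before_def split: if_splits)
  show "sorted_wrt (\<lambda>x xa. \<forall>u\<in>set (if (x, j) \<in> diagram lam then [(x, j)] else []). \<forall>v\<in>set (if (xa, j) \<in> diagram lam then [(xa, j)] else []). column_before u v) (rev [1..<len lam + 1])" for j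
    by (rule sorted_wrt_mono_rel[OF _ sorted_wrt_greater_rev_upt]) (auto simp: column_before_def split: if_splits)
qed auto

lemma sorted_row_order: "sorted_wrt row_before (row_order lam)"
  unfolding row_order_def
proof (intro sorted_wrt_concat_map)
  show "sorted_wrt (\<lambda>x y. \<forall>u\<in>set (map (Pair x) [1..<lam x + 1]). \<forall>v\<in>set (map (Pair y) [1..<lam y + 1]). row_before u v) (rev [1..<len lam + 1])"
    by (rule sorted_wrt_mono_rel[OF _ sorted_wrt_greater_rev_upt]) (auto simp: row_before_def)
  show "sorted_wrt row_before (map (Pair x) [1..<lam x + 1])" for x
    unfolding sorted_wrt_map
    by (rule sorted_wrt_mono_rel[OF _ sorted_wrt_less_upt]) (auto simp: row_before_def)
qed

lemma row_le_len: "is_composition lam \<Longrightarrow> lam i \<noteq> 0 \<Longrightarrow> i \<le> len lam"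
  by (auto simp: is_composition_def len_def)

lemma set_column_order: "is_partition lam \<Longrightarrow> set (column_order lam) = diagram lam"
proof -
  assume p: "is_partition lam"
  then have c: "is_composition lam" by (simp add: is_partition_def)
  have "i \<le> len lam \<and> j \<le> lam 1 \<and> 1 \<le> i \<and> 1 \<le> j" if "(i, j) \<in> diagram lam" for i j
    using that row_le_len[OF c, of i] partition_antimono[OF p, of 1 i] by (auto simp: diagram_def)
  moreover have "(i, j) \<in> set (column_order lam) \<longleftrightarrow>
      1 \<le> j \<and> j < lam 1 + 1 \<and> 1 \<le> i \<and> i < len lam + 1 \<and> (i, j) \<in> diagram lam" for i j
    unfolding column_order_def by (auto simp: image_iff simp del: upt_Suc)
  ultimately show ?thesis by (simp add: set_eq_iff less_Suc_eq_le) blast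
qed

lemma set_row_order: "is_composition lam \<Longrightarrow> set (row_order lam) = diagram lam"
proof -
  assume c: "is_composition lam"
  have "i \<le> len lam \<and> 1 \<le> i \<and> 1 \<le> j \<and> j \<le> lam i" if "(i, j) \<in> diagram lam" for i j
    using that row_le_len[OF c, of i] by (auto simp: diagram_def)
  moreover have "(i, j) \<in> set (row_order lam) \<longleftrightarrow> 1 \<le> i \<and> i < len lam + 1 \<and> 1 \<le> j \<and> j < lam i + 1" for i j
    unfolding row_order_def by (auto simp: image_iff simp del: upt_Suc)
  moreover have "(i, j) \<in> diagram lam \<longleftrightarrow> 1 \<le> i \<and> 1 \<le> j \<and> j \<le> lam i" for i j
    by (simp add: diagram_def)
  ultimately show ?thesis by (simp add: set_eq_iff less_Suc_eq_le) blast
qed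

lemma sorted_wrt_imp_distinct: "sorted_wrt R xs \<Longrightarrow> (\<And>x. \<not> R x x) \<Longrightarrow> distinct xs"
  by (induction xs) auto

lemma distinct_column_order: "distinct (column_order lam)"
  by (rule sorted_wrt_imp_distinct[OF sorted_column_order]) (simp add: column_before_def)

lemma distinct_row_order: "distinct (row_order lam)"
  by (rule sorted_wrt_imp_distinct[OF sorted_row_order]) (simp add: row_before_def)

section \<open>Expanding a tableau polynomial times an alternant\<close>

text \<open>
  The shapes met when the boxes of a list \<open>bs\<close> with letters \<open>U\<close> are read in turn, where \<open>B\<close> is the set
  of the positions in \<open>bs\<close> that are barred. Positions rather than boxes make the first \<open>i\<close> steps
  depend on \<open>B \<inter> {..<i}\<close>.
\<close>

primrec path :: "(nat \<Rightarrow> nat) \<Rightarrow> box list \<Rightarrow> (box \<Rightarrow> nat) \<Rightarrow> nat set \<Rightarrow> nat \<Rightarrow> (nat \<Rightarrow> nat)" where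
  "path \<mu> bs U B 0 = \<mu>"
| "path \<mu> bs U B (Suc j) = (if j \<in> B then add_box (U (bs ! j)) (path \<mu> bs U B j) else path \<mu> bs U B j)"

definition path_weight :: "(int \<Rightarrow> 'r::comm_ring_1) \<Rightarrow> (nat \<Rightarrow> nat) \<Rightarrow> box list \<Rightarrow> (box \<Rightarrow> nat) \<Rightarrow> nat set \<Rightarrow> nat \<Rightarrow> 'r" where
  "path_weight a \<mu> bs U B i =
     (\<Prod>j\<in>{..<i} - B. a (int (U (bs ! j)) - int (path \<mu> bs U B j (U (bs ! j)))) - a (int (U (bs ! j)) - content (bs ! j)))"

definition yamanouchi_path :: "(nat \<Rightarrow> nat) \<Rightarrow> box list \<Rightarrow> (box \<Rightarrow> nat) \<Rightarrow> nat set \<Rightarrow> nat \<Rightarrow> bool" where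
  "yamanouchi_path \<mu> bs U B i \<longleftrightarrow> (\<forall>j\<le>i. is_partition (path \<mu> bs U B j))"

lemma path_cong:
  assumes "\<And>j. j < i \<Longrightarrow> U (bs ! j) = U' (bs ! j)" "\<And>j. j < i \<Longrightarrow> j \<in> B \<longleftrightarrow> j \<in> B'"
  shows "path \<mu> bs U B i = path \<mu> bs U' B' i"
  using assms by (induction i) auto

lemma path_weight_cong:
  assumes "\<And>j. j < i \<Longrightarrow> U (bs ! j) = U' (bs ! j)" "\<And>j. j < i \<Longrightarrow> j \<in> B \<longleftrightarrow> j \<in> B'"
  shows "path_weight a \<mu> bs U B i = path_weight a \<mu> bs U' B' i"
  unfolding path_weight_def
proof (intro prod.cong)
  show "{..<i} - B = {..<i} - B'" using assms(2) by auto
  fix j assume "j \<in> {..<i} - B'"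
  then have j: "j < i" by simp
  have "path \<mu> bs U B j = path \<mu> bs U' B' j" by (rule path_cong) (use assms j in auto)
  then show "a (int (U (bs ! j)) - int (path \<mu> bs U B j (U (bs ! j)))) - a (int (U (bs ! j)) - content (bs ! j)) =
      a (int (U' (bs ! j)) - int (path \<mu> bs U' B' j (U' (bs ! j)))) - a (int (U' (bs ! j)) - content (bs ! j))"
    using assms(1)[OF j] by simp
qed

lemma yamanouchi_path_cong:
  assumes "\<And>j. j < i \<Longrightarrow> U (bs ! j) = U' (bs ! j)" "\<And>j. j < i \<Longrightarrow> j \<in> B \<longleftrightarrow> j \<in> B'"
  shows "yamanouchi_path \<mu> bs U B i = yamanouchi_path \<mu> bs U' B' i"
proof -
  have "path \<mu> bs U B j = path \<mu> bs U' B' j" if "j \<le> i" for j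
    by (rule path_cong) (use assms that in auto)
  then show ?thesis unfolding yamanouchi_path_def by auto
qed

lemma yamanouchi_path_Suc: "yamanouchi_path \<mu> bs U B (Suc i) \<longleftrightarrow> yamanouchi_path \<mu> bs U B i \<and> is_partition (path \<mu> bs U B (Suc i))"
  unfolding yamanouchi_path_def by (auto simp: le_Suc_eq)

lemma not_partition_add_box:
  assumes \<rho>: "is_partition \<rho>" and k: "1 \<le> k" and np: "\<not> is_partition (add_box k \<rho>)"
  shows "2 \<le> k" "\<rho> k = \<rho> (k - 1)"
proof -
  have "{i. add_box k \<rho> i \<noteq> 0} \<subseteq> insert k {i. \<rho> i \<noteq> 0}" by (auto simp: add_box_def)
  moreover have "finite (insert k {i. \<rho> i \<noteq> 0})" "\<rho> 0 = 0"
    using \<rho> by (simp_all add: is_partition_def is_composition_def)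
  ultimately have "finite {i. add_box k \<rho> i \<noteq> 0}" "add_box k \<rho> 0 = 0"
    using k finite_subset[of "{i. add_box k \<rho> i \<noteq> 0}"] by (simp_all add: add_box_def)
  then have "is_composition (add_box k \<rho>)" by (simp add: is_composition_def)
  then obtain i where i: "1 \<le> i" "add_box k \<rho> i < add_box k \<rho> (Suc i)"
    using np by (auto simp: is_partition_def not_le)
  have "\<rho> (Suc i) \<le> \<rho> i" using \<rho> i(1) by (simp add: is_partition_def)
  then have "k = Suc i \<and> \<rho> (Suc i) = \<rho> i" using i(2) by (auto simp: add_box_def split: if_splits)
  then show "2 \<le> k" "\<rho> k = \<rho> (k - 1)" using i by auto
qed

text \<open>
  Used with \<open>g\<close> a key whose fibres are Bender-Knuth classes.
\<close>

lemma sum_by_classes: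
  assumes "finite S" "\<And>s. s \<in> S \<Longrightarrow> sum f {t \<in> S. g t = g s} = sum f' {t \<in> S. g t = g s}"
  shows "sum f S = sum f' S"
  unfolding sum.image_gen[OF assms(1), of _ g]
proof (rule sum.cong[OF refl])
  fix y assume "y \<in> g ` S"
  then obtain s where s: "s \<in> S" "y = g s" by auto
  show "sum f {t \<in> S. g t = y} = sum f' {t \<in> S. g t = y}" unfolding s(2) by (rule assms(2)[OF s(1)])
qed

context
  fixes n :: nat and lam \<mu> :: "nat \<Rightarrow> nat" and a :: "int \<Rightarrow> 'r::idom" and x :: "nat \<Rightarrow> 'r"
  assumes lam: "is_partition lam" and \<mu>: "is_partition \<mu>"
begin

definition bk_key :: "nat \<Rightarrow> nat \<Rightarrow> (box \<Rightarrow> nat) \<Rightarrow> (box \<Rightarrow> nat) \<times> (box \<Rightarrow> nat)" where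
  "bk_key k j0 U = (\<lambda>\<beta>. if \<beta> \<in> diagram lam \<and> snd \<beta> \<le> j0 then U \<beta> else 0,
                     \<lambda>\<beta>. if \<beta> \<in> diagram lam then collapse k (U \<beta>) else 0)"

lemma bk_key_eq_iff:
  "bk_key k j0 U = bk_key k j0 U' \<longleftrightarrow>
     (\<forall>\<beta>\<in>diagram lam. (snd \<beta> \<le> j0 \<longrightarrow> U \<beta> = U' \<beta>) \<and> collapse k (U \<beta>) = collapse k (U' \<beta>))"
  by (auto simp: bk_key_def fun_eq_iff split: if_splits)

definition tableau_polynomial :: "(nat \<Rightarrow> 'r) \<Rightarrow> 'r" where
  "tableau_polynomial y = (\<Sum>U\<in>strict_fillings n lam. \<Prod>\<beta>\<in>diagram lam. box_factor a y (U \<beta>) \<beta>)"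

lemma tableau_polynomial_symmetric:
  assumes "p permutes {0..<n}"
  shows "tableau_polynomial (y \<circ> p) = tableau_polynomial y"
proof (rule invariant_adjacent_imp_symmetric[OF _ assms])
  fix i and y :: "nat \<Rightarrow> 'r" assume i: "Suc i < n"
  define k where "k = i + 2"
  have d: "{\<beta> \<in> diagram lam. 0 < snd \<beta>} = diagram lam" by (auto simp: diagram_def)
  show "tableau_polynomial (y \<circ> transpose i (Suc i)) = tableau_polynomial y"
    unfolding tableau_polynomial_def
  proof (rule sum_by_classes[of _ _ "bk_key k 0", OF finite_strict_fillings[OF lam]])
    fix U0 assume U0: "U0 \<in> strict_fillings n lam"
    interpret bender_knuth n lam k 0 U0
      using lam i U0 by unfold_locales (auto simp: k_def)
    have "{U \<in> strict_fillings n lam. bk_key k 0 U = bk_key k 0 U0} = bk_class"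
      by (simp add: bk_class_def bk_key_eq_iff)
    then show "(\<Sum>U | U \<in> strict_fillings n lam \<and> bk_key k 0 U = bk_key k 0 U0.
          \<Prod>\<beta>\<in>diagram lam. box_factor a (y \<circ> transpose i (Suc i)) (U \<beta>) \<beta>) =
        (\<Sum>U | U \<in> strict_fillings n lam \<and> bk_key k 0 U = bk_key k 0 U0.
          \<Prod>\<beta>\<in>diagram lam. box_factor a y (U \<beta>) \<beta>)"
      using class_sum_symmetric[of a y] unfolding d by (simp add: k_def)
  qed
qed

lemma nth_column_order: "j < length (column_order lam) \<Longrightarrow> column_order lam ! j \<in> diagram lam"
  using set_column_order[OF lam] nth_mem by blast

lemma column_order_before: "i < j \<Longrightarrow> j < length (column_order lam) \<Longrightarrow> column_before (column_order lam ! i) (column_order lam ! j)"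
  using sorted_column_order[of lam] by (simp add: sorted_wrt_iff_nth_less)

definition remaining_factors :: "(box \<Rightarrow> nat) \<Rightarrow> nat \<Rightarrow> (nat \<Rightarrow> 'r) \<Rightarrow> 'r" where
  "remaining_factors U i y = (\<Prod>j\<in>{i..<length (column_order lam)}. box_factor a y (U (column_order lam ! j)) (column_order lam ! j))"

lemma remaining_factors_0: "remaining_factors U 0 y = (\<Prod>\<beta>\<in>diagram lam. box_factor a y (U \<beta>) \<beta>)"
proof -
  have "bij_betw ((!) (column_order lam)) {0..<length (column_order lam)} (diagram lam)"
    using bij_betw_nth[OF distinct_column_order[of lam], of "{0..<length (column_order lam)}" "diagram lam"] set_column_order[OF lam]
    by (simp add: lessThan_atLeast0)
  then show ?thesis unfolding remaining_factors_def by (rule prod.reindex_bij_betw)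
qed

text \<open>
  Terms with a bad shape cancel within a Bender-Knuth class. Here \<open>\<rho>\<close> is what a partition has become
  by adding a box in row \<open>k\<close> where this is not allowed. The boxes read after position \<open>i\<close> are those in later columns, to which
  \<open>class_sum_symmetric\<close> applies, and those above it in its own column, whose letters exceed \<open>k\<close> and are
  not affected by the exchange of the two variables.
\<close>

lemma bad_class_sum:
  assumes U0: "U0 \<in> strict_fillings n lam" and i: "i < length (column_order lam)" and kd: "k = U0 (column_order lam ! i)" "2 \<le> k"
    and \<rho>: "\<rho> k = Suc (\<rho> (k - 1))"
  defines "C \<equiv> {U \<in> strict_fillings n lam. bk_key k (snd (column_order lam ! i)) U = bk_key k (snd (column_order lam ! i)) U0}"
  shows "(\<Sum>U\<in>C. alt n (\<lambda>y. remaining_factors U (Suc i) y * factorial_monomial a n \<rho> y) x) = 0"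
proof -
  obtain i1 j0 where ij: "column_order lam ! i = (i1, j0)" by (cases "column_order lam ! i")
  have bd: "(i1, j0) \<in> diagram lam" using nth_column_order[OF i] ij by simp
  have kn: "k \<le> n" using strict_fillings_range[OF U0 bd] kd ij by simp
  interpret bender_knuth n lam k j0 U0
    using lam kd kn U0 ij bd by unfold_locales auto
  have C: "C = bk_class" unfolding C_def by (simp add: bk_class_def bk_key_eq_iff ij)
  let ?t = "transpose (k - 2) (k - 1)"
  define A where "A = (!) (column_order lam) ` {Suc i..<length (column_order lam)}"
  have inj: "inj_on ((!) (column_order lam)) {Suc i..<length (column_order lam)}"
    using distinct_column_order[of lam] by (auto simp: inj_on_def nth_eq_iff_index_eq)
  have rest_A: "remaining_factors U (Suc i) y = (\<Prod>\<beta>\<in>A. box_factor a y (U \<beta>) \<beta>)" for U y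
    unfolding remaining_factors_def A_def by (simp add: prod.reindex[OF inj])
  have Asub: "A \<subseteq> d" using nth_column_order by (auto simp: A_def)
  have Aafter: "j0 < snd \<beta> \<or> (snd \<beta> = j0 \<and> fst \<beta> < i1)" if "\<beta> \<in> A" for \<beta>
  proof -
    have "\<beta> \<in> (!) (column_order lam) ` {Suc i..<length (column_order lam)}" using that by (simp add: A_def)
    then obtain m where "\<beta> = column_order lam ! m" "m \<in> {Suc i..<length (column_order lam)}" by (rule imageE)
    then show ?thesis using column_order_before[of i m] ij by (auto simp: column_before_def)
  qed
  have right: "\<beta> \<in> A" if "\<beta> \<in> d" "j0 < snd \<beta>" for \<beta>
  proof -
    have "\<beta> \<in> set (column_order lam)" using that(1) by (simp add: set_column_order[OF lam])
    then obtain m where m: "m < length (column_order lam)" "\<beta> = column_order lam ! m" by (auto simp: in_set_conv_nth)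
    have "\<not> m < i" using column_order_before[of m i] i m(2) that(2) ij by (auto simp: column_before_def)
    moreover have "m \<noteq> i" using m(2) that(2) ij by auto
    ultimately show ?thesis using m by (auto simp: A_def)
  qed
  let ?R = "{\<beta> \<in> d. j0 < snd \<beta>}"
  have R: "?R \<subseteq> A" using right by auto
  have finA: "finite A" by (simp add: A_def)
  have split: "remaining_factors U (Suc i) y = (\<Prod>\<beta>\<in>A - ?R. box_factor a y (U0 \<beta>) \<beta>) * (\<Prod>\<beta>\<in>?R. box_factor a y (U \<beta>) \<beta>)"
    if "U \<in> C" for U y
  proof -
    have "(\<Prod>\<beta>\<in>A - ?R. box_factor a y (U \<beta>) \<beta>) = (\<Prod>\<beta>\<in>A - ?R. box_factor a y (U0 \<beta>) \<beta>)"
      by (rule prod.cong) (use that Asub in \<open>auto simp: C bk_class_def not_less\<close>)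
    then show ?thesis unfolding rest_A prod.subset_diff[OF R finA] by simp
  qed
  \<comment> \<open>Above position \<open>i\<close> in its column the letters exceed \<open>k\<close>, so they avoid both variables.\<close>
  have fixed_part: "(\<Prod>\<beta>\<in>A - ?R. box_factor a (y \<circ> ?t) (U0 \<beta>) \<beta>) = (\<Prod>\<beta>\<in>A - ?R. box_factor a y (U0 \<beta>) \<beta>)" for y
  proof (rule prod.cong[OF refl])
    fix \<beta> assume b: "\<beta> \<in> A - ?R"
    then have "snd \<beta> = j0" "fst \<beta> < i1" "\<beta> \<in> d" using Aafter[of \<beta>] Asub by auto
    then have "k < U0 \<beta>" using col[of "fst \<beta>" j0 i1] bd kd(1) ij \<open>\<beta> \<in> d\<close> by (cases \<beta>) auto
    then have "?t (U0 \<beta> - 1) = U0 \<beta> - 1" using kd(2) by (auto simp: transpose_def)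
    then show "box_factor a (y \<circ> ?t) (U0 \<beta>) \<beta> = box_factor a y (U0 \<beta>) \<beta>" by (simp add: box_factor_def)
  qed
  let ?F = "\<lambda>y. (\<Sum>U\<in>C. remaining_factors U (Suc i) y) * factorial_monomial a n \<rho> y"
  have "(\<Sum>U\<in>C. remaining_factors U (Suc i) y) = (\<Prod>\<beta>\<in>A - ?R. box_factor a y (U0 \<beta>) \<beta>) * (\<Sum>U\<in>bk_class. \<Prod>\<beta>\<in>?R. box_factor a y (U \<beta>) \<beta>)" for y
    using split by (simp add: C sum_distrib_left)
  then have "?F (y \<circ> ?t) = ?F y" for y
    by (simp only: fixed_part class_sum_symmetric factorial_monomial_symmetric[OF kd(2) kn \<rho>])
  then have "alt n ?F x = 0"
    using kd(2) kn by (intro alt_eq_0[of "k - 2" n "k - 1"]) auto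
  then show ?thesis unfolding sum_distrib_right alt_sum .
qed

text \<open>
  The expansion after \<open>i\<close> boxes, with only the barrings kept that have met partitions so far; the
  factors of the other boxes are still unexpanded inside the alternating sum.
\<close>

definition partial_expansion :: "nat \<Rightarrow> 'r" where
  "partial_expansion i = (\<Sum>U\<in>strict_fillings n lam. \<Sum>B\<in>{B \<in> Pow {..<i}. yamanouchi_path \<mu> (column_order lam) U B i}.
      path_weight a \<mu> (column_order lam) U B i * alt n (\<lambda>y. remaining_factors U i y * factorial_monomial a n (path \<mu> (column_order lam) U B i) y) x)"

text \<open>
  The next factor is split into a barred and an unbarred term. The barred terms whose new shape is not
  a partition are grouped by Bender-Knuth classes for the letter just read: on a class, the fillings
  agree up to position \<open>i\<close>, so weights and shapes are constant and \<open>bad_class_sum\<close> applies.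
\<close>

lemma partial_expansion_Suc:
  assumes i: "i < length (column_order lam)"
  shows "partial_expansion i = partial_expansion (Suc i)"
proof -
  let ?S = "strict_fillings n lam"
  let ?P = "\<lambda>U B. path \<mu> (column_order lam) U B i"
  let ?k = "\<lambda>U. U (column_order lam ! i)"
  let ?w = "\<lambda>U B. path_weight a \<mu> (column_order lam) U B i"
  let ?v = "\<lambda>U B. a (int (?k U) - int (?P U B (?k U))) - a (int (?k U) - content (column_order lam ! i))"
  let ?ok = "\<lambda>U B. yamanouchi_path \<mu> (column_order lam) U B i"
  let ?up = "\<lambda>U B. add_box (?k U) (?P U B)"
  let ?All = "\<lambda>U. {B \<in> Pow {..<i}. ?ok U B}"
  let ?Good = "\<lambda>U. {B \<in> Pow {..<i}. ?ok U B \<and> is_partition (?up U B)}"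
  let ?Bad = "\<lambda>U. {B \<in> Pow {..<i}. ?ok U B \<and> \<not> is_partition (?up U B)}"
  let ?alt = "\<lambda>U \<rho>. alt n (\<lambda>y. remaining_factors U (Suc i) y * factorial_monomial a n \<rho> y) x"
  have "partial_expansion i = (\<Sum>U\<in>?S. \<Sum>B\<in>?All U. ?w U B * ?alt U (?up U B) + ?w U B * ?v U B * ?alt U (?P U B))"
    unfolding partial_expansion_def
  proof (intro sum.cong refl)
    fix U B assume U: "U \<in> ?S"
    have k: "1 \<le> ?k U" "?k U \<le> n" using strict_fillings_range[OF U nth_column_order[OF i]] by auto
    have "remaining_factors U i y * factorial_monomial a n (?P U B) y =
        remaining_factors U (Suc i) y * factorial_monomial a n (?up U B) y +
        ?v U B * (remaining_factors U (Suc i) y * factorial_monomial a n (?P U B) y)" for y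
    proof -
      have r: "remaining_factors U i y = box_factor a y (?k U) (column_order lam ! i) * remaining_factors U (Suc i) y"
        unfolding remaining_factors_def by (rule prod.atLeast_Suc_lessThan[OF i])
      have b: "box_factor a y (?k U) (column_order lam ! i) = (y (?k U - 1) - a (int (?k U) - int (?P U B (?k U)))) + ?v U B"
        by (simp add: box_factor_def)
      show ?thesis unfolding r b factorial_monomial_add_box[OF k, symmetric]
        by (simp add: algebra_simps)
    qed
    then have "alt n (\<lambda>y. remaining_factors U i y * factorial_monomial a n (?P U B) y) x = ?alt U (?up U B) + ?v U B * ?alt U (?P U B)"
      by (simp only: alt_add alt_scale)
    then show "?w U B * alt n (\<lambda>y. remaining_factors U i y * factorial_monomial a n (?P U B) y) x =
        ?w U B * ?alt U (?up U B) + ?w U B * ?v U B * ?alt U (?P U B)" by (simp only: distrib_left mult.assoc)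
  qed
  also have "\<dots> = (\<Sum>U\<in>?S. \<Sum>B\<in>?All U. ?w U B * ?alt U (?up U B)) +
      (\<Sum>U\<in>?S. \<Sum>B\<in>?All U. ?w U B * ?v U B * ?alt U (?P U B))"
    by (simp only: sum.distrib)
  also have "(\<Sum>U\<in>?S. \<Sum>B\<in>?All U. ?w U B * ?alt U (?up U B)) =
      (\<Sum>U\<in>?S. \<Sum>B\<in>?Good U. ?w U B * ?alt U (?up U B)) +
      (\<Sum>U\<in>?S. \<Sum>B\<in>?Bad U. ?w U B * ?alt U (?up U B))"
    unfolding sum.distrib[symmetric]
  proof (rule sum.cong[OF refl])
    fix U
    have e: "?All U = ?Good U \<union> ?Bad U"
      by auto
    show "(\<Sum>B\<in>?All U. ?w U B * ?alt U (?up U B)) =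
       (\<Sum>B\<in>?Good U. ?w U B * ?alt U (?up U B)) +
       (\<Sum>B\<in>?Bad U. ?w U B * ?alt U (?up U B))"
      by (subst e, rule sum.union_disjoint) auto
  qed
  also have "(\<Sum>U\<in>?S. \<Sum>B\<in>?Bad U. ?w U B * ?alt U (?up U B)) = 0"
  proof -
    let ?g = "\<lambda>U B. if ?ok U B \<and> \<not> is_partition (?up U B) then ?w U B * ?alt U (?up U B) else 0"
    have "(\<Sum>U\<in>?S. \<Sum>B\<in>?Bad U. ?w U B * ?alt U (?up U B)) = (\<Sum>U\<in>?S. \<Sum>B\<in>Pow {..<i}. ?g U B)"
      by (intro sum.cong refl sum.inter_filter) simp
    also have "\<dots> = (\<Sum>B\<in>Pow {..<i}. \<Sum>U\<in>?S. ?g U B)" by (rule sum.swap)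
    also have "\<dots> = 0"
    proof (rule sum.neutral, rule ballI)
      fix B
      have "(\<Sum>U\<in>?S. ?g U B) = (\<Sum>U\<in>?S. 0)"
      proof (rule sum_by_classes[of _ _ "\<lambda>U. (?k U, bk_key (?k U) (snd (column_order lam ! i)) U)", OF finite_strict_fillings[OF lam]])
        fix U0 assume U0: "U0 \<in> ?S"
        let ?C = "{U \<in> ?S. (?k U, bk_key (?k U) (snd (column_order lam ! i)) U) = (?k U0, bk_key (?k U0) (snd (column_order lam ! i)) U0)}"
        have C: "?C = {U \<in> ?S. bk_key (?k U0) (snd (column_order lam ! i)) U = bk_key (?k U0) (snd (column_order lam ! i)) U0}"
          using nth_column_order[OF i] by (auto simp: bk_key_eq_iff)
        have same: "U (column_order lam ! j) = U0 (column_order lam ! j)" if "U \<in> ?C" "j \<le> i" for U j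
        proof -
          have "snd (column_order lam ! j) \<le> snd (column_order lam ! i)"
            using column_order_before[of j i] i that(2) by (cases "j = i") (auto simp: column_before_def)
          then show ?thesis using that nth_column_order[of j] i by (auto simp: bk_key_eq_iff)
        qed
        have eqs: "?P U B = ?P U0 B" "?w U B = ?w U0 B" "?ok U B = ?ok U0 B" "?k U = ?k U0" if "U \<in> ?C" for U
          using same[OF that] by (auto intro!: path_cong path_weight_cong yamanouchi_path_cong)
        show "(\<Sum>U\<in>?C. ?g U B) = (\<Sum>U\<in>?C. 0)"
        proof (cases "?ok U0 B \<and> \<not> is_partition (?up U0 B)")
          case True
          have part: "is_partition (?P U0 B)" using True by (simp add: yamanouchi_path_def)
          have k1: "1 \<le> ?k U0" using strict_fillings_range[OF U0 nth_column_order[OF i]] by simp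
          note np = not_partition_add_box[OF part k1 conjunct2[OF True]]
          have "?up U0 B (?k U0) = Suc (?up U0 B (?k U0 - 1))"
            unfolding add_box_def fun_upd_same np(2) using np(1) by simp
          note zero = bad_class_sum[OF U0 i refl np(1) this]
          have "(\<Sum>U\<in>?C. ?g U B) = (\<Sum>U\<in>?C. ?w U0 B * ?alt U (?up U0 B))"
          proof (rule sum.cong[OF refl])
            fix U assume "U \<in> ?C"
            note e = eqs[OF this]
            show "?g U B = ?w U0 B * ?alt U (?up U0 B)" unfolding e using True by simp
          qed
          also have "\<dots> = 0" unfolding C sum_distrib_left[symmetric] zero by simp
          finally show ?thesis by simp
        next
          case False
          have "?g U B = 0" if "U \<in> ?C" for U unfolding eqs[OF that] by (rule if_not_P[OF False])
          then show ?thesis by (intro sum.cong refl)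
        qed
      qed
      then show "(\<Sum>U\<in>?S. ?g U B) = 0" by simp
    qed
    finally show ?thesis .
  qed
  also have "(\<Sum>U\<in>?S. \<Sum>B\<in>?Good U. ?w U B * ?alt U (?up U B)) + 0 +
      (\<Sum>U\<in>?S. \<Sum>B\<in>?All U. ?w U B * ?v U B * ?alt U (?P U B)) = partial_expansion (Suc i)"
    unfolding partial_expansion_def add_0_right sum.distrib[symmetric]
  proof (rule sum.cong[OF refl])
    fix U
    let ?h = "\<lambda>B. path_weight a \<mu> (column_order lam) U B (Suc i) * ?alt U (path \<mu> (column_order lam) U B (Suc i))"
    let ?X = "{B \<in> Pow {..<Suc i}. yamanouchi_path \<mu> (column_order lam) U B (Suc i)}"
    have e: "?X = {B \<in> ?X. i \<in> B} \<union> {B \<in> ?X. i \<notin> B}" by auto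
    have "sum ?h ?X = sum ?h {B \<in> ?X. i \<in> B} + sum ?h {B \<in> ?X. i \<notin> B}"
      by (subst e, rule sum.union_disjoint) auto
    also have "sum ?h {B \<in> ?X. i \<in> B} = (\<Sum>B\<in>?Good U. ?w U B * ?alt U (?up U B))"
    proof (rule sum.reindex_bij_witness[of _ "insert i" "\<lambda>B. B - {i}"])
      fix B assume B: "B \<in> {B \<in> ?X. i \<in> B}"
      have c: "path \<mu> (column_order lam) U (B - {i}) i = path \<mu> (column_order lam) U B i" "path_weight a \<mu> (column_order lam) U (B - {i}) i = path_weight a \<mu> (column_order lam) U B i"
         "yamanouchi_path \<mu> (column_order lam) U (B - {i}) i = yamanouchi_path \<mu> (column_order lam) U B i"
        by (auto intro!: path_cong path_weight_cong yamanouchi_path_cong)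
      show "insert i (B - {i}) = B" using B by auto
      show "B - {i} \<in> ?Good U"
        using B by (auto simp: c yamanouchi_path_Suc less_Suc_eq)
      have "{..<Suc i} - B = {..<i} - B" using B by (auto simp: less_Suc_eq)
      then have "path_weight a \<mu> (column_order lam) U B (Suc i) = path_weight a \<mu> (column_order lam) U B i" by (simp add: path_weight_def)
      then show "?w U (B - {i}) * ?alt U (?up U (B - {i})) = ?h B" using B by (simp add: c)
    next
      fix B assume B: "B \<in> ?Good U"
      have c: "path \<mu> (column_order lam) U (insert i B) i = path \<mu> (column_order lam) U B i" "yamanouchi_path \<mu> (column_order lam) U (insert i B) i = yamanouchi_path \<mu> (column_order lam) U B i"
        by (auto intro!: path_cong yamanouchi_path_cong)
      show "insert i B - {i} = B" using B by auto
      show "insert i B \<in> {B \<in> ?X. i \<in> B}" using B by (auto simp: c yamanouchi_path_Suc)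
    qed
    also have "sum ?h {B \<in> ?X. i \<notin> B} = (\<Sum>B\<in>?All U. ?w U B * ?v U B * ?alt U (?P U B))"
    proof (rule sum.cong)
      have "yamanouchi_path \<mu> (column_order lam) U B (Suc i) = ?ok U B" if "i \<notin> B" for B
        unfolding yamanouchi_path_Suc using that by (auto simp: yamanouchi_path_def)
      then show "{B \<in> ?X. i \<notin> B} = ?All U"
        by (auto simp: less_Suc_eq)
      fix B assume "B \<in> ?All U"
      then have iB: "i \<notin> B" by auto
      then have "{..<Suc i} - B = insert i ({..<i} - B)" by auto
      then have "path_weight a \<mu> (column_order lam) U B (Suc i) = ?w U B * ?v U B" by (simp add: path_weight_def mult.commute)
      then show "?h B = ?w U B * ?v U B * ?alt U (?P U B)" using iB by simp
    qed
    finally show "(\<Sum>B\<in>?Good U. ?w U B * ?alt U (?up U B)) +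
        (\<Sum>B\<in>?All U. ?w U B * ?v U B * ?alt U (?P U B)) = sum ?h ?X" by simp
  qed
  finally show ?thesis .
qed

theorem tableau_polynomial_times_alternant:
  "tableau_polynomial x * alternant a n \<mu> x =
     (\<Sum>U\<in>strict_fillings n lam. \<Sum>B\<in>{B \<in> Pow {..<length (column_order lam)}. yamanouchi_path \<mu> (column_order lam) U B (length (column_order lam))}.
        path_weight a \<mu> (column_order lam) U B (length (column_order lam)) * alternant a n (path \<mu> (column_order lam) U B (length (column_order lam))) x)"
proof -
  have "tableau_polynomial x * alternant a n \<mu> x = alt n (\<lambda>y. tableau_polynomial y * factorial_monomial a n \<mu> y) x"
    unfolding alternant_def by (rule alt_symmetric_mult[symmetric]) (rule tableau_polynomial_symmetric)
  also have "\<dots> = (\<Sum>U\<in>strict_fillings n lam. alt n (\<lambda>y. remaining_factors U 0 y * factorial_monomial a n \<mu> y) x)"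
    unfolding tableau_polynomial_def sum_distrib_right alt_sum remaining_factors_0 ..
  also have "\<dots> = partial_expansion 0"
  proof -
    have "{B \<in> Pow {..<0}. yamanouchi_path \<mu> (column_order lam) U B 0} = {{}}" for U using \<mu> by (auto simp: yamanouchi_path_def)
    then show ?thesis by (simp add: partial_expansion_def path_weight_def)
  qed
  also have "\<dots> = partial_expansion (length (column_order lam))"
  proof -
    have "i \<le> length (column_order lam) \<Longrightarrow> partial_expansion 0 = partial_expansion i" for i
      by (induction i) (auto simp: partial_expansion_Suc)
    then show ?thesis by simp
  qed
  also have "\<dots> = (\<Sum>U\<in>strict_fillings n lam. \<Sum>B\<in>{B \<in> Pow {..<length (column_order lam)}. yamanouchi_path \<mu> (column_order lam) U B (length (column_order lam))}.
        path_weight a \<mu> (column_order lam) U B (length (column_order lam)) * alternant a n (path \<mu> (column_order lam) U B (length (column_order lam))) x)"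
    by (simp add: partial_expansion_def remaining_factors_def alternant_def)
  finally show ?thesis .
qed

end

section \<open>From barred fillings to tableaux\<close>

lemma apply_word_append: "apply_word (S @ S') \<mu> = apply_word S' (apply_word S \<mu>)"
  by (simp add: apply_word_def)

lemma apply_word_eq_count: "apply_word S \<mu> k = \<mu> k + count_list S k"
  by (induction S arbitrary: \<mu>) (auto simp: apply_word_def add_box_def)

lemma barred_word_append: "barred_word T (xs @ ys) = barred_word T xs @ barred_word T ys"
  by (simp add: barred_word_def)

lemma count_barred_word:
  "distinct xs \<Longrightarrow> count_list (barred_word T xs) k = card {\<beta> \<in> set xs. is_barred (T \<beta>) \<and> val (T \<beta>) = k}"
proof (induction xs)
  case (Cons \<beta> xs)
  let ?A = "{\<gamma> \<in> set xs. is_barred (T \<gamma>) \<and> val (T \<gamma>) = k}"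
  have "{\<gamma> \<in> set (\<beta> # xs). is_barred (T \<gamma>) \<and> val (T \<gamma>) = k} =
      (if is_barred (T \<beta>) \<and> val (T \<beta>) = k then insert \<beta> ?A else ?A)" by auto
  then show ?case using Cons by (simp add: barred_word_def)
qed (simp add: barred_word_def)

lemma yamanouchi_snoc:
  "yamanouchi (S @ [k]) \<mu> \<longleftrightarrow> yamanouchi S \<mu> \<and> is_partition (apply_word (S @ [k]) \<mu>)"
  unfolding yamanouchi_def by (auto simp: le_Suc_eq)

lemma set_take_sorted_wrt:
  assumes "sorted_wrt R xs" "\<And>x y. R x y \<Longrightarrow> \<not> R y x" "i < length xs"
  shows "set (take i xs) = {y \<in> set xs. R y (xs ! i)}"
proof -
  have "xs = take i xs @ xs ! i # drop (Suc i) xs" using id_take_nth_drop[OF assms(3)] .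
  moreover from this have "sorted_wrt R (take i xs @ xs ! i # drop (Suc i) xs)" using assms(1) by simp
  then have "\<forall>y\<in>set (take i xs). R y (xs ! i)" "\<forall>y\<in>set (drop (Suc i) xs). R (xs ! i) y"
    by (auto simp: sorted_wrt_append)
  moreover have "set xs = set (take i xs) \<union> {xs ! i} \<union> set (drop (Suc i) xs)"
    by (subst calculation(1)) simp
  ultimately show ?thesis using assms(2) by blast
qed

lemma takeWhile_neq_nth:
  assumes "distinct xs" "i < length xs"
  shows "takeWhile (\<lambda>y. y \<noteq> xs ! i) xs = take i xs"
  by (rule takeWhile_eq_take_P_nth) (use assms in \<open>auto simp: nth_eq_iff_index_eq\<close>)

text \<open>
  Of two boxes with equal letters in different rows of a column strict filling, the lower one is
  strictly further left.
\<close>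

lemma before_same_letter:
  assumes lam: "is_partition lam" and T: "T \<in> reverse_tableaux lam" "column_strict lam T"
    and d: "\<alpha> \<in> diagram lam" "\<beta> \<in> diagram lam" and eq: "val (T \<alpha>) = val (T \<beta>)"
  shows "column_before \<beta> \<alpha> \<longleftrightarrow> row_before \<beta> \<alpha>"
proof -
  have nlt: "\<not> (fst \<alpha> < fst \<beta> \<and> snd \<alpha> \<le> snd \<beta>)"
    if d: "\<alpha> \<in> diagram lam" "\<beta> \<in> diagram lam" and eq: "val (T \<alpha>) = val (T \<beta>)" for \<alpha> \<beta>
  proof
    assume lt: "fst \<alpha> < fst \<beta> \<and> snd \<alpha> \<le> snd \<beta>"
    obtain i j i' j' where ij: "\<alpha> = (i, j)" "\<beta> = (i', j')" by (cases \<alpha>, cases \<beta>)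
    have m: "(i, j') \<in> diagram lam"
      using diagram_down_closed[OF lam, of i' j' i j'] d lt ij by (auto simp: diagram_def)
    have "val (T (i', j')) < val (T (i, j'))" using T(2) m d lt ij by (auto simp: column_strict_def)
    moreover have "val (T (i, j')) \<le> val (T (i, j))"
      using T(1) m d(1) lt ij by (cases "j = j'") (auto simp: reverse_tableaux_def)
    ultimately show False using eq ij by simp
  qed
  show ?thesis using nlt[OF d eq] nlt[OF d(2,1) eq[symmetric]]
    unfolding column_before_def row_before_def by auto
qed

definition yamanouchi_tableaux :: "nat \<Rightarrow> (nat \<Rightarrow> nat) \<Rightarrow> (nat \<Rightarrow> nat) \<Rightarrow> (box \<Rightarrow> entry) set" where
  "yamanouchi_tableaux n lam \<mu> =
     {T \<in> reverse_tableaux lam. column_strict lam T \<and> yamanouchi (column_word lam T) \<mu> \<and>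
        (\<forall>\<beta>\<in>diagram lam. val (T \<beta>) \<le> n)}"

text \<open>
  The weight of the theorem in an arbitrary ring; it is needed in \<open>\<int>[a]\<close> and, through constants, in
  \<open>\<int>[a][x]\<close>.
\<close>

definition barring_weight :: "(int \<Rightarrow> 'r::comm_ring_1) \<Rightarrow> (nat \<Rightarrow> nat) \<Rightarrow> (nat \<Rightarrow> nat) \<Rightarrow> (box \<Rightarrow> entry) \<Rightarrow> 'r" where
  "barring_weight a lam \<mu> T =
     (\<Prod>\<alpha> \<in> {\<alpha> \<in> diagram lam. \<not> is_barred (T \<alpha>)}.
        a (int (val (T \<alpha>)) - int (rho_row lam \<mu> T \<alpha> (val (T \<alpha>)))) - a (int (val (T \<alpha>)) - content \<alpha>))"

definition content_word :: "(nat \<Rightarrow> nat) \<Rightarrow> (box \<Rightarrow> entry) \<Rightarrow> (nat \<Rightarrow> nat) \<Rightarrow> (nat \<Rightarrow> nat)" where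
  "content_word lam T \<mu> = apply_word (column_word lam T) \<mu>"

text \<open>
  The letter \<open>k\<close> of an unbarred box sees the same barred letters \<open>k\<close> before it in both orders, hence
  the same length of row \<open>k\<close>.
\<close>

lemma count_before:
  assumes lam: "is_partition lam" and T: "T \<in> reverse_tableaux lam" "column_strict lam T"
    and i: "i < length (column_order lam)" and nb: "\<not> is_barred (T (column_order lam ! i))"
  defines "\<alpha> \<equiv> column_order lam ! i"
  shows "apply_word (barred_word T (take i (column_order lam))) \<mu> (val (T \<alpha>)) = rho_row lam \<mu> T \<alpha> (val (T \<alpha>))"
proof -
  let ?cs = "column_order lam" and ?rs = "row_order lam" and ?v = "val (T \<alpha>)"
  have comp: "is_composition lam" using lam by (simp add: is_partition_def)
  have \<alpha>: "\<alpha> \<in> diagram lam" using i set_column_order[OF lam] nth_mem unfolding \<alpha>_def by blast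
  then have "\<alpha> \<in> set ?rs" using set_row_order[OF comp] by simp
  then obtain m where m: "m < length ?rs" "\<alpha> = ?rs ! m" by (auto simp: in_set_conv_nth)
  have col: "set (take i ?cs) = {\<beta> \<in> diagram lam. column_before \<beta> \<alpha>}"
    unfolding \<alpha>_def set_column_order[OF lam, symmetric]
    by (rule set_take_sorted_wrt[OF sorted_column_order _ i]) (auto simp: column_before_def)
  have row: "set (take m ?rs) = {\<beta> \<in> diagram lam. row_before \<beta> \<alpha>}"
    unfolding m(2) set_row_order[OF comp, symmetric]
    by (rule set_take_sorted_wrt[OF sorted_row_order _ m(1)]) (auto simp: row_before_def)
  have "row_word_upto lam T \<alpha> = barred_word T (take m ?rs)"
    using takeWhile_neq_nth[OF distinct_row_order m(1)] nb
    by (simp add: row_word_upto_def m(2)[symmetric] barred_word_append) (simp add: barred_word_def \<alpha>_def)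
  moreover have "{\<beta> \<in> set (take i ?cs). is_barred (T \<beta>) \<and> val (T \<beta>) = ?v} =
      {\<beta> \<in> set (take m ?rs). is_barred (T \<beta>) \<and> val (T \<beta>) = ?v}"
    unfolding col row using before_same_letter[OF lam T \<alpha>] by auto
  ultimately show ?thesis unfolding rho_row_def apply_word_eq_count
    by (simp add: count_barred_word distinct_column_order distinct_row_order)
qed

definition letters :: "(nat \<Rightarrow> nat) \<Rightarrow> (box \<Rightarrow> entry) \<Rightarrow> box \<Rightarrow> nat" where
  "letters lam T = restrict (val \<circ> T) (diagram lam)"

definition bars :: "(nat \<Rightarrow> nat) \<Rightarrow> (box \<Rightarrow> entry) \<Rightarrow> nat set" where
  "bars lam T = {j. j < length (column_order lam) \<and> is_barred (T (column_order lam ! j))}"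

definition barring :: "(nat \<Rightarrow> nat) \<Rightarrow> (box \<Rightarrow> nat) \<times> nat set \<Rightarrow> box \<Rightarrow> entry" where
  "barring lam = (\<lambda>(U, B). restrict (\<lambda>\<beta>. if \<beta> \<in> (!) (column_order lam) ` B then Barred (U \<beta>) else Unbarred (U \<beta>)) (diagram lam))"

lemma path_eq_apply_word:
  assumes lam: "is_partition lam" and "i \<le> length (column_order lam)"
  shows "path \<mu> (column_order lam) (letters lam T) (bars lam T) i = apply_word (barred_word T (take i (column_order lam))) \<mu>"
    and "is_partition \<mu> \<Longrightarrow> yamanouchi_path \<mu> (column_order lam) (letters lam T) (bars lam T) i \<longleftrightarrow>
      yamanouchi (barred_word T (take i (column_order lam))) \<mu>"
  using assms(2)
proof (induction i)
  case 0
  { case 1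
    show ?case by (simp add: apply_word_def barred_word_def)
  next
    case 2
    then show ?case by (simp add: yamanouchi_path_def yamanouchi_def apply_word_def barred_word_def)
  }
next
  case (Suc i)
  let ?cs = "column_order lam"
  { case 1
    then have i: "i < length ?cs" by simp
    then have "?cs ! i \<in> diagram lam" using set_column_order[OF lam] nth_mem by blast
    then show ?case using Suc.IH(1) i
      by (simp add: take_Suc_conv_app_nth barred_word_append apply_word_append)
        (simp add: bars_def letters_def barred_word_def apply_word_def)
  next
    case 2
    then have i: "i < length ?cs" by simp
    have d: "?cs ! i \<in> diagram lam" using i set_column_order[OF lam] nth_mem by blast
    have p: "path \<mu> ?cs (letters lam T) (bars lam T) (Suc i) = apply_word (barred_word T (take (Suc i) ?cs)) \<mu>"
      using Suc.IH(1) i d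
      by (simp add: take_Suc_conv_app_nth barred_word_append apply_word_append)
        (simp add: bars_def letters_def barred_word_def apply_word_def)
    have ih: "yamanouchi_path \<mu> ?cs (letters lam T) (bars lam T) i \<longleftrightarrow> yamanouchi (barred_word T (take i ?cs)) \<mu>"
      using Suc.IH(2) 2 i by simp
    have y: "is_partition (apply_word S \<mu>)" if "yamanouchi S \<mu>" for S
      using that unfolding yamanouchi_def by (auto dest: spec[of _ "length S"])
    show ?case
    proof (cases "is_barred (T (?cs ! i))")
      case True
      then have "barred_word T (take (Suc i) ?cs) = barred_word T (take i ?cs) @ [val (T (?cs ! i))]"
        using i by (simp add: take_Suc_conv_app_nth barred_word_append) (simp add: barred_word_def)
      then show ?thesis unfolding yamanouchi_path_Suc p ih by (simp only: yamanouchi_snoc)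
    next
      case False
      then have "barred_word T (take (Suc i) ?cs) = barred_word T (take i ?cs)"
        using i by (simp add: take_Suc_conv_app_nth barred_word_append) (simp add: barred_word_def)
      then show ?thesis unfolding yamanouchi_path_Suc p ih using y by auto
    qed
  }
qed

lemma path_weight_eq_weight:
  assumes lam: "is_partition lam" and T: "T \<in> reverse_tableaux lam" "column_strict lam T"
  shows "path_weight a \<mu> (column_order lam) (letters lam T) (bars lam T) (length (column_order lam)) = barring_weight a lam \<mu> T"
proof -
  let ?cs = "column_order lam"
  let ?B = "bars lam T"
  have d: "?cs ! j \<in> diagram lam" if "j < length ?cs" for j
    using that set_column_order[OF lam] nth_mem by blast
  have bij0: "bij_betw ((!) ?cs) {..<length ?cs} (diagram lam)"
    using bij_betw_nth[OF distinct_column_order[of lam], of "{..<length ?cs}" "diagram lam"] set_column_order[OF lam] by simp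
  then have "(!) ?cs ` {..<length ?cs} = diagram lam" by (simp add: bij_betw_def)
  then have "(!) ?cs ` {j \<in> {..<length ?cs}. \<not> is_barred (T (?cs ! j))} = {\<alpha> \<in> diagram lam. \<not> is_barred (T \<alpha>)}"
    using Compr_image_eq[of "(!) ?cs" "{..<length ?cs}" "\<lambda>\<alpha>. \<not> is_barred (T \<alpha>)"] by (simp only:)
  then have "bij_betw ((!) ?cs) {j \<in> {..<length ?cs}. \<not> is_barred (T (?cs ! j))} {\<alpha> \<in> diagram lam. \<not> is_barred (T \<alpha>)}"
    by (intro bij_betw_subset[OF bij0]) auto
  moreover have "{..<length ?cs} - ?B = {j \<in> {..<length ?cs}. \<not> is_barred (T (?cs ! j))}"
    by (auto simp: bars_def)
  ultimately have bij: "bij_betw ((!) ?cs) ({..<length ?cs} - ?B) {\<alpha> \<in> diagram lam. \<not> is_barred (T \<alpha>)}" by simp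
  show ?thesis unfolding path_weight_def barring_weight_def prod.reindex_bij_betw[OF bij, symmetric]
  proof (rule prod.cong[OF refl])
    fix j assume j: "j \<in> {..<length ?cs} - ?B"
    then have l: "j < length ?cs" and nb: "\<not> is_barred (T (?cs ! j))" by (auto simp: bars_def)
    have u: "letters lam T (?cs ! j) = val (T (?cs ! j))" using d[OF l] by (simp add: letters_def)
    have p: "path \<mu> ?cs (letters lam T) ?B j = apply_word (barred_word T (take j ?cs)) \<mu>"
      by (rule path_eq_apply_word[OF lam]) (use l in simp)
    show "a (int (letters lam T (?cs ! j)) - int (path \<mu> ?cs (letters lam T) ?B j (letters lam T (?cs ! j)))) -
        a (int (letters lam T (?cs ! j)) - content (?cs ! j)) =
      a (int (val (T (?cs ! j))) - int (rho_row lam \<mu> T (?cs ! j) (val (T (?cs ! j))))) - a (int (val (T (?cs ! j))) - content (?cs ! j))"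
      unfolding u p count_before[OF lam T l nb] ..
  qed
qed

lemma barring_inverse:
  assumes lam: "is_partition lam" and U: "U \<in> strict_fillings n lam" and B: "B \<subseteq> {..<length (column_order lam)}"
  shows "letters lam (barring lam (U, B)) = U" "bars lam (barring lam (U, B)) = B"
    "barring lam (U, B) \<in> reverse_tableaux lam" "column_strict lam (barring lam (U, B))"
    "\<And>\<beta>. \<beta> \<in> diagram lam \<Longrightarrow> val (barring lam (U, B) \<beta>) \<le> n"
proof -
  let ?cs = "column_order lam"
  let ?T = "barring lam (U, B)"
  have d: "?cs ! j \<in> diagram lam" if "j < length ?cs" for j
    using that set_column_order[OF lam] nth_mem by blast
  have v: "val (?T \<beta>) = U \<beta>" if "\<beta> \<in> diagram lam" for \<beta> using that by (simp add: barring_def)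
  show "letters lam ?T = U"
    using v strict_fillings_ext[OF U] by (auto simp: letters_def fun_eq_iff)
  have "is_barred (?T (?cs ! j)) \<longleftrightarrow> j \<in> B" if "j < length ?cs" for j
  proof -
    have "?cs ! j \<in> (!) ?cs ` B \<longleftrightarrow> j \<in> B"
      using that B distinct_column_order[of lam] by (auto simp: image_iff nth_eq_iff_index_eq subset_iff)
    then show ?thesis using d[OF that] by (simp add: barring_def is_barred_def)
  qed
  then show "bars lam ?T = B" using B by (auto simp: bars_def)
  have "?T \<in> diagram lam \<rightarrow>\<^sub>E {e. 1 \<le> val e}"
    using v strict_fillings_range[OF U] by (auto simp: barring_def)
  then show "?T \<in> reverse_tableaux lam"
    using v strict_fillings_row[OF U] by (auto simp: reverse_tableaux_def)
  show "column_strict lam ?T" using v strict_fillings_col[OF U] by (auto simp: column_strict_def)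
  show "\<beta> \<in> diagram lam \<Longrightarrow> val (?T \<beta>) \<le> n" for \<beta> using v strict_fillings_range[OF U] by auto
qed

lemma inverse_barring:
  assumes lam: "is_partition lam" and T: "T \<in> reverse_tableaux lam" "column_strict lam T"
    and n: "\<And>\<beta>. \<beta> \<in> diagram lam \<Longrightarrow> val (T \<beta>) \<le> n"
  shows "letters lam T \<in> strict_fillings n lam" "bars lam T \<subseteq> {..<length (column_order lam)}"
    "barring lam (letters lam T, bars lam T) = T"
proof -
  let ?cs = "column_order lam"
  have v: "letters lam T \<beta> = val (T \<beta>)" if "\<beta> \<in> diagram lam" for \<beta> using that by (simp add: letters_def)
  have E: "T \<in> diagram lam \<rightarrow>\<^sub>E {e. 1 \<le> val e}" using T(1) by (simp add: reverse_tableaux_def)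
  have "letters lam T \<in> diagram lam \<rightarrow>\<^sub>E {1..n}"
    using n PiE_mem[OF E] by (auto simp: letters_def)
  then show "letters lam T \<in> strict_fillings n lam"
    using T by (auto simp: strict_fillings_def v reverse_tableaux_def column_strict_def)
  show "bars lam T \<subseteq> {..<length ?cs}" by (auto simp: bars_def)
  show "barring lam (letters lam T, bars lam T) = T"
  proof
    fix \<beta>
    show "barring lam (letters lam T, bars lam T) \<beta> = T \<beta>"
    proof (cases "\<beta> \<in> diagram lam")
      case True
      then have "\<beta> \<in> set ?cs" using set_column_order[OF lam] by simp
      then have "\<beta> \<in> (!) ?cs ` bars lam T \<longleftrightarrow> is_barred (T \<beta>)"
        by (auto simp: bars_def in_set_conv_nth)
      then show ?thesis using True v[OF True] by (cases "T \<beta>") (auto simp: barring_def is_barred_def)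
    next
      case False
      then show ?thesis using PiE_arb[OF E False] by (simp add: barring_def)
    qed
  qed
qed

lemma finite_yamanouchi_tableaux:
  assumes lam: "is_partition lam"
  shows "finite (yamanouchi_tableaux n lam \<mu>)"
proof -
  let ?X = "strict_fillings n lam \<times> Pow {..<length (column_order lam)}"
  have "yamanouchi_tableaux n lam \<mu> \<subseteq> barring lam ` ?X"
  proof
    fix T assume T: "T \<in> yamanouchi_tableaux n lam \<mu>"
    then have "T \<in> reverse_tableaux lam" "column_strict lam T" "\<And>\<beta>. \<beta> \<in> diagram lam \<Longrightarrow> val (T \<beta>) \<le> n"
      by (auto simp: yamanouchi_tableaux_def)
    note inv = inverse_barring[OF lam this]
    show "T \<in> barring lam ` ?X"
      by (rule image_eqI[of _ _ "(letters lam T, bars lam T)"]) (use inv in auto)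
  qed
  then show ?thesis by (rule finite_subset) (simp add: finite_strict_fillings[OF lam])
qed

theorem tableau_polynomial_times_alternant_tableaux:
  fixes a :: "int \<Rightarrow> 'r::idom"
  assumes lam: "is_partition lam" and \<mu>: "is_partition \<mu>"
  shows "tableau_polynomial n lam a x * alternant a n \<mu> x =
    (\<Sum>T\<in>yamanouchi_tableaux n lam \<mu>. barring_weight a lam \<mu> T * alternant a n (content_word lam T \<mu>) x)"
proof -
  let ?cs = "column_order lam"
  let ?N = "length ?cs"
  let ?B = "\<lambda>U. {B \<in> Pow {..<?N}. yamanouchi_path \<mu> ?cs U B ?N}"
  have "tableau_polynomial n lam a x * alternant a n \<mu> x =
     (\<Sum>(U, B)\<in>(SIGMA U:strict_fillings n lam. ?B U). path_weight a \<mu> ?cs U B ?N * alternant a n (path \<mu> ?cs U B ?N) x)"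
    unfolding tableau_polynomial_times_alternant[OF lam \<mu>]
    by (rule sum.Sigma) (auto simp: finite_strict_fillings[OF lam])
  also have "\<dots> = (\<Sum>T\<in>yamanouchi_tableaux n lam \<mu>. barring_weight a lam \<mu> T * alternant a n (content_word lam T \<mu>) x)"
  proof (rule sum.reindex_bij_witness[of _ "\<lambda>T. (letters lam T, bars lam T)" "barring lam"])
    fix p assume "p \<in> (SIGMA U:strict_fillings n lam. ?B U)"
    then obtain U B where p: "p = (U, B)" and U: "U \<in> strict_fillings n lam" and B: "B \<subseteq> {..<?N}"
      and ok: "yamanouchi_path \<mu> ?cs U B ?N" by auto
    note inv = barring_inverse[OF lam U B]
    show "(letters lam (barring lam p), bars lam (barring lam p)) = p" by (simp add: p inv)
    have ok': "yamanouchi (barred_word (barring lam (U, B)) (take ?N ?cs)) \<mu>"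
      using path_eq_apply_word(2)[OF lam order_refl \<mu>, of "barring lam (U, B)"] ok by (simp add: inv)
    show "barring lam p \<in> yamanouchi_tableaux n lam \<mu>"
      using inv ok' by (simp add: p yamanouchi_tableaux_def column_word_def)
    have w: "path_weight a \<mu> ?cs U B ?N = barring_weight a lam \<mu> (barring lam (U, B))"
      using path_weight_eq_weight[OF lam inv(3,4), of a \<mu>] by (simp add: inv)
    have c: "path \<mu> ?cs U B ?N = content_word lam (barring lam (U, B)) \<mu>"
      using path_eq_apply_word(1)[OF lam order_refl, of \<mu> "barring lam (U, B)"]
      by (simp add: inv content_word_def column_word_def)
    show "barring_weight a lam \<mu> (barring lam p) * alternant a n (content_word lam (barring lam p) \<mu>) x =
        (case p of (U, B) \<Rightarrow> path_weight a \<mu> ?cs U B ?N * alternant a n (path \<mu> ?cs U B ?N) x)"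
      by (simp add: p w c)
  next
    fix T assume T: "T \<in> yamanouchi_tableaux n lam \<mu>"
    then have T': "T \<in> reverse_tableaux lam" "column_strict lam T" "\<And>\<beta>. \<beta> \<in> diagram lam \<Longrightarrow> val (T \<beta>) \<le> n"
      "yamanouchi (column_word lam T) \<mu>" by (auto simp: yamanouchi_tableaux_def)
    note inv = inverse_barring[OF lam T'(1,2,3)]
    show "barring lam (letters lam T, bars lam T) = T" by (rule inv(3))
    have "yamanouchi_path \<mu> ?cs (letters lam T) (bars lam T) ?N"
      using path_eq_apply_word(2)[OF lam order_refl \<mu>, of T] T'(4) by (simp add: column_word_def)
    then show "(letters lam T, bars lam T) \<in> (SIGMA U:strict_fillings n lam. ?B U)" using inv by auto
  qed
  finally show ?thesis .
qed

section \<open>The tableau polynomial as a quotient of alternants\<close>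

lemma down_closed_eq_interval:
  fixes S :: "nat set"
  assumes "finite S" "\<And>i. i \<in> S \<Longrightarrow> 1 \<le> i" "\<And>i i'. i \<in> S \<Longrightarrow> 1 \<le> i' \<Longrightarrow> i' \<le> i \<Longrightarrow> i' \<in> S"
  shows "S = {1..card S}"
proof (cases "S = {}")
  case False
  then have m: "Max S \<in> S" using assms(1) by simp
  have "S = {1..Max S}"
  proof
    show "S \<subseteq> {1..Max S}" using assms(1,2) by auto
    show "{1..Max S} \<subseteq> S" using assms(3)[OF m] by auto
  qed
  moreover from this have "card S = Max S" by (metis card_atLeastAtMost diff_Suc_1)
  ultimately show ?thesis by simp
qed simp

definition column_height :: "(nat \<Rightarrow> nat) \<Rightarrow> nat \<Rightarrow> nat" where
  "column_height lam j = card {i. (i, j) \<in> diagram lam}"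

lemma diagram_iff_column_height:
  assumes lam: "is_partition lam"
  shows "(i, j) \<in> diagram lam \<longleftrightarrow> 1 \<le> i \<and> i \<le> column_height lam j"
proof -
  have "{i. (i, j) \<in> diagram lam} = {1..card {i. (i, j) \<in> diagram lam}}"
  proof (rule down_closed_eq_interval)
    have "{i. (i, j) \<in> diagram lam} \<subseteq> fst ` diagram lam" by force
    then show "finite {i. (i, j) \<in> diagram lam}"
      using finite_diagram_partition[OF lam] finite_subset by blast
    show "1 \<le> i" if "i \<in> {i. (i, j) \<in> diagram lam}" for i using that by (simp add: diagram_def)
    show "i' \<in> {i. (i, j) \<in> diagram lam}" if "i \<in> {i. (i, j) \<in> diagram lam}" "1 \<le> i'" "i' \<le> i" for i i'
      using diagram_down_closed[OF lam, of i j i' j] that by (auto simp: diagram_def)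
  qed
  then show ?thesis unfolding column_height_def by (metis atLeastAtMost_iff mem_Collect_eq)
qed

text \<open>
  The tableau with all entries barred whose columns read \<open>1, 2, 3, \<dots>\<close> from bottom to top.
\<close>

definition superstandard :: "(nat \<Rightarrow> nat) \<Rightarrow> box \<Rightarrow> entry" where
  "superstandard lam = restrict (\<lambda>(i, j). Barred (Suc (column_height lam j) - i)) (diagram lam)"

lemma composition_apply_word:
  assumes "is_composition \<mu>" "0 \<notin> set S"
  shows "is_composition (apply_word S \<mu>)"
proof -
  have "{i. apply_word S \<mu> i \<noteq> 0} \<subseteq> {i. \<mu> i \<noteq> 0} \<union> set S"
    by (auto simp: apply_word_eq_count)
  then have "finite {i. apply_word S \<mu> i \<noteq> 0}"
    using assms(1) finite_subset by (auto simp: is_composition_def)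
  moreover have "apply_word S \<mu> 0 = 0" using assms by (simp add: apply_word_eq_count is_composition_def count_notin)
  ultimately show ?thesis by (simp add: is_composition_def)
qed

lemma zero_partition: "is_partition (\<lambda>_. 0)"
  by (simp add: is_partition_def is_composition_def)

context
  fixes lam :: "nat \<Rightarrow> nat"
  assumes lam: "is_partition lam"
begin

lemmas in_diagram = diagram_iff_column_height[OF lam]

lemma height_antimono: "1 \<le> j' \<Longrightarrow> j' \<le> j \<Longrightarrow> column_height lam j \<le> column_height lam j'"
proof -
  assume j: "1 \<le> j'" "j' \<le> j"
  show ?thesis
  proof (cases "column_height lam j = 0")
    case False
    then have "(column_height lam j, j) \<in> diagram lam" by (simp add: in_diagram)
    then have "(column_height lam j, j') \<in> diagram lam" using diagram_down_closed[OF lam, of "column_height lam j" j "column_height lam j" j'] j by (auto simp: diagram_def)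
    then show ?thesis by (simp add: in_diagram)
  qed simp
qed

lemma superstandard_val: "(i, j) \<in> diagram lam \<Longrightarrow> superstandard lam (i, j) = Barred (Suc (column_height lam j) - i)"
  by (simp add: superstandard_def)

text \<open>
  The letter \<open>k\<close> occurs once in every column that is long enough, so its occurrences can be counted by
  columns.
\<close>

lemma superstandard_letter_card:
  assumes P: "P \<subseteq> diagram lam" and k: "1 \<le> k"
  shows "card {\<beta> \<in> P. is_barred (superstandard lam \<beta>) \<and> val (superstandard lam \<beta>) = k} =
    card {j. (k, j) \<in> diagram lam \<and> (Suc (column_height lam j) - k, j) \<in> P}"
  (is "card ?L = card ?J")
proof (rule bij_betw_same_card[of snd], rule bij_betw_byWitness[of _ "\<lambda>j. (Suc (column_height lam j) - k, j)"])
  show "\<forall>\<beta>\<in>?L. (Suc (column_height lam (snd \<beta>)) - k, snd \<beta>) = \<beta>"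
  proof
    fix \<beta> assume b: "\<beta> \<in> ?L"
    obtain i j where ij: "\<beta> = (i, j)" by (cases \<beta>)
    then have "(i, j) \<in> diagram lam" using b P by auto
    then show "(Suc (column_height lam (snd \<beta>)) - k, snd \<beta>) = \<beta>" using b ij by (auto simp: superstandard_val in_diagram)
  qed
  show "snd ` ?L \<subseteq> ?J"
  proof
    fix j assume "j \<in> snd ` ?L"
    then obtain i where i: "(i, j) \<in> P" "val (superstandard lam (i, j)) = k" by auto
    then have "(i, j) \<in> diagram lam" using P by auto
    then show "j \<in> ?J"
      using i by (auto simp: superstandard_val in_diagram)
  qed
  show "(\<lambda>j. (Suc (column_height lam j) - k, j)) ` ?J \<subseteq>
      ?L"
    using k by (auto simp: superstandard_def in_diagram is_barred_def)
qed simp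

text \<open>
  In a column, \<open>k\<close> is read before \<open>k + 1\<close>. Thus at any time, the columns in which \<open>k + 1\<close> has been
  read are among those in which \<open>k\<close> has.
\<close>

lemma superstandard_yamanouchi:
  assumes n: "len lam \<le> n"
  shows "superstandard lam \<in> yamanouchi_tableaux n lam (\<lambda>_. 0)"
proof -
  let ?T = "superstandard lam" and ?cs = "column_order lam"
  have h1: "column_height lam j \<le> len lam" if "(i, j) \<in> diagram lam" for i j
  proof -
    have "(column_height lam j, j) \<in> diagram lam" using that by (simp add: in_diagram)
    then have "lam (column_height lam j) \<noteq> 0" by (auto simp: diagram_def)
    then show ?thesis using row_le_len lam by (auto simp: is_partition_def)
  qed
  have pos: "1 \<le> val (?T \<beta>)" "val (?T \<beta>) \<le> n" if "\<beta> \<in> diagram lam" for \<beta>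
    using that h1[of "fst \<beta>" "snd \<beta>"] n by (cases \<beta>; auto simp: superstandard_val in_diagram)+
  have "?T \<in> diagram lam \<rightarrow>\<^sub>E {e. 1 \<le> val e}" using pos by (auto simp: superstandard_def)
  moreover have "val (?T (i, j')) \<le> val (?T (i, j))" if "(i, j) \<in> diagram lam" "(i, j') \<in> diagram lam" "j < j'" for i j j'
    using that height_antimono[of j j'] by (auto simp: superstandard_val diagram_def)
  ultimately have rev: "?T \<in> reverse_tableaux lam" by (auto simp: reverse_tableaux_def)
  have strict: "column_strict lam ?T"
    unfolding column_strict_def using superstandard_val by (auto simp: in_diagram)
  have part: "is_partition (apply_word (barred_word ?T (take i ?cs)) (\<lambda>_. 0))" if i: "i \<le> length ?cs" for i
  proof -
    let ?P = "set (take i ?cs)"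
    let ?J = "\<lambda>k. {j. (k, j) \<in> diagram lam \<and> (Suc (column_height lam j) - k, j) \<in> ?P}"
    have P: "?P \<subseteq> diagram lam" using set_take_subset[of i ?cs] set_column_order[OF lam] by auto
    have closed: "\<gamma> \<in> ?P" if b: "\<beta> \<in> ?P" and bef: "column_before \<gamma> \<beta>" and g: "\<gamma> \<in> diagram lam" for \<beta> \<gamma>
    proof -
      obtain m where m: "m < i" "\<beta> = ?cs ! m" using b i by (auto simp: in_set_conv_nth)
      have "\<gamma> \<in> set ?cs" using g set_column_order[OF lam] by simp
      then obtain m' where m': "m' < length ?cs" "\<gamma> = ?cs ! m'" by (auto simp: in_set_conv_nth)
      have "\<not> m < m'"
      proof
        assume "m < m'"
        then have "column_before \<beta> \<gamma>"
          using sorted_column_order[of lam] m m' by (simp add: sorted_wrt_iff_nth_less)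
        then show False using bef by (auto simp: column_before_def)
      qed
      then have "m' < i" using m by simp
      then show ?thesis using m' i by (auto simp: in_set_conv_nth)
    qed
    have cnt: "apply_word (barred_word ?T (take i ?cs)) (\<lambda>_. 0) k = card (?J k)"
      if "1 \<le> k" for k
      using that by (simp add: apply_word_eq_count count_barred_word distinct_column_order superstandard_letter_card[OF P])
    have "0 \<notin> set (barred_word ?T (take i ?cs))" using pos P by (force simp: barred_word_def)
    then have "is_composition (apply_word (barred_word ?T (take i ?cs)) (\<lambda>_. 0))"
      using zero_partition by (intro composition_apply_word) (simp_all add: is_partition_def)
    moreover have "card (?J (Suc k)) \<le> card (?J k)"
      if k: "1 \<le> k" for k
    proof (rule card_mono)
      have "(?J k) \<subseteq> snd ` diagram lam" by force
      then show "finite (?J k)"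
        using finite_diagram_partition[OF lam] finite_subset by blast
      show "(?J (Suc k)) \<subseteq> (?J k)"
      proof
        fix j assume "j \<in> (?J (Suc k))"
        then have j: "(Suc k, j) \<in> diagram lam" "(Suc (column_height lam j) - Suc k, j) \<in> ?P" by auto
        have "(Suc (column_height lam j) - k, j) \<in> ?P"
          by (rule closed[OF j(2)]) (use j(1) k in \<open>auto simp: column_before_def in_diagram\<close>)
        then show "j \<in> (?J k)" using j(1) k by (auto simp: in_diagram)
      qed
    qed
    ultimately show ?thesis by (simp add: is_partition_def cnt)
  qed
  have "yamanouchi_path (\<lambda>_. 0) ?cs (letters lam ?T) (bars lam ?T) (length ?cs)"
    unfolding yamanouchi_path_def using part path_eq_apply_word(1)[OF lam] by simp
  then have "yamanouchi (column_word lam ?T) (\<lambda>_. 0)"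
    using path_eq_apply_word(2)[OF lam order_refl zero_partition] by (simp add: column_word_def)
  then show ?thesis using rev strict pos by (simp add: yamanouchi_tableaux_def)
qed

lemma superstandard_content: "content_word lam (superstandard lam) (\<lambda>_. 0) = lam"
proof
  fix k
  let ?T = "superstandard lam"
  have "content_word lam ?T (\<lambda>_. 0) k = card {\<beta> \<in> diagram lam. is_barred (?T \<beta>) \<and> val (?T \<beta>) = k}"
    by (simp add: content_word_def column_word_def apply_word_eq_count count_barred_word distinct_column_order set_column_order[OF lam])
  also have "\<dots> = lam k"
  proof (cases "k = 0")
    case True
    have "{\<beta> \<in> diagram lam. is_barred (?T \<beta>) \<and> val (?T \<beta>) = k} = {}" using True by (auto simp: superstandard_val in_diagram)
    then have "card {\<beta> \<in> diagram lam. is_barred (?T \<beta>) \<and> val (?T \<beta>) = k} = 0" by (simp only: card.empty)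
    then show ?thesis using True lam by (simp add: is_partition_def is_composition_def)
  next
    case False
    have "(k, j) \<in> diagram lam \<Longrightarrow> (Suc (column_height lam j) - k, j) \<in> diagram lam" for j by (auto simp: in_diagram)
    then have "{j. (k, j) \<in> diagram lam \<and> (Suc (column_height lam j) - k, j) \<in> diagram lam} = {j. (k, j) \<in> diagram lam}" by blast
    also have "\<dots> = {1..lam k}" using False by (auto simp: diagram_def)
    finally have "{j. (k, j) \<in> diagram lam \<and> (Suc (column_height lam j) - k, j) \<in> diagram lam} = {1..lam k}" .
    then show ?thesis using superstandard_letter_card[OF order_refl, of k] False by simp
  qed
  finally show "content_word lam ?T (\<lambda>_. 0) k = lam k" .
qed

lemma superstandard_weight: "barring_weight a lam \<mu> (superstandard lam) = 1"
proof -
  have e: "{\<alpha> \<in> diagram lam. \<not> is_barred (superstandard lam \<alpha>)} = {}" by (auto simp: superstandard_def is_barred_def)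
  show ?thesis unfolding barring_weight_def e by simp
qed

text \<open>
  Column by column from the left. Let \<open>K\<close> be the top letter of column \<open>j\<close>. The earlier columns have
  supplied \<open>j - 1\<close> letters \<open>K\<close>, and \<open>j - 1\<close> is the content of the top box; so if this box were unbarred,
  its weight would vanish. Going down, a barred letter \<open>v \<ge> 2\<close> can be added to the shape only if \<open>v - 1\<close>
  has been read in the same column before, so \<open>v - 1\<close> stands barred directly below; this stops
  at 1 only.
\<close>

lemma unique_tableau:
  assumes T: "T \<in> yamanouchi_tableaux n lam (\<lambda>_. 0)" and w: "barring_weight a lam (\<lambda>_. 0) T \<noteq> 0"
  shows "T = superstandard lam"
proof -
  let ?cs = "column_order lam"
  have T1: "T \<in> reverse_tableaux lam" "column_strict lam T" "yamanouchi (column_word lam T) (\<lambda>_. 0)"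
    using T by (auto simp: yamanouchi_tableaux_def)
  have E: "T \<in> diagram lam \<rightarrow>\<^sub>E {e. 1 \<le> val e}" using T1(1) by (simp add: reverse_tableaux_def)
  have pos: "1 \<le> val (T \<beta>)" if "\<beta> \<in> diagram lam" for \<beta> using PiE_mem[OF E that] by simp
  have row: "val (T (i, j')) \<le> val (T (i, j))" if "(i, j) \<in> diagram lam" "(i, j') \<in> diagram lam" "j < j'" for i j j'
    using T1(1) that by (auto simp: reverse_tableaux_def)
  have col: "val (T (i', j)) < val (T (i, j))" if "(i, j) \<in> diagram lam" "(i', j) \<in> diagram lam" "i < i'" for i i' j
    using T1(2) that by (auto simp: column_strict_def)
  define c where "c \<beta> k = card {\<gamma> \<in> diagram lam. column_before \<gamma> \<beta> \<and> T \<gamma> = Barred k}" for \<beta> k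
  have bar: "is_barred e \<and> val e = k \<longleftrightarrow> e = Barred k" for e k by (cases e) (auto simp: is_barred_def)
  have c_word: "apply_word (barred_word T (take i ?cs)) (\<lambda>_. 0) k = c (?cs ! i) k" if "i < length ?cs" for i k
  proof -
    have "set (take i ?cs) = {\<gamma> \<in> diagram lam. column_before \<gamma> (?cs ! i)}"
      unfolding set_column_order[OF lam, symmetric]
      by (rule set_take_sorted_wrt[OF sorted_column_order _ that]) (auto simp: column_before_def)
    then show ?thesis
      by (simp add: apply_word_eq_count count_barred_word distinct_column_order bar c_def conj_assoc)
  qed
  have index: "\<exists>i<length ?cs. ?cs ! i = \<beta>" if "\<beta> \<in> diagram lam" for \<beta>
    using that unfolding set_column_order[OF lam, symmetric] by (simp add: in_set_conv_nth)
  \<comment> \<open>The shape after a barred \<open>v\<close> is a partition.\<close>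
  have Y: "c \<beta> v < c \<beta> (v - 1)" if \<beta>: "\<beta> \<in> diagram lam" and v: "T \<beta> = Barred v" "2 \<le> v" for \<beta> v
  proof -
    obtain i where i: "i < length ?cs" "?cs ! i = \<beta>" using index[OF \<beta>] by auto
    have "yamanouchi_path (\<lambda>_. 0) ?cs (letters lam T) (bars lam T) (length ?cs)"
      using path_eq_apply_word(2)[OF lam order_refl zero_partition, of T] T1(3) by (simp add: column_word_def)
    then have "is_partition (path (\<lambda>_. 0) ?cs (letters lam T) (bars lam T) (Suc i))"
      using i by (simp add: yamanouchi_path_def del: path.simps)
    then have "is_partition (apply_word (barred_word T (take (Suc i) ?cs)) (\<lambda>_. 0))"
      using path_eq_apply_word(1)[OF lam, of "Suc i"] i by simp
    moreover have "barred_word T (take (Suc i) ?cs) = barred_word T (take i ?cs) @ [v]"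
      using i v by (simp add: take_Suc_conv_app_nth barred_word_append) (simp add: barred_word_def is_barred_def)
    ultimately have "is_partition (add_box v (apply_word (barred_word T (take i ?cs)) (\<lambda>_. 0)))"
      by (simp add: apply_word_append) (simp add: apply_word_def)
    then have "add_box v (apply_word (barred_word T (take i ?cs)) (\<lambda>_. 0)) (Suc (v - 1)) \<le>
        add_box v (apply_word (barred_word T (take i ?cs)) (\<lambda>_. 0)) (v - 1)"
      unfolding is_partition_def using v(2) by (elim conjE allE[of _ "v - 1"]) simp
    then show ?thesis using v c_word[OF i(1)] i by (simp add: add_box_def split: if_splits)
  qed
  \<comment> \<open>An unbarred box whose letter sees a row as long as its content makes the weight vanish.\<close>
  have W: "int (c \<beta> (val (T \<beta>))) \<noteq> content \<beta>" if \<beta>: "\<beta> \<in> diagram lam" and nb: "\<not> is_barred (T \<beta>)" for \<beta>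
  proof
    assume eq: "int (c \<beta> (val (T \<beta>))) = content \<beta>"
    obtain i where i: "i < length ?cs" "?cs ! i = \<beta>" using index[OF \<beta>] by auto
    have "rho_row lam (\<lambda>_. 0) T \<beta> (val (T \<beta>)) = c \<beta> (val (T \<beta>))"
      using count_before[OF lam T1(1,2) i(1), of "\<lambda>_. 0"] nb i c_word[OF i(1)] by simp
    then have "barring_weight a lam (\<lambda>_. 0) T = 0"
      unfolding barring_weight_def using \<beta> nb eq finite_diagram_partition[OF lam]
      by (intro prod_zero bexI[of _ \<beta>]) simp_all
    then show False using w by simp
  qed
  have cols: "\<forall>i. (i, j) \<in> diagram lam \<longrightarrow> T (i, j) = Barred (Suc (column_height lam j) - i)" for j
  proof (induction j rule: less_induct)
    case (less j)
    have IH: "T (i, j') = Barred (Suc (column_height lam j') - i)" if "(i, j') \<in> diagram lam" "j' < j" for i j' using less that by blast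
    \<comment> \<open>Earlier columns are known; in column \<open>j\<close> only the boxes further down count.\<close>
    have cnt: "c (i, j) k = card {j'. j' < j \<and> (k, j') \<in> diagram lam} + card {i'. i < i' \<and> (i', j) \<in> diagram lam \<and> T (i', j) = Barred k}"
      if k: "1 \<le> k" for i k
    proof -
      let ?J = "{j'. j' < j \<and> (k, j') \<in> diagram lam}" and ?I = "{i'. i < i' \<and> (i', j) \<in> diagram lam \<and> T (i', j) = Barred k}"
      have "{\<gamma> \<in> diagram lam. column_before \<gamma> (i, j) \<and> T \<gamma> = Barred k} = (\<lambda>j'. (Suc (column_height lam j') - k, j')) ` ?J \<union> (\<lambda>i'. (i', j)) ` ?I"
        (is "?L = ?R")
      proof
        show "?L \<subseteq> ?R"
        proof
          fix \<gamma> assume "\<gamma> \<in> ?L"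
          then obtain i' j' where g: "\<gamma> = (i', j')" "(i', j') \<in> diagram lam" "j' < j \<or> (j' = j \<and> i < i')" "T (i', j') = Barred k"
            by (cases \<gamma>) (auto simp: column_before_def)
          show "\<gamma> \<in> ?R"
          proof (cases "j' < j")
            case True
            then have "k = Suc (column_height lam j') - i'" using IH[OF g(2)] g(4) by simp
            then have "i' = Suc (column_height lam j') - k" "(k, j') \<in> diagram lam" using g(2) k by (auto simp: in_diagram)
            then show ?thesis using True g(1) by auto
          next
            case False
            then show ?thesis using g by auto
          qed
        qed
        show "?R \<subseteq> ?L"
        proof -
          have "(Suc (column_height lam j') - k, j') \<in> ?L" if "j' < j" "(k, j') \<in> diagram lam" for j'
          proof -
            have "(Suc (column_height lam j') - k, j') \<in> diagram lam" using that by (auto simp: in_diagram)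
            moreover have "Suc (column_height lam j') - (Suc (column_height lam j') - k) = k" using that by (auto simp: in_diagram)
            ultimately show ?thesis using IH[of "Suc (column_height lam j') - k" j'] that(1) by (simp add: column_before_def)
          qed
          then show ?thesis by (auto simp: column_before_def)
        qed
      qed
      then have "c (i, j) k = card ((\<lambda>j'. (Suc (column_height lam j') - k, j')) ` ?J \<union> (\<lambda>i'. (i', j)) ` ?I)" by (simp add: c_def)
      also have "\<dots> = card ((\<lambda>j'. (Suc (column_height lam j') - k, j')) ` ?J) + card ((\<lambda>i'. (i', j)) ` ?I)"
      proof (rule card_Un_disjoint)
        have "finite ?J" by simp
        then show "finite ((\<lambda>j'. (Suc (column_height lam j') - k, j')) ` ?J)" by (rule finite_imageI)
        have "?I \<subseteq> {1..column_height lam j}" by (auto simp: in_diagram)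
        then show "finite ((\<lambda>i'. (i', j)) ` ?I)" using finite_subset by blast
      qed auto
      also have "card ((\<lambda>j'. (Suc (column_height lam j') - k, j')) ` ?J) = card ?J" by (rule card_image) (auto simp: inj_on_def)
      also have "card ((\<lambda>i'. (i', j)) ` ?I) = card ?I" by (rule card_image) (auto simp: inj_on_def)
      finally show ?thesis .
    qed
    show ?case
    proof (cases "(1, j) \<in> diagram lam")
      case False
      then show ?thesis by (auto simp: in_diagram)
    next
      case True
      define K where "K = val (T (1, j))"
      have j1: "1 \<le> j" using True by (simp add: diagram_def)
      have full: "card {j'. j' < j \<and> (k, j') \<in> diagram lam} = j - 1" if "1 \<le> k" "k \<le> K" for k
      proof -
        have "(k, j') \<in> diagram lam" if j': "1 \<le> j'" "j' < j" for j'
        proof -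
          have d1: "(1, j') \<in> diagram lam" using diagram_down_closed[OF lam True] j' by simp
          have "K \<le> val (T (1, j'))" unfolding K_def by (rule row[OF d1 True j'(2)])
          also have "\<dots> = column_height lam j'" using IH[OF d1 j'(2)] by simp
          finally show ?thesis using \<open>1 \<le> k\<close> \<open>k \<le> K\<close> by (simp add: in_diagram)
        qed
        then have "{j'. j' < j \<and> (k, j') \<in> diagram lam} = {1..<j}" by (auto simp: diagram_def)
        then show ?thesis by simp
      qed
      have own: "c (i, j) v = j - 1" if "(i, j) \<in> diagram lam" "val (T (i, j)) = v" for i v
      proof -
        have "v \<le> K" using that col[OF True, of i] by (cases "i = 1") (auto simp: K_def in_diagram)
        moreover have "1 \<le> v" using pos[OF that(1)] that(2) by simp
        moreover have none: "{i'. i < i' \<and> (i', j) \<in> diagram lam \<and> T (i', j) = Barred v} = {}"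
          using col[OF that(1)] that(2) by fastforce
        ultimately show ?thesis unfolding cnt[OF \<open>1 \<le> v\<close>] none by (simp add: full)
      qed
      have top: "T (1, j) = Barred K"
      proof -
        have "is_barred (T (1, j))"
          using W[OF True] own[OF True refl] j1 by (force simp: content_def)
        then show ?thesis by (auto simp: is_barred_def K_def)
      qed
      have next_row: "T (Suc i, j) = Barred (v - 1) \<and> (Suc i, j) \<in> diagram lam" if i: "(i, j) \<in> diagram lam" "T (i, j) = Barred v" "2 \<le> v" for i v
      proof -
        have "v \<le> K" using i col[OF True, of i] by (cases "i = 1") (auto simp: K_def in_diagram)
        then have "c (i, j) (v - 1) = j - 1 + card {i'. i < i' \<and> (i', j) \<in> diagram lam \<and> T (i', j) = Barred (v - 1)}"
          using i(3) by (subst cnt) (auto simp: full)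
        moreover have "j - 1 < c (i, j) (v - 1)" using Y[OF i] own[OF i(1), of v] i(2) by simp
        ultimately have "card {i'. i < i' \<and> (i', j) \<in> diagram lam \<and> T (i', j) = Barred (v - 1)} \<noteq> 0" by simp
        then have "{i'. i < i' \<and> (i', j) \<in> diagram lam \<and> T (i', j) = Barred (v - 1)} \<noteq> {}" by (metis card.empty)
        then obtain i' where i': "i < i'" "(i', j) \<in> diagram lam" "T (i', j) = Barred (v - 1)" by auto
        have s: "(Suc i, j) \<in> diagram lam" using i' by (simp add: in_diagram)
        have "i' = Suc i"
        proof (rule ccontr)
          assume "i' \<noteq> Suc i"
          then show False using col[OF s i'(2)] col[OF i(1) s] i' i(2) by auto
        qed
        then show ?thesis using i' by simp
      qed
      have all: "T (Suc m, j) = Barred (K - m) \<and> m < K" if "(Suc m, j) \<in> diagram lam" for m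
        using that
      proof (induction m)
        case 0
        then show ?case using top pos[OF True] by (simp add: K_def)
      next
        case (Suc m)
        have dm: "(Suc m, j) \<in> diagram lam" using Suc.prems by (simp add: in_diagram)
        have Tm: "T (Suc m, j) = Barred (K - m)" "m < K" using Suc.IH[OF dm] by auto
        have "2 \<le> K - m" using col[OF dm Suc.prems] pos[OF Suc.prems] Tm by simp
        then show ?case using next_row[OF dm Tm(1)] by simp
      qed
      have hj: "1 \<le> column_height lam j" using True by (simp add: in_diagram)
      have "K = column_height lam j"
      proof (rule ccontr)
        assume ne: "K \<noteq> column_height lam j"
        have dh: "(Suc (column_height lam j - 1), j) \<in> diagram lam" using hj by (simp add: in_diagram)
        have "2 \<le> K - (column_height lam j - 1)" using all[OF dh] ne hj by auto
        then have "(Suc (Suc (column_height lam j - 1)), j) \<in> diagram lam" using next_row[OF dh conjunct1[OF all[OF dh]]] by blast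
        then show False using hj by (simp add: in_diagram)
      qed
      show ?thesis
      proof (intro allI impI)
        fix i assume i: "(i, j) \<in> diagram lam"
        then obtain m where "i = Suc m" by (cases i) (auto simp: in_diagram)
        then show "T (i, j) = Barred (Suc (column_height lam j) - i)" using all[of m] i \<open>K = column_height lam j\<close> by simp
      qed
    qed
  qed
  show ?thesis
  proof
    fix \<beta>
    show "T \<beta> = superstandard lam \<beta>"
    proof (cases "\<beta> \<in> diagram lam")
      case True
      then show ?thesis using cols[of "snd \<beta>"] by (cases \<beta>) (simp add: superstandard_val)
    next
      case False
      then show ?thesis using PiE_arb[OF E False] by (simp add: superstandard_def)
    qed
  qed
qed

theorem tableau_polynomial_times_denominator:
  fixes a :: "int \<Rightarrow> 'r::idom"
  assumes n: "len lam \<le> n"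
  shows "tableau_polynomial n lam a x * alternant a n (\<lambda>_. 0) x = alternant a n lam x"
proof -
  let ?Y = "yamanouchi_tableaux n lam (\<lambda>_. 0)"
  let ?f = "\<lambda>T. barring_weight a lam (\<lambda>_. 0) T * alternant a n (content_word lam T (\<lambda>_. 0)) x"
  have "tableau_polynomial n lam a x * alternant a n (\<lambda>_. 0) x = sum ?f ?Y"
    by (rule tableau_polynomial_times_alternant_tableaux[OF lam zero_partition])
  also have "\<dots> = sum ?f {superstandard lam}"
  proof (rule sum.mono_neutral_right)
    show "finite ?Y" by (rule finite_yamanouchi_tableaux[OF lam])
    show "{superstandard lam} \<subseteq> ?Y" using superstandard_yamanouchi[OF n] by simp
    show "\<forall>T\<in>?Y - {superstandard lam}. ?f T = 0" using unique_tableau[of _ n a] by auto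
  qed
  also have "\<dots> = alternant a n lam x" by (simp add: superstandard_weight superstandard_content)
  finally show ?thesis .
qed

end

section \<open>Jacobi-Trudi determinants as quotients of alternants\<close>

unbundle fps_syntax
no_notation vec_index (infixl "$" 100)

definition geometric :: "'r::comm_ring_1 \<Rightarrow> 'r fps" where
  "geometric z = Abs_fps (\<lambda>k. z ^ k)"

definition linear_factor :: "'r::comm_ring_1 \<Rightarrow> 'r fps" where
  "linear_factor z = 1 - fps_const z * fps_X"

lemma linear_factor_mult_nth:
  "(linear_factor z * F) $ 0 = F $ 0" "(linear_factor z * F) $ Suc k = F $ Suc k - z * F $ k"
  by (simp_all add: linear_factor_def left_diff_distrib mult.assoc)

lemma linear_factor_nth_0: "linear_factor z $ 0 = 1"
  by (simp add: linear_factor_def)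

lemma linear_factor_geometric: "linear_factor z * geometric z = 1"
proof (rule fps_ext)
  fix k show "(linear_factor z * geometric z) $ k = 1 $ k"
    by (cases k) (simp_all add: linear_factor_mult_nth linear_factor_nth_0 geometric_def)
qed

text \<open>
  The generating function \<open>\<Prod>\<^sub>c (1 - a\<^sub>c t) / \<Prod>\<^sub>i (1 - x\<^sub>i t)\<close>. Its coefficients with \<open>C = {2 - p + s..n}\<close> are
  the images of \<open>h\<^sub>p\<close> under \<open>s\<close> shifts: the shift removes the smallest element from the interval.
\<close>

definition supersymmetric_series :: "(nat \<Rightarrow> 'r) \<Rightarrow> (int \<Rightarrow> 'r) \<Rightarrow> nat \<Rightarrow> int set \<Rightarrow> 'r::comm_ring_1 fps" where
  "supersymmetric_series x a n C = (\<Prod>c\<in>C. linear_factor (a c)) * (\<Prod>i<n. geometric (x i))"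

definition complete_coeff :: "(nat \<Rightarrow> 'r) \<Rightarrow> (int \<Rightarrow> 'r) \<Rightarrow> nat \<Rightarrow> int set \<Rightarrow> int \<Rightarrow> 'r::comm_ring_1" where
  "complete_coeff x a n C r = (if r < 0 then 0 else supersymmetric_series x a n C $ nat r)"

lemma supersymmetric_series_insert:
  "finite C \<Longrightarrow> c \<notin> C \<Longrightarrow> supersymmetric_series x a n (insert c C) = linear_factor (a c) * supersymmetric_series x a n C"
  by (simp add: supersymmetric_series_def mult_ac)

lemma complete_coeff_zero: "finite C \<Longrightarrow> complete_coeff x a n C 0 = 1"
proof -
  have "(\<Prod>c\<in>C. linear_factor (a c)) $ 0 = 1" if "finite C"
    using that by (induction C) (auto simp: linear_factor_mult_nth linear_factor_nth_0)
  moreover have "(\<Prod>i<n. geometric (x i)) $ 0 = 1"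
    by (induction n) (auto simp: geometric_def)
  ultimately show "finite C \<Longrightarrow> ?thesis" by (simp add: complete_coeff_def supersymmetric_series_def)
qed

lemma complete_coeff_insert:
  assumes "finite C" "c \<notin> C"
  shows "complete_coeff x a n (insert c C) r = complete_coeff x a n C r - a c * complete_coeff x a n C (r - 1)"
proof (cases "r \<le> 0")
  case True
  then show ?thesis using assms complete_coeff_zero[of "insert c C" x a n] complete_coeff_zero[of C x a n]
    by (cases "r = 0") (auto simp: complete_coeff_def)
next
  case False
  then have "r = int (Suc (nat r - 1))" by simp
  then obtain k where "r = int (Suc k)" by blast
  then show ?thesis by (simp add: complete_coeff_def supersymmetric_series_insert[OF assms] linear_factor_mult_nth nat_add_distrib)
qed

lemma prod_linear_factor_degree:
  fixes a :: "'i \<Rightarrow> 'r::comm_ring_1"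
  shows "finite C \<Longrightarrow> card C < k \<Longrightarrow> (\<Prod>c\<in>C. linear_factor (a c)) $ k = 0"
proof (induction C arbitrary: k rule: finite_induct)
  case (insert c C)
  then obtain m where k: "k = Suc m" by (cases k) auto
  then show ?case using insert by (simp add: linear_factor_mult_nth)
qed simp

text \<open>
  The coefficient of \<open>t\<^sup>N\<close> in \<open>Q(t) / (1 - z t)\<close>, where \<open>N\<close> bounds the degree of \<open>Q\<close>, is the value at
  \<open>z\<close> of the reversed polynomial.
\<close>

lemma prod_linear_factor_geometric_top:
  "finite C \<Longrightarrow> ((\<Prod>c\<in>C. linear_factor (a c)) * geometric z) $ card C = (\<Prod>c\<in>C. z - a c)"
proof (induction C rule: finite_induct)
  case empty
  then show ?case by (simp add: geometric_def)
next
  case (insert c C)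
  let ?Q = "\<Prod>c\<in>C. linear_factor (a c)"
  have "linear_factor z * (?Q * geometric z) = ?Q"
    by (metis linear_factor_geometric mult.left_commute mult_1_right)
  then have "(linear_factor z * (?Q * geometric z)) $ Suc (card C) = 0"
    using prod_linear_factor_degree[OF insert.hyps(1), of "Suc (card C)" a] by simp
  then have "(?Q * geometric z) $ Suc (card C) = z * (?Q * geometric z) $ card C"
    by (simp add: linear_factor_mult_nth)
  then have "(linear_factor (a c) * (?Q * geometric z)) $ Suc (card C) = (z - a c) * (\<Prod>c\<in>C. z - a c)"
    using insert.IH by (simp add: linear_factor_mult_nth left_diff_distrib)
  then show ?case using insert.hyps by (simp add: mult.assoc)
qed

lemma complete_coeff_Suc:
  assumes "finite C" "c \<notin> C"
  shows "complete_coeff x a (Suc n) (insert c C) r =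
     complete_coeff x a n C r + (x n - a c) * complete_coeff x a (Suc n) C (r - 1)"
proof -
  have step: "complete_coeff x a (Suc n) C r = complete_coeff x a n C r + x n * complete_coeff x a (Suc n) C (r - 1)" for r
  proof -
    have g: "geometric (x n) = 1 + fps_const (x n) * fps_X * geometric (x n)"
      using linear_factor_geometric[of "x n"] by (simp add: linear_factor_def algebra_simps)
    have s: "supersymmetric_series x a (Suc n) C = supersymmetric_series x a n C * geometric (x n)"
      by (simp add: supersymmetric_series_def mult.assoc)
    have e: "supersymmetric_series x a (Suc n) C = supersymmetric_series x a n C + fps_const (x n) * (fps_X * supersymmetric_series x a (Suc n) C)"
      unfolding s by (subst g) (simp add: algebra_simps)
    show ?thesis
    proof (cases "r \<le> 0")
      case True
      then show ?thesis using assms complete_coeff_zero[of C x a n] complete_coeff_zero[of C x a "Suc n"]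
        by (cases "r = 0") (auto simp: complete_coeff_def)
    next
      case False
      then have "r = int (Suc (nat r - 1))" by simp
      then obtain k where r: "r = int (Suc k)" by blast
      have "supersymmetric_series x a (Suc n) C $ Suc k = supersymmetric_series x a n C $ Suc k + x n * supersymmetric_series x a (Suc n) C $ k"
        by (subst e) simp
      then show ?thesis by (simp add: complete_coeff_def r nat_add_distrib)
    qed
  qed
  show ?thesis unfolding complete_coeff_insert[OF assms] step[of r] by (simp add: left_diff_distrib)
qed

text \<open>
  In row \<open>i\<close> of the Jacobi-Trudi matrix the number of shifts and the degree grow together, so all
  entries are coefficients of one and the same series.
\<close>

definition jacobi_trudi :: "(nat \<Rightarrow> 'r) \<Rightarrow> (int \<Rightarrow> 'r) \<Rightarrow> nat \<Rightarrow> (nat \<Rightarrow> nat) \<Rightarrow> 'r::comm_ring_1 mat" where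
  "jacobi_trudi x a n lam =
     mat n n (\<lambda>(i, j). complete_coeff x a n {2 + int i - int (lam (Suc i))..int n} (int (lam (Suc i)) + int j - int i))"

text \<open>
  Column \<open>k\<close> consists of the signed elementary symmetric polynomials in all variables but \<open>x k\<close>.
  Multiplying row \<open>i\<close> of the Jacobi-Trudi matrix by it convolves the series of row \<open>i\<close> with
  \<open>\<Prod>\<^bsub>j\<noteq>k\<^esub> (1 - x\<^sub>j t)\<close>, and only the variable \<open>x k\<close> is left in the denominator.
\<close>

definition omit_matrix :: "(nat \<Rightarrow> 'r) \<Rightarrow> nat \<Rightarrow> 'r::comm_ring_1 mat" where
  "omit_matrix x n = mat n n (\<lambda>(j, k). (\<Prod>i\<in>{..<n} - {k}. linear_factor (x i)) $ (n - 1 - j))"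

definition alternant_matrix :: "(nat \<Rightarrow> 'r) \<Rightarrow> (int \<Rightarrow> 'r) \<Rightarrow> nat \<Rightarrow> (nat \<Rightarrow> nat) \<Rightarrow> 'r::comm_ring_1 mat" where
  "alternant_matrix x a n lam = mat n n (\<lambda>(i, k). \<Prod>c\<in>{int i + 2 - int (lam (Suc i))..int n}. x k - a c)"

lemma det_alternant_matrix: "det (alternant_matrix x a n lam) = alternant a n lam x"
proof -
  have "det (alternant_matrix x a n lam) =
     (\<Sum>p | p permutes {0..<n}. signof p * (\<Prod>i = 0..<n. alternant_matrix x a n lam $$ (i, p i)))"
    by (rule det_def') (simp add: alternant_matrix_def)
  also have "\<dots> = alternant a n lam x"
    unfolding alternant_def alt_def factorial_monomial_def lessThan_atLeast0
  proof (rule sum.cong[OF refl], rule arg_cong[where f = "\<lambda>z. _ * z"], rule prod.cong[OF refl])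
    fix p i assume "p \<in> {p. p permutes {0..<n}}" "i \<in> {0..<n}"
    then have "i < n" "p i < n" using permutes_in_image[of p "{0..<n}" i] by auto
    then show "alternant_matrix x a n lam $$ (i, p i) = (\<Prod>c\<in>{int i + 2 - int (lam (Suc i))..int n}. (x \<circ> p) i - a c)"
      by (simp add: alternant_matrix_def)
  qed
  finally show ?thesis .
qed

lemma jacobi_trudi_times_omit:
  "jacobi_trudi x a n lam * omit_matrix x n = alternant_matrix x a n lam"
proof (rule eq_matI)
  fix i k assume "i < dim_row (alternant_matrix x a n lam)" "k < dim_col (alternant_matrix x a n lam)"
  then have i: "i < n" and k: "k < n" by (simp_all add: alternant_matrix_def)
  define M where "M = n - Suc i + lam (Suc i)"
  define C where "C = {int i + 2 - int (lam (Suc i))..int n}"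
  have C: "card C = M" "finite C" using i by (auto simp: C_def M_def)
  let ?D = "\<Prod>i\<in>{..<n} - {k}. linear_factor (x i)"
  let ?G = "supersymmetric_series x a n C"
  have DG: "?D * ?G = (\<Prod>c\<in>C. linear_factor (a c)) * geometric (x k)"
  proof -
    have "(\<Prod>i<n. geometric (x i)) = geometric (x k) * (\<Prod>i\<in>{..<n} - {k}. geometric (x i))"
      by (rule prod.remove) (use k in auto)
    moreover have "?D * (\<Prod>i\<in>{..<n} - {k}. geometric (x i)) = 1"
      unfolding prod.distrib[symmetric] linear_factor_geometric by simp
    ultimately show ?thesis unfolding supersymmetric_series_def by (simp add: mult_ac)
  qed
  \<comment> \<open>The sum over columns has \<open>n\<close> terms, the convolution \<open>M + 1\<close>; the others vanish.\<close>
  have deg: "?D $ q = 0" if "n \<le> q" for q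
    using prod_linear_factor_degree[of "{..<n} - {k}" q x] that k by simp
  have "(jacobi_trudi x a n lam * omit_matrix x n) $$ (i, k) =
      (\<Sum>j<n. complete_coeff x a n C (int (lam (Suc i)) + int j - int i) * ?D $ (n - 1 - j))"
    using i k by (simp add: jacobi_trudi_def omit_matrix_def scalar_prod_def C_def lessThan_atLeast0 algebra_simps)
  also have "\<dots> = (\<Sum>q<n. ?D $ q * complete_coeff x a n C (int M - int q))"
    by (rule sum.reindex_bij_witness[of _ "\<lambda>q. n - 1 - q" "\<lambda>q. n - 1 - q"])
      (use i in \<open>auto simp: M_def of_nat_diff algebra_simps\<close>)
  also have "\<dots> = (\<Sum>q<max n (Suc M). ?D $ q * complete_coeff x a n C (int M - int q))"
    by (rule sum.mono_neutral_left) (auto simp: deg)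
  also have "\<dots> = (\<Sum>q<Suc M. ?D $ q * complete_coeff x a n C (int M - int q))"
    by (rule sum.mono_neutral_right) (auto simp: complete_coeff_def)
  also have "\<dots> = (?D * ?G) $ M"
    unfolding fps_mult_nth atLeast0AtMost lessThan_Suc_atMost
    by (rule sum.cong) (auto simp: complete_coeff_def nat_diff_distrib)
  also have "\<dots> = (\<Prod>c\<in>C. x k - a c)"
    unfolding DG C(1)[symmetric] by (rule prod_linear_factor_geometric_top[OF C(2)])
  finally show "(jacobi_trudi x a n lam * omit_matrix x n) $$ (i, k) = alternant_matrix x a n lam $$ (i, k)"
    using i k by (simp add: alternant_matrix_def C_def)
qed (simp_all add: jacobi_trudi_def omit_matrix_def alternant_matrix_def)

text \<open>
  Rows of zero parts do not change a Jacobi-Trudi determinant.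
\<close>

lemma det_unit_lower_block:
  fixes f :: "nat \<Rightarrow> nat \<Rightarrow> 'r::comm_ring_1"
  assumes "l \<le> n" "\<And>i j. l \<le> i \<Longrightarrow> i < n \<Longrightarrow> j < i \<Longrightarrow> f i j = 0" "\<And>i. l \<le> i \<Longrightarrow> i < n \<Longrightarrow> f i i = 1"
  shows "det (mat n n (\<lambda>(i, j). f i j)) = det (mat l l (\<lambda>(i, j). f i j))"
  using assms
proof (induction n rule: dec_induct)
  case (step n)
  let ?A = "mat (Suc n) (Suc n) (\<lambda>(i, j). f i j)"
  have "det ?A = (\<Sum>j<Suc n. ?A $$ (n, j) * cofactor ?A n j)"
    by (rule laplace_expansion_row) auto
  also have "\<dots> = (\<Sum>j\<in>{n}. ?A $$ (n, j) * cofactor ?A n j)"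
    by (rule sum.mono_neutral_right) (use step in auto)
  also have "\<dots> = cofactor ?A n n" using step by simp
  also have "\<dots> = det (mat_delete ?A n n)" by (simp add: cofactor_def flip: mult_2)
  also have "mat_delete ?A n n = mat n n (\<lambda>(i, j). f i j)"
    by (rule eq_matI) (auto simp: mat_delete_def)
  finally show ?case using step by simp
qed simp

text \<open>
  The determinant of \<open>omit_matrix\<close> is identified as \<open>A\<^sub>0\<close> by the case of the empty partition, whose
  Jacobi-Trudi determinant is 1.
\<close>

theorem jacobi_trudi_bialternant:
  "det (jacobi_trudi x a n lam) * alternant a n (\<lambda>_. 0) x = alternant a n lam x"
proof -
  have prod: "det (jacobi_trudi x a n lam) * det (omit_matrix x n) = alternant a n lam x" for lam
    using det_mult[of "jacobi_trudi x a n lam" n "omit_matrix x n"]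
    by (simp add: jacobi_trudi_times_omit det_alternant_matrix) (simp add: jacobi_trudi_def omit_matrix_def)
  have "det (jacobi_trudi x a n (\<lambda>_. 0)) = det (mat 0 0 (\<lambda>(i, j). complete_coeff x a n {2 + int i - int 0..int n} (int 0 + int j - int i)))"
    unfolding jacobi_trudi_def by (rule det_unit_lower_block) (auto simp: complete_coeff_def[of _ _ _ _ "_ - _"] complete_coeff_zero)
  then have "det (jacobi_trudi x a n (\<lambda>_. 0)) = 1" by simp
  then have "det (omit_matrix x n) = alternant a n (\<lambda>_. 0) x" using prod[of "\<lambda>_. 0"] by simp
  then show ?thesis using prod[of lam] by simp
qed

section \<open>The ring of double symmetric functions\<close>

lemma cst_add: "cst (c + d) = cst c + cst d" by (simp add: cst_def single_add)
lemma cst_mult: "cst (c * d) = cst c * cst d" by (simp add: cst_def mult_single)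
lemma cst_0 [simp]: "cst 0 = 0" by (simp add: cst_def)
lemma cst_1 [simp]: "cst 1 = 1" by (simp add: cst_def)

lemma cst_eq_iff: "cst c = cst d \<longleftrightarrow> c = d"
  unfolding cst_def by (metis lookup_single_eq)

interpretation cst_hom: comm_ring_hom cst
  by unfold_locales (simp_all add: cst_add cst_mult)

definition eval_monomial :: "(nat \<Rightarrow> xpoly) \<Rightarrow> (nat \<Rightarrow>\<^sub>0 nat) \<Rightarrow> xpoly" where
  "eval_monomial f m = (\<Prod>i\<in>Poly_Mapping.keys m. f i ^ Poly_Mapping.lookup m i)"

lemma eval_monomial_superset:
  "finite S \<Longrightarrow> Poly_Mapping.keys m \<subseteq> S \<Longrightarrow> eval_monomial f m = (\<Prod>i\<in>S. f i ^ Poly_Mapping.lookup m i)"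
  unfolding eval_monomial_def by (rule prod.mono_neutral_left) (auto simp: in_keys_iff)

lemma eval_monomial_add: "eval_monomial f (m + m') = eval_monomial f m * eval_monomial f m'"
proof -
  let ?S = "Poly_Mapping.keys m \<union> Poly_Mapping.keys m'"
  have "Poly_Mapping.keys (m + m') \<subseteq> ?S" by (rule keys_add)
  then have "eval_monomial f (m + m') = (\<Prod>i\<in>?S. f i ^ Poly_Mapping.lookup (m + m') i)"
    by (intro eval_monomial_superset) auto
  also have "\<dots> = (\<Prod>i\<in>?S. f i ^ Poly_Mapping.lookup m i) * (\<Prod>i\<in>?S. f i ^ Poly_Mapping.lookup m' i)"
    by (simp add: lookup_add power_add prod.distrib)
  also have "\<dots> = eval_monomial f m * eval_monomial f m'"
    by (subst (1 2) eval_monomial_superset[of ?S]) auto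
  finally show ?thesis .
qed

lemma xsubst_superset:
  "finite S \<Longrightarrow> Poly_Mapping.keys P \<subseteq> S \<Longrightarrow> xsubst f P = (\<Sum>m\<in>S. cst (Poly_Mapping.lookup P m) * eval_monomial f m)"
  unfolding xsubst_def eval_monomial_def[symmetric]
  by (rule sum.mono_neutral_left) (auto simp: in_keys_iff)

lemma xsubst_add: "xsubst f (P + Q) = xsubst f P + xsubst f Q"
proof -
  let ?S = "Poly_Mapping.keys P \<union> Poly_Mapping.keys Q"
  have "Poly_Mapping.keys (P + Q) \<subseteq> ?S" by (rule keys_add)
  then have "xsubst f (P + Q) = (\<Sum>m\<in>?S. cst (Poly_Mapping.lookup (P + Q) m) * eval_monomial f m)"
    by (intro xsubst_superset) auto
  also have "\<dots> = xsubst f P + xsubst f Q"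
    by (subst (1 2) xsubst_superset[of ?S]) (auto simp: lookup_add cst_add distrib_right sum.distrib)
  finally show ?thesis .
qed

lemma xsubst_0 [simp]: "xsubst f 0 = 0"
  by (simp add: xsubst_def)

lemma xsubst_sum: "xsubst f (sum g I) = (\<Sum>i\<in>I. xsubst f (g i))"
  by (induction I rule: infinite_finite_induct) (auto simp: xsubst_add)

lemma xsubst_single: "xsubst f (Poly_Mapping.single m c) = cst c * eval_monomial f m"
  by (subst xsubst_superset[of "{m}"]) auto

lemma sum_of_singles: "P = (\<Sum>m\<in>Poly_Mapping.keys P. Poly_Mapping.single m (Poly_Mapping.lookup P m))"
  by (rule poly_mapping_eqI) (auto simp: lookup_sum lookup_single when_def in_keys_iff)

lemma xsubst_mult: "xsubst f (P * Q) = xsubst f P * xsubst f Q"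
proof -
  let ?p = "\<lambda>m. Poly_Mapping.single m (Poly_Mapping.lookup P m)"
  let ?q = "\<lambda>m. Poly_Mapping.single m (Poly_Mapping.lookup Q m)"
  have "P * Q = (\<Sum>m\<in>Poly_Mapping.keys P. \<Sum>m'\<in>Poly_Mapping.keys Q. ?p m * ?q m')"
    by (subst (1) sum_of_singles[of P], subst (1) sum_of_singles[of Q]) (rule sum_product)
  then have "xsubst f (P * Q) = (\<Sum>m\<in>Poly_Mapping.keys P. \<Sum>m'\<in>Poly_Mapping.keys Q. xsubst f (?p m) * xsubst f (?q m'))"
    by (simp add: xsubst_sum mult_single xsubst_single eval_monomial_add cst_mult mult_ac)
  also have "\<dots> = xsubst f (\<Sum>m\<in>Poly_Mapping.keys P. ?p m) * xsubst f (\<Sum>m\<in>Poly_Mapping.keys Q. ?q m)"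
    by (simp only: sum_product xsubst_sum)
  finally show ?thesis by (simp only: sum_of_singles[symmetric])
qed

lemma xsubst_cst [simp]: "xsubst f (cst c) = cst c"
  by (simp add: cst_def[of c] xsubst_single eval_monomial_def)

lemma xsubst_xvar [simp]: "xsubst f (xvar i) = f i"
  by (simp add: xvar_def xsubst_single eval_monomial_def)

interpretation xsubst_hom: comm_ring_hom "xsubst f" for f
proof unfold_locales
  show "xsubst f 1 = 1" using xsubst_cst[of f 1] by simp
qed (simp_all add: xsubst_add xsubst_mult)

definition vars_le :: "nat \<Rightarrow> xpoly \<Rightarrow> bool" where
  "vars_le n P \<longleftrightarrow> (\<forall>m\<in>Poly_Mapping.keys P. Poly_Mapping.keys m \<subseteq> {1..n})"

definition monomial_degree :: "(nat \<Rightarrow>\<^sub>0 nat) \<Rightarrow> nat" where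
  "monomial_degree m = (\<Sum>i\<in>Poly_Mapping.keys m. Poly_Mapping.lookup m i)"

lemma monomial_degree_add: "monomial_degree (m + m') = monomial_degree m + monomial_degree m'"
proof -
  have superset: "monomial_degree m = (\<Sum>i\<in>S. Poly_Mapping.lookup m i)"
    if "finite S" "Poly_Mapping.keys m \<subseteq> S" for S m
    unfolding monomial_degree_def by (rule sum.mono_neutral_left) (use that in \<open>auto simp: in_keys_iff\<close>)
  let ?S = "Poly_Mapping.keys m \<union> Poly_Mapping.keys m'"
  have "monomial_degree (m + m') = (\<Sum>i\<in>?S. Poly_Mapping.lookup (m + m') i)"
    by (rule superset) (simp_all add: keys_add)
  also have "\<dots> = monomial_degree m + monomial_degree m'"
    by (subst (1 2) superset[of ?S]) (auto simp: lookup_add sum.distrib)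
  finally show ?thesis .
qed

lemma vars_le_add: "vars_le n P \<Longrightarrow> vars_le n Q \<Longrightarrow> vars_le n (P + Q)"
  using keys_add[of P Q] unfolding vars_le_def by blast

lemma vars_le_mult:
  assumes "vars_le n P" "vars_le n Q" shows "vars_le n (P * Q)"
  unfolding vars_le_def
proof
  fix m assume "m \<in> Poly_Mapping.keys (P * Q)"
  then obtain m1 m2 where "m = m1 + m2" "m1 \<in> Poly_Mapping.keys P" "m2 \<in> Poly_Mapping.keys Q"
    using keys_mult[of P Q] by auto
  then show "Poly_Mapping.keys m \<subseteq> {1..n}" using assms keys_add[of m1 m2] unfolding vars_le_def by blast
qed

lemma vars_le_cst: "vars_le n (cst c)" by (simp add: vars_le_def cst_def)
lemma vars_le_xvar: "1 \<le> i \<Longrightarrow> i \<le> n \<Longrightarrow> vars_le n (xvar i)" by (simp add: vars_le_def xvar_def)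
lemma vars_le_uminus: "vars_le n P \<Longrightarrow> vars_le n (- P)"
  using vars_le_mult[OF vars_le_cst[of n "-1"], of P] by (simp add: cst_hom.hom_uminus)

lemma xdegree_le_alt: "xdegree_le d P \<longleftrightarrow> (\<forall>m\<in>Poly_Mapping.keys P. monomial_degree m \<le> d)"
  by (simp add: xdegree_le_def monomial_degree_def)

lemma xdegree_le_mono: "xdegree_le d P \<Longrightarrow> d \<le> d' \<Longrightarrow> xdegree_le d' P"
  by (auto simp: xdegree_le_def intro: order_trans)

lemma xdegree_le_add: "xdegree_le d P \<Longrightarrow> xdegree_le d Q \<Longrightarrow> xdegree_le d (P + Q)"
  using keys_add[of P Q] unfolding xdegree_le_def by blast

lemma xdegree_le_mult:
  assumes "xdegree_le d P" "xdegree_le d' Q" shows "xdegree_le (d + d') (P * Q)"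
  unfolding xdegree_le_alt
proof
  fix m assume "m \<in> Poly_Mapping.keys (P * Q)"
  then obtain m1 m2 where "m = m1 + m2" "m1 \<in> Poly_Mapping.keys P" "m2 \<in> Poly_Mapping.keys Q"
    using keys_mult[of P Q] by auto
  then show "monomial_degree m \<le> d + d'"
    using assms unfolding xdegree_le_alt by (auto simp: monomial_degree_add intro: add_mono)
qed

lemma xdegree_le_cst: "xdegree_le d (cst c)" by (simp add: xdegree_le_def cst_def)
lemma xdegree_le_xvar: "xdegree_le 1 (xvar i)" by (simp add: xdegree_le_def xvar_def)
lemma xdegree_le_uminus: "xdegree_le d P \<Longrightarrow> xdegree_le d (- P)"
  using xdegree_le_mult[OF xdegree_le_cst[of 0 "-1"], of d P] by (simp add: cst_hom.hom_uminus)

lemma symmetric_polys_iff: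
  "P \<in> symmetric_polys n \<longleftrightarrow> vars_le n P \<and> (\<forall>\<pi>. \<pi> permutes {1..n} \<longrightarrow> xsubst (xvar \<circ> \<pi>) P = P)"
  by (simp add: symmetric_polys_def vars_le_def)

lemma Lambda_add: "f \<in> Lambda \<Longrightarrow> g \<in> Lambda \<Longrightarrow> f + g \<in> Lambda"
proof -
  assume f: "f \<in> Lambda" and g: "g \<in> Lambda"
  obtain d d' where "\<forall>n. xdegree_le d (f n)" "\<forall>n. xdegree_le d' (g n)" using f g by (auto simp: Lambda_def)
  then have "\<forall>n. xdegree_le (max d d') ((f + g) n)"
    by (auto intro!: xdegree_le_add intro: xdegree_le_mono)
  then show ?thesis using f g
    by (auto simp: Lambda_def symmetric_polys_iff restrict_last_def xsubst_add vars_le_add)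
qed

lemma Lambda_mult: "f \<in> Lambda \<Longrightarrow> g \<in> Lambda \<Longrightarrow> f * g \<in> Lambda"
proof -
  assume f: "f \<in> Lambda" and g: "g \<in> Lambda"
  obtain d d' where "\<forall>n. xdegree_le d (f n)" "\<forall>n. xdegree_le d' (g n)" using f g by (auto simp: Lambda_def)
  then have "\<forall>n. xdegree_le (d + d') ((f * g) n)" by (auto intro!: xdegree_le_mult)
  then show ?thesis using f g
    by (auto simp: Lambda_def symmetric_polys_iff restrict_last_def xsubst_mult vars_le_mult)
qed

lemma Lambda_scalar: "scalar c \<in> Lambda"
  by (auto simp: Lambda_def symmetric_polys_iff restrict_last_def scalar_def vars_le_cst xdegree_le_cst)

lemma scalar_0: "scalar 0 = 0" and scalar_1: "scalar 1 = 1"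
  by (simp_all add: scalar_def fun_eq_iff)

lemma Lambda_0: "0 \<in> Lambda" and Lambda_1: "1 \<in> Lambda"
  using Lambda_scalar[of 0] Lambda_scalar[of 1] by (simp_all add: scalar_0 scalar_1)

lemma Lambda_uminus: "f \<in> Lambda \<Longrightarrow> - f \<in> Lambda"
proof -
  assume f: "f \<in> Lambda"
  have "- f = scalar (-1) * f" by (simp add: fun_eq_iff scalar_def cst_hom.hom_uminus)
  then show ?thesis using Lambda_mult[OF Lambda_scalar f] by simp
qed

lemma Lambda_sum: "(\<And>i. i \<in> I \<Longrightarrow> f i \<in> Lambda) \<Longrightarrow> sum f I \<in> Lambda"
  by (induction I rule: infinite_finite_induct) (auto simp: Lambda_0 Lambda_add)

lemma Lambda_prod: "(\<And>i. i \<in> I \<Longrightarrow> f i \<in> Lambda) \<Longrightarrow> prod f I \<in> Lambda"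
  by (induction I rule: infinite_finite_induct) (auto simp: Lambda_1 Lambda_mult)

lemma Lambda_det:
  assumes "\<And>i j. i < n \<Longrightarrow> j < n \<Longrightarrow> F i j \<in> Lambda"
  shows "det (mat n n (\<lambda>(i, j). F i j)) \<in> Lambda"
proof -
  have "signof p * (\<Prod>i = 0..<n. mat n n (\<lambda>(i, j). F i j) $$ (i, p i)) \<in> Lambda" if "p permutes {0..<n}" for p
  proof (rule Lambda_mult)
    show "signof p \<in> Lambda" using Lambda_1 Lambda_uminus[OF Lambda_1] by (cases p rule: sign_cases) auto
    show "(\<Prod>i = 0..<n. mat n n (\<lambda>(i, j). F i j) $$ (i, p i)) \<in> Lambda"
    proof (rule Lambda_prod)
      fix i assume "i \<in> {0..<n}"
      then have "i < n" "p i < n" using permutes_in_image[OF that, of i] by auto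
      then show "mat n n (\<lambda>(i, j). F i j) $$ (i, p i) \<in> Lambda" using assms by simp
    qed
  qed
  then show ?thesis by (subst det_def'[of _ n]) (auto intro: Lambda_sum)
qed

text \<open>
  The restriction maps determine the member at \<open>n\<close> from the member at any larger index.
\<close>

lemma Lambda_eqI:
  assumes f: "f \<in> Lambda" and g: "g \<in> Lambda" and eq: "\<And>n. N \<le> n \<Longrightarrow> f n = g n"
  shows "f = g"
proof
  fix n
  have down: "f (m - 1) = g (m - 1)" if "1 \<le> m" "f m = g m" for m
    using f g that by (auto simp: Lambda_def)
  show "f n = g n"
  proof (cases "N \<le> n")
    case False
    then have "n \<le> N" by simp
    then show ?thesis
    proof (induction n rule: inc_induct)
      case base
      show ?case by (rule eq) simp
    next
      case (step m)
      then show ?case using down[of "Suc m"] by simp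
    qed
  qed (rule eq)
qed

definition weakly_decreasing :: "nat \<Rightarrow> nat \<Rightarrow> nat list set" where
  "weakly_decreasing n p = {is. length is = p \<and> set is \<subseteq> {1..n} \<and> sorted_wrt (\<ge>) is}"

lemma weakly_decreasing_0: "weakly_decreasing n 0 = {[]}"
  by (auto simp: weakly_decreasing_def)

lemma weakly_decreasing_0_Suc: "weakly_decreasing 0 (Suc p) = {}"
  by (auto simp: weakly_decreasing_def)

lemma finite_weakly_decreasing: "finite (weakly_decreasing n p)"
  by (rule finite_subset[OF _ finite_lists_length_eq[of "{1..n}" p]]) (auto simp: weakly_decreasing_def)

lemma weakly_decreasing_Suc:
  "weakly_decreasing (Suc n) (Suc p) = weakly_decreasing n (Suc p) \<union> Cons (Suc n) ` weakly_decreasing (Suc n) p"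
proof
  show "weakly_decreasing (Suc n) (Suc p) \<subseteq> weakly_decreasing n (Suc p) \<union> Cons (Suc n) ` weakly_decreasing (Suc n) p"
  proof
    fix xs assume xs: "xs \<in> weakly_decreasing (Suc n) (Suc p)"
    then obtain y ys where y: "xs = y # ys" by (cases xs) (auto simp: weakly_decreasing_def)
    show "xs \<in> weakly_decreasing n (Suc p) \<union> Cons (Suc n) ` weakly_decreasing (Suc n) p"
    proof (cases "y = Suc n")
      case True
      then show ?thesis using xs y by (auto simp: weakly_decreasing_def)
    next
      case False
      then have "xs \<in> weakly_decreasing n (Suc p)" using xs y by (fastforce simp: weakly_decreasing_def)
      then show ?thesis by simp
    qed
  qed
  show "weakly_decreasing n (Suc p) \<union> Cons (Suc n) ` weakly_decreasing (Suc n) p \<subseteq> weakly_decreasing (Suc n) (Suc p)"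
    by (fastforce simp: weakly_decreasing_def)
qed

text \<open>
  Splitting the sum by whether the first index equals \<open>n\<close> gives the recursion \<open>complete_coeff_Suc\<close> of
  the coefficients. Removing this index lowers the position of all the others by one, which the
  parameter \<open>e\<close> accounts for.
\<close>

lemma complete_sum_eq_coeff:
  fixes x :: "nat \<Rightarrow> 'r::comm_ring_1"
  shows "(\<Sum>is\<in>weakly_decreasing n p. \<Prod>k<p. x (is ! k - 1) - a (int (is ! k) - int k - int e)) =
     complete_coeff x a n {2 - int p - int e..int n - int e} (int p)"
proof (induction "n + p" arbitrary: n p e rule: less_induct)
  case less
  let ?H = "\<lambda>e n p. \<Sum>is\<in>weakly_decreasing n p. \<Prod>k<p. x (is ! k - 1) - a (int (is ! k) - int k - int e)"
  consider "p = 0" | q where "p = Suc q" "n = 0" | q m where "p = Suc q" "n = Suc m"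
    by (metis not0_implies_Suc)
  then show ?case
  proof cases
    case 1
    then show ?thesis by (simp add: weakly_decreasing_0 complete_coeff_zero)
  next
    case 2
    have "(\<Prod>c\<in>{2 - int p - int e..int n - int e}. linear_factor (a c)) $ p = 0"
      by (rule prod_linear_factor_degree) (use 2 in auto)
    then show ?thesis using 2 by (simp add: weakly_decreasing_0_Suc complete_coeff_def supersymmetric_series_def nat_add_distrib)
  next
    case 3
    let ?C = "{1 - int q - int e..int m - int e}"
    have ins: "{2 - int p - int e..int n - int e} = insert (int n - int e) ?C" using 3 by auto
    have IH1: "?H e m (Suc q) = complete_coeff x a m ?C (int p)"
      using less[of m "Suc q" e] 3 by (simp add: algebra_simps)
    have IH2: "?H (Suc e) (Suc m) q = complete_coeff x a n ?C (int q)"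
      using less[of "Suc m" q "Suc e"] 3 by (simp add: algebra_simps)
    have "?H e n p = ?H e m (Suc q) + (\<Sum>is\<in>Cons (Suc m) ` weakly_decreasing (Suc m) q. \<Prod>k<Suc q. x (is ! k - 1) - a (int (is ! k) - int k - int e))"
      unfolding 3 weakly_decreasing_Suc
      by (rule sum.union_disjoint) (auto simp: finite_weakly_decreasing, auto simp: weakly_decreasing_def)
    also have "(\<Sum>is\<in>Cons (Suc m) ` weakly_decreasing (Suc m) q. \<Prod>k<Suc q. x (is ! k - 1) - a (int (is ! k) - int k - int e)) =
        (x m - a (int n - int e)) * ?H (Suc e) (Suc m) q"
      unfolding sum_distrib_left
      by (subst sum.reindex) (auto simp: prod.lessThan_Suc_shift 3 algebra_simps simp del: prod.lessThan_Suc intro!: sum.cong)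
    finally have "?H e n p = complete_coeff x a m ?C (int p) + (x m - a (int n - int e)) * complete_coeff x a (Suc m) ?C (int p - 1)"
      unfolding IH1 IH2 using 3 by simp
    also have "\<dots> = complete_coeff x a n (insert (int n - int e) ?C) (int p)"
      unfolding 3(2) by (rule complete_coeff_Suc[symmetric]) auto
    finally show ?thesis unfolding ins .
  qed
qed

abbreviation "xgen \<equiv> \<lambda>i. xvar (Suc i)"
abbreviation "agen \<equiv> \<lambda>i. cst (avar i)"

lemma hpoly_eq_complete_coeff: "hpoly n p = complete_coeff xgen agen n {2 - int p..int n} (int p)"
proof -
  have "hpoly n p = (\<Sum>is\<in>weakly_decreasing n p. \<Prod>k<p. xgen (is ! k - 1) - agen (int (is ! k) - int k - int 0))"
    unfolding hpoly_def weakly_decreasing_def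
  proof (intro sum.cong prod.cong refl)
    fix "is" k assume "is \<in> {is. length is = p \<and> set is \<subseteq> {1..n} \<and> sorted_wrt (\<ge>) is}" "k \<in> {..<p}"
    then have "is ! k \<in> {1..n}" by (auto dest: nth_mem)
    then show "xvar (is ! k) - cst (avar (int (is ! k) - int k)) = xgen (is ! k - 1) - agen (int (is ! k) - int k - int 0)" by simp
  qed
  then show ?thesis using complete_sum_eq_coeff[of xgen agen 0 p n] by simp
qed

lemma (in comm_ring_hom) hom_complete_coeff:
  "hom (complete_coeff x a n C r) = complete_coeff (\<lambda>i. hom (x i)) (\<lambda>c. hom (a c)) n C r"
proof -
  \<comment> \<open>The homomorphism is applied to a power series coefficientwise.\<close>
  define \<Phi> where "\<Phi> F = Abs_fps (\<lambda>k. hom (F $ k))" for F :: "'a fps"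
  have mult: "\<Phi> (F * G) = \<Phi> F * \<Phi> G" for F G
    by (rule fps_ext) (simp add: \<Phi>_def fps_mult_nth hom_distribs)
  have one: "\<Phi> 1 = 1" by (rule fps_ext) (simp add: \<Phi>_def)
  have prod: "\<Phi> (prod F I) = (\<Prod>i\<in>I. \<Phi> (F i))" for F and I :: "'i set"
    by (induction I rule: infinite_finite_induct) (simp_all add: one mult)
  have lin: "\<Phi> (linear_factor z) = linear_factor (hom z)" for z
    by (rule fps_ext) (simp add: \<Phi>_def linear_factor_def hom_distribs fps_X_def)
  have geo: "\<Phi> (geometric z) = geometric (hom z)" for z
    by (rule fps_ext) (simp add: \<Phi>_def geometric_def hom_distribs)
  have "\<Phi> (supersymmetric_series x a n C) = supersymmetric_series (\<lambda>i. hom (x i)) (\<lambda>c. hom (a c)) n C"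
    by (simp add: supersymmetric_series_def mult prod lin geo)
  then have "hom (supersymmetric_series x a n C $ k) = supersymmetric_series (\<lambda>i. hom (x i)) (\<lambda>c. hom (a c)) n C $ k" for k
    by (metis \<Phi>_def fps_nth_Abs_fps)
  then show ?thesis by (simp add: complete_coeff_def)
qed

lemma hfun_nonneg: "hfun (int p) = (\<lambda>n. hpoly n p)"
  by (simp add: hfun_def)

lemma hpoly_0: "hpoly n 0 = 1"
  by (simp add: hpoly_eq_complete_coeff complete_coeff_zero)

lemma hpoly_vars_degree: "vars_le n (hpoly n p)" "xdegree_le p (hpoly n p)"
proof -
  have f: "vars_le n (xvar i - cst c)" if "i \<in> {1..n}" for i c
    unfolding diff_conv_add_uminus using that by (intro vars_le_add vars_le_uminus vars_le_cst vars_le_xvar) auto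
  have g: "xdegree_le 1 (xvar i - cst c)" for i c
    unfolding diff_conv_add_uminus by (intro xdegree_le_add xdegree_le_uminus xdegree_le_cst xdegree_le_xvar)
  have prod_vars: "vars_le n (prod F I)" if "\<And>i. i \<in> I \<Longrightarrow> vars_le n (F i)" for F and I :: "nat set"
    using that vars_le_cst[of n 1] by (induction I rule: infinite_finite_induct) (auto intro!: vars_le_mult)
  have sum_vars: "vars_le n (sum F I)" if "\<And>i. i \<in> I \<Longrightarrow> vars_le n (F i)" for F and I :: "nat list set"
    using that vars_le_cst[of n 0] by (induction I rule: infinite_finite_induct) (auto intro!: vars_le_add)
  have prod_deg: "xdegree_le (card I) (prod F I)" if "finite I" "\<And>i. i \<in> I \<Longrightarrow> xdegree_le 1 (F i)" for F and I :: "nat set"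
    using that
  proof (induction I)
    case empty
    then show ?case using xdegree_le_cst[of 0 1] by simp
  next
    case (insert i I)
    then show ?case using xdegree_le_mult[of 1 "F i" "card I" "prod F I"] by simp
  qed
  have sum_deg: "xdegree_le p (sum F I)" if "\<And>i. i \<in> I \<Longrightarrow> xdegree_le p (F i)" for F and I :: "nat list set"
    using that xdegree_le_cst[of p 0] by (induction I rule: infinite_finite_induct) (auto intro!: xdegree_le_add)
  show "vars_le n (hpoly n p)" unfolding hpoly_def
  proof (intro sum_vars prod_vars f)
    fix "is" k assume "is \<in> {is. length is = p \<and> set is \<subseteq> {1..n} \<and> sorted_wrt (\<ge>) is}" "k \<in> {..<p}"
    then show "is ! k \<in> {1..n}" by (auto dest: nth_mem)
  qed
  show "xdegree_le p (hpoly n p)" unfolding hpoly_def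
    using prod_deg[of "{..<p}"] g by (intro sum_deg) simp
qed

lemma hpoly_symmetric: "\<pi> permutes {1..n} \<Longrightarrow> xsubst (xvar \<circ> \<pi>) (hpoly n p) = hpoly n p"
proof -
  assume \<pi>: "\<pi> permutes {1..n}"
  have "(\<Prod>i<n. geometric (xvar (\<pi> (Suc i)))) = (\<Prod>i\<in>{1..n}. geometric (xvar (\<pi> i)))"
    by (rule prod.reindex_bij_witness[of _ "\<lambda>i. i - 1" Suc]) auto
  also have "\<dots> = (\<Prod>i\<in>{1..n}. geometric (xvar i))" by (rule prod.permute[OF \<pi>, symmetric, unfolded o_def])
  also have "\<dots> = (\<Prod>i<n. geometric (xvar (Suc i)))"
    by (rule prod.reindex_bij_witness[of _ Suc "\<lambda>i. i - 1"]) auto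
  finally show ?thesis
    by (simp add: hpoly_eq_complete_coeff xsubst_hom.hom_complete_coeff) (simp add: complete_coeff_def supersymmetric_series_def)
qed

text \<open>
  Setting \<open>x\<^sub>n = a\<^sub>n\<close> cancels a factor of the numerator of the generating function against one of the
  denominator.
\<close>

lemma hpoly_restrict:
  assumes n: "1 \<le> n"
  shows "restrict_last n (hpoly n p) = hpoly (n - 1) p"
proof (cases "p = 0")
  case True
  then show ?thesis by (simp add: hpoly_0 restrict_last_def)
next
  case False
  obtain m where m: "n = Suc m" using n by (cases n) auto
  let ?f = "xvar(n := cst (avar (int n)))"
  have ins: "{2 - int p..int n} = insert (int n) {2 - int p..int m}" using m False by auto
  have "restrict_last n (hpoly n p) = complete_coeff (\<lambda>i. ?f (Suc i)) agen n {2 - int p..int n} (int p)"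
    by (simp add: restrict_last_def hpoly_eq_complete_coeff xsubst_hom.hom_complete_coeff)
  also have "\<dots> = complete_coeff (\<lambda>i. ?f (Suc i)) agen m {2 - int p..int m} (int p)"
    unfolding ins unfolding m by (subst complete_coeff_Suc) auto
  also have "\<dots> = complete_coeff xgen agen m {2 - int p..int m} (int p)"
  proof -
    have "(\<Prod>i<m. geometric (?f (Suc i))) = (\<Prod>i<m. geometric (xgen i))"
      by (rule prod.cong) (auto simp: m)
    then show ?thesis by (simp only: complete_coeff_def supersymmetric_series_def)
  qed
  finally show ?thesis by (simp add: hpoly_eq_complete_coeff m)
qed

lemma hfun_Lambda: "hfun r \<in> Lambda"
proof (cases "r < 0")
  case True
  then show ?thesis by (simp add: hfun_def Lambda_0)
next
  case False
  then obtain p where "r = int p" by (metis not_less zero_le_imp_eq_int)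
  then show ?thesis
    by (auto simp: hfun_nonneg Lambda_def symmetric_polys_iff hpoly_vars_degree hpoly_symmetric hpoly_restrict intro!: exI[of _ p])
qed

context
  fixes \<tau> :: "xseq \<Rightarrow> xseq"
  assumes \<tau>: "is_shift \<tau>"
begin

lemma shift_Lambda: "f \<in> Lambda \<Longrightarrow> (\<tau> ^^ s) f \<in> Lambda"
  using \<tau> by (induction s) (auto simp: is_shift_def bij_betw_def)

lemma shift_add: "f \<in> Lambda \<Longrightarrow> g \<in> Lambda \<Longrightarrow> (\<tau> ^^ s) (f + g) = (\<tau> ^^ s) f + (\<tau> ^^ s) g"
  using \<tau> shift_Lambda by (induction s) (auto simp: is_shift_def)

lemma shift_mult: "f \<in> Lambda \<Longrightarrow> g \<in> Lambda \<Longrightarrow> (\<tau> ^^ s) (f * g) = (\<tau> ^^ s) f * (\<tau> ^^ s) g"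
  using \<tau> shift_Lambda by (induction s) (auto simp: is_shift_def)

lemma shift_avar: "(\<tau> ^^ s) (scalar (avar i)) = scalar (avar (i + int s))"
  using \<tau> by (induction s) (auto simp: is_shift_def algebra_simps)

lemma shift_1: "(\<tau> ^^ s) 1 = 1"
  using \<tau> by (induction s) (auto simp: is_shift_def)

lemma shift_0: "(\<tau> ^^ s) 0 = 0"
proof -
  have "\<tau> 0 = \<tau> (0 + 0)" by simp
  also have "\<dots> = \<tau> 0 + \<tau> 0" using \<tau> Lambda_0 unfolding is_shift_def by blast
  finally have "\<tau> 0 = 0" by simp
  then show ?thesis by (induction s) auto
qed

lemma hshift_Lambda: "hshift \<tau> r s \<in> Lambda"
  by (simp add: hshift_def shift_Lambda hfun_Lambda)

text \<open>
  The defining relation of the shift is \<open>complete_coeff_insert\<close>, read as the removal of the smallest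
  index. The hypothesis keeps this index in the interval.
\<close>

lemma hshift_eq_complete_coeff:
  assumes "2 + int s - r \<le> int n + 1"
  shows "hshift \<tau> r s n = complete_coeff xgen agen n {2 + int s - r..int n} r"
  using assms
proof (induction s arbitrary: r)
  case 0
  show ?case
  proof (cases "r < 0")
    case True
    then show ?thesis by (simp add: hshift_def hfun_def complete_coeff_def)
  next
    case False
    then obtain p where "r = int p" by (metis not_less zero_le_imp_eq_int)
    then show ?thesis by (simp add: hshift_def hfun_nonneg hpoly_eq_complete_coeff)
  qed
next
  case (Suc s)
  consider "r < 0" | "r = 0" | "1 \<le> r" by linarith
  then show ?case
  proof cases
    case 1
    then show ?thesis using shift_0[of "Suc s"] by (simp add: hshift_def hfun_def complete_coeff_def del: funpow.simps)
  next
    case 2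
    have "hfun 0 = 1" using hpoly_0 by (auto simp: hfun_def fun_eq_iff)
    then show ?thesis using 2 shift_1[of "Suc s"] by (simp add: hshift_def complete_coeff_zero del: funpow.simps)
  next
    case 3
    have "\<tau> (hfun r) = hfun r + scalar (avar (2 - r)) * hfun (r - 1)"
      using \<tau> 3 by (simp add: is_shift_def)
    then have "hshift \<tau> r (Suc s) = (\<tau> ^^ s) (hfun r + scalar (avar (2 - r)) * hfun (r - 1))"
      by (simp add: hshift_def funpow_swap1)
    also have "\<dots> = hshift \<tau> r s + scalar (avar (2 - r + int s)) * hshift \<tau> (r - 1) s"
      by (simp add: shift_add shift_mult Lambda_mult Lambda_scalar hfun_Lambda shift_avar hshift_def)
    finally have "hshift \<tau> r (Suc s) n = hshift \<tau> r s n + agen (2 + int s - r) * hshift \<tau> (r - 1) s n"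
      by (simp add: scalar_def algebra_simps)
    also have "hshift \<tau> r s n = complete_coeff xgen agen n {2 + int s - r..int n} r"
      by (rule Suc.IH) (use Suc.prems in simp)
    also have "hshift \<tau> (r - 1) s n = complete_coeff xgen agen n {2 + int s - (r - 1)..int n} (r - 1)"
      by (rule Suc.IH) (use Suc.prems in simp)
    also have "{2 + int s - r..int n} = insert (2 + int s - r) {2 + int (Suc s) - r..int n}"
      using Suc.prems by auto
    also have "complete_coeff xgen agen n (insert (2 + int s - r) {2 + int (Suc s) - r..int n}) r =
        complete_coeff xgen agen n {2 + int (Suc s) - r..int n} r - agen (2 + int s - r) * complete_coeff xgen agen n {2 + int (Suc s) - r..int n} (r - 1)"
      by (rule complete_coeff_insert) auto
    finally show ?thesis by (simp add: algebra_simps)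
  qed
qed

lemma double_schur_Lambda: "double_schur \<tau> lam \<in> Lambda"
  unfolding double_schur_def by (intro Lambda_det hshift_Lambda)

theorem double_schur_bialternant:
  assumes lam: "is_composition lam" and n: "len lam \<le> n"
  shows "double_schur \<tau> lam n * alternant agen n (\<lambda>_. 0) xgen = alternant agen n lam xgen"
proof -
  interpret ev: comm_ring_hom "\<lambda>f :: xseq. f n" by unfold_locales auto
  let ?l = "len lam"
  let ?f = "\<lambda>i j. complete_coeff xgen agen n {2 + int i - int (lam (Suc i))..int n} (int (lam (Suc i)) + int j - int i)"
  have "double_schur \<tau> lam n = det (map_mat (\<lambda>f. f n) (mat ?l ?l (\<lambda>(i, j). hshift \<tau> (int (lam (i + 1)) + int j - int i) j)))"
    unfolding double_schur_def ev.hom_det ..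
  also have "map_mat (\<lambda>f. f n) (mat ?l ?l (\<lambda>(i, j). hshift \<tau> (int (lam (i + 1)) + int j - int i) j)) = mat ?l ?l (\<lambda>(i, j). ?f i j)"
  proof (rule eq_matI)
    fix i j assume "i < dim_row (mat ?l ?l (\<lambda>(i, j). ?f i j))" "j < dim_col (mat ?l ?l (\<lambda>(i, j). ?f i j))"
    then have ij: "i < ?l" "j < ?l" by simp_all
    have e: "2 + int j - (int (lam (Suc i)) + int j - int i) = 2 + int i - int (lam (Suc i))" by simp
    have "hshift \<tau> (int (lam (Suc i)) + int j - int i) j n = ?f i j"
      using hshift_eq_complete_coeff[of j "int (lam (Suc i)) + int j - int i" n] ij n unfolding e by simp
    then show "map_mat (\<lambda>f. f n) (mat ?l ?l (\<lambda>(i, j). hshift \<tau> (int (lam (i + 1)) + int j - int i) j)) $$ (i, j) = mat ?l ?l (\<lambda>(i, j). ?f i j) $$ (i, j)"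
      using ij by simp
  qed simp_all
  also have "det (mat ?l ?l (\<lambda>(i, j). ?f i j)) = det (mat n n (\<lambda>(i, j). ?f i j))"
  proof (rule det_unit_lower_block[symmetric, OF n])
    fix i assume i: "?l \<le> i" "i < n"
    have "lam (Suc i) = 0" using row_le_len[OF lam, of "Suc i"] i by auto
    then show "?f i j = 0" if "j < i" for j using that by (simp add: complete_coeff_def)
    show "?f i i = 1" using \<open>lam (Suc i) = 0\<close> by (simp add: complete_coeff_zero)
  qed
  also have "\<dots> = det (jacobi_trudi xgen agen n lam)" by (simp add: jacobi_trudi_def)
  finally show ?thesis by (simp add: jacobi_trudi_bialternant)
qed

end

section \<open>Independence of alternants and the Littlewood-Richardson rule\<close>

lemma (in comm_ring_hom) hom_alternant:
  "hom (alternant a n \<kappa> x) = alternant (\<lambda>c. hom (a c)) n \<kappa> (\<lambda>i. hom (x i))"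
  by (simp add: alternant_def alt_def factorial_monomial_def hom_distribs)

lemma strict_mono_permutation_id:
  fixes p :: "nat \<Rightarrow> nat"
  assumes p: "p permutes {0..<n}" and mono: "\<And>i j. i < j \<Longrightarrow> j < n \<Longrightarrow> p i < p j" and i: "i < n"
  shows "p i = i"
proof -
  have le: "m < n \<longrightarrow> m \<le> p m" for m
  proof (induction m)
    case (Suc m)
    then show ?case using mono[of m "Suc m"] by auto
  qed simp
  have "(\<Sum>i\<in>{0..<n}. i) = (\<Sum>i\<in>{0..<n}. p i)"
    using sum.permute[OF p, of "\<lambda>i. i"] by (simp add: o_def)
  then have "i = p i"
    by (rule sum_mono_inv) (use le i in auto)
  then show ?thesis by simp
qed

text \<open>
  The substitution \<open>x\<^sub>k = a\<^bsub>k - \<nu>(k)\<^esub>\<close>, at which \<open>A\<^sub>\<kappa>\<close> vanishes unless \<open>\<kappa>\<close> is contained in \<open>\<nu>\<close>. A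
  comparison of sizes in place of the containment is enough to separate the alternants.
\<close>

definition special_point :: "(nat \<Rightarrow> nat) \<Rightarrow> nat \<Rightarrow> xpoly" where
  "special_point \<nu> i = agen (int i + 1 - int (\<nu> (Suc i)))"

lemma avar_eq_iff: "avar i = avar j \<longleftrightarrow> i = j"
proof
  assume "avar i = avar j"
  then have "Poly_Mapping.single i (1::nat) = Poly_Mapping.single j 1"
    unfolding avar_def by (metis keys_single one_neq_zero singleton_inject)
  then show "i = j" by (metis keys_single one_neq_zero singleton_inject)
qed simp

lemma agen_diff_eq_0_iff: "agen i - agen j = 0 \<longleftrightarrow> i = j"
  by (simp add: cst_eq_iff avar_eq_iff)

lemma factorial_monomial_special:
  assumes p: "p permutes {0..<n}" and ne: "factorial_monomial agen n \<kappa> (special_point \<nu> \<circ> p) \<noteq> 0" and i: "i < n"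
  shows "int (\<kappa> (Suc i)) - int i \<le> int (\<nu> (Suc (p i))) - int (p i)"
proof (rule ccontr)
  assume neg: "\<not> ?thesis"
  let ?c = "int (p i) + 1 - int (\<nu> (Suc (p i)))"
  have pi: "p i < n" using permutes_in_image[OF p, of i] i by simp
  have "?c \<in> {int i + 2 - int (\<kappa> (Suc i))..int n}" using neg pi by auto
  then have "(\<Prod>c\<in>{int i + 2 - int (\<kappa> (Suc i))..int n}. (special_point \<nu> \<circ> p) i - agen c) = 0"
    by (intro prod_zero bexI[of _ ?c]) (auto simp: special_point_def)
  then have "factorial_monomial agen n \<kappa> (special_point \<nu> \<circ> p) = 0"
    unfolding factorial_monomial_def using i by (intro prod_zero bexI[of _ i]) auto
  then show False using ne by simp
qed

text \<open>
  A nonvanishing term of the alternating sum gives \<open>\<kappa>\<^sub>i - i \<le> \<nu>\<^bsub>p(i)\<^esub> - p(i)\<close> for all \<open>i\<close>. Summing over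
  \<open>i\<close>, all of these are equalities if \<open>\<kappa>\<close> is at least as large as \<open>\<nu>\<close>. Since both sequences are strictly
  decreasing, \<open>p\<close> is increasing.
\<close>

lemma special_term_nonzero:
  assumes \<kappa>: "is_partition \<kappa>" and \<nu>: "is_partition \<nu>"
    and size: "(\<Sum>i<n. \<nu> (Suc i)) \<le> (\<Sum>i<n. \<kappa> (Suc i))"
    and p: "p permutes {0..<n}" and ne: "factorial_monomial agen n \<kappa> (special_point \<nu> \<circ> p) \<noteq> 0"
  shows "p = id \<and> (\<forall>i<n. \<kappa> (Suc i) = \<nu> (Suc i))"
proof -
  let ?k = "\<lambda>i. int (\<kappa> (Suc i)) - int i" and ?v = "\<lambda>i. int (\<nu> (Suc i)) - int i"
  have le: "?k i \<le> ?v (p i)" if "i < n" for i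
    using factorial_monomial_special[OF p ne that] .
  have "sum ?v {0..<n} = (\<Sum>i\<in>{0..<n}. ?v (p i))"
    using sum.permute[OF p, of ?v] by (simp add: o_def)
  moreover have "sum ?v {0..<n} \<le> sum ?k {0..<n}"
    using size by (simp add: sum_subtractf lessThan_atLeast0 flip: of_nat_sum)
  moreover have "sum ?k {0..<n} \<le> (\<Sum>i\<in>{0..<n}. ?v (p i))" by (rule sum_mono) (use le in auto)
  ultimately have "sum ?k {0..<n} = (\<Sum>i\<in>{0..<n}. ?v (p i))" by simp
  then have eq: "?k i = ?v (p i)" if "i < n" for i
    by (rule sum_mono_inv) (use le that in auto)
  have anti: "int (\<rho> (Suc j)) - int j < int (\<rho> (Suc i)) - int i" if "is_partition \<rho>" "i < j" for \<rho> i j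
    using partition_antimono[OF that(1), of "Suc i" "Suc j"] that(2) by simp
  have "p i < p j" if ij: "i < j" "j < n" for i j
  proof (rule ccontr)
    assume "\<not> p i < p j"
    moreover have "p i \<noteq> p j" using permutes_inj[OF p] ij by (auto dest: injD)
    ultimately have "?v (p i) < ?v (p j)" using anti[OF \<nu>, of "p j" "p i"] by simp
    then show False using eq[of i] eq[of j] anti[OF \<kappa> ij(1)] ij by simp
  qed
  then have id: "p i = i" if "i < n" for i using strict_mono_permutation_id[OF p _ that] by blast
  have "p i = i" for i using id permutes_not_in[OF p, of i] by (cases "i < n") auto
  then show ?thesis using eq by auto
qed

lemma alternant_special_zero:
  assumes "is_partition \<kappa>" "is_partition \<nu>" "len \<kappa> \<le> n" "len \<nu> \<le> n" "\<kappa> \<noteq> \<nu>"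
    and "(\<Sum>i<n. \<nu> (Suc i)) \<le> (\<Sum>i<n. \<kappa> (Suc i))"
  shows "alternant agen n \<kappa> (special_point \<nu>) = 0"
proof -
  have "\<not> (\<forall>i<n. \<kappa> (Suc i) = \<nu> (Suc i))"
  proof
    assume eq: "\<forall>i<n. \<kappa> (Suc i) = \<nu> (Suc i)"
    have "\<kappa> i = \<nu> i" for i
    proof (cases i)
      case 0
      then show ?thesis using assms(1,2) by (simp add: is_partition_def is_composition_def)
    next
      case (Suc m)
      have c: "is_composition \<kappa>" "is_composition \<nu>" using assms by (simp_all add: is_partition_def)
      show ?thesis
      proof (cases "m < n")
        case False
        then have "\<kappa> i = 0" "\<nu> i = 0"
          using row_le_len[OF c(1), of i] row_le_len[OF c(2), of i] assms(3,4) Suc by linarith+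
        then show ?thesis by simp
      qed (use eq Suc in simp)
    qed
    then show False using assms(5) by auto
  qed
  then have "factorial_monomial agen n \<kappa> (special_point \<nu> \<circ> p) = 0" if "p permutes {0..<n}" for p
    using special_term_nonzero[OF assms(1,2,6) that] by blast
  then show ?thesis by (simp add: alternant_def alt_def)
qed

lemma alternant_special_nonzero:
  assumes \<nu>: "is_partition \<nu>"
  shows "alternant agen n \<nu> (special_point \<nu>) \<noteq> 0"
proof -
  let ?f = "\<lambda>p. signof p * factorial_monomial agen n \<nu> (special_point \<nu> \<circ> p)"
  have "?f p = 0" if "p permutes {0..<n}" "p \<noteq> id" for p
    using special_term_nonzero[OF \<nu> \<nu> order_refl that(1)] that(2) by auto
  then have "(\<Sum>p | p permutes {0..<n}. ?f p) = (\<Sum>p\<in>{id}. ?f p)"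
    by (intro sum.mono_neutral_right) (auto simp: finite_permutations permutes_id)
  also have "\<dots> = factorial_monomial agen n \<nu> (special_point \<nu>)" by simp
  also have "\<dots> \<noteq> 0"
  proof -
    have "special_point \<nu> i - agen c \<noteq> 0" if "c \<in> {int i + 2 - int (\<nu> (Suc i))..int n}" for i c
      unfolding special_point_def agen_diff_eq_0_iff using that by auto
    then show ?thesis unfolding factorial_monomial_def by (simp add: prod_zero_iff)
  qed
  finally show ?thesis unfolding alternant_def alt_def .
qed

lemma xsubst_alternant:
  "xsubst (\<lambda>i. special_point \<nu> (i - 1)) (alternant agen n \<kappa> xgen) = alternant agen n \<kappa> (special_point \<nu>)"
  by (simp add: xsubst_hom.hom_alternant)

lemma alternant_nonzero: "is_partition \<nu> \<Longrightarrow> alternant agen n \<nu> xgen \<noteq> 0"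
  using alternant_special_nonzero[of \<nu> n] xsubst_alternant[of \<nu> n \<nu>] by auto

text \<open>
  Evaluating a relation at the point of a smallest partition in its support leaves only one term.
\<close>

lemma alternants_independent:
  assumes S: "finite S" "\<And>\<nu>. \<nu> \<in> S \<Longrightarrow> is_partition \<nu> \<and> len \<nu> \<le> n"
    and zero: "(\<Sum>\<nu>\<in>S. cst (c \<nu>) * alternant agen n \<nu> xgen) = 0"
  shows "\<forall>\<nu>\<in>S. c \<nu> = 0"
proof (rule ccontr)
  assume neg: "\<not> ?thesis"
  define S' where "S' = {\<nu> \<in> S. c \<nu> \<noteq> 0}"
  have S': "finite S'" "S' \<noteq> {}" using S neg by (auto simp: S'_def)
  let ?size = "\<lambda>\<nu>. \<Sum>i<n. \<nu> (Suc i)"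
  obtain \<kappa>0 where "\<kappa>0 \<in> S'" using S' by auto
  then obtain \<nu> where \<nu>: "\<nu> \<in> S'" "\<And>\<kappa>. \<kappa> \<in> S' \<Longrightarrow> ?size \<nu> \<le> ?size \<kappa>"
    using ex_has_least_nat[of "\<lambda>\<nu>. \<nu> \<in> S'" \<kappa>0 ?size] by blast
  let ?\<phi> = "xsubst (\<lambda>i. special_point \<nu> (i - 1))"
  have "0 = ?\<phi> (\<Sum>\<kappa>\<in>S. cst (c \<kappa>) * alternant agen n \<kappa> xgen)" by (simp add: zero)
  also have "\<dots> = (\<Sum>\<kappa>\<in>S. cst (c \<kappa>) * alternant agen n \<kappa> (special_point \<nu>))"
    by (simp only: xsubst_sum xsubst_mult xsubst_cst xsubst_alternant)
  also have "\<dots> = (\<Sum>\<kappa>\<in>{\<nu>}. cst (c \<kappa>) * alternant agen n \<kappa> (special_point \<nu>))"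
  proof (rule sum.mono_neutral_right)
    show "{\<nu>} \<subseteq> S" using \<nu> by (auto simp: S'_def)
    show "\<forall>\<kappa>\<in>S - {\<nu>}. cst (c \<kappa>) * alternant agen n \<kappa> (special_point \<nu>) = 0"
    proof
      fix \<kappa> assume \<kappa>: "\<kappa> \<in> S - {\<nu>}"
      show "cst (c \<kappa>) * alternant agen n \<kappa> (special_point \<nu>) = 0"
      proof (cases "c \<kappa> = 0")
        case False
        then have "\<kappa> \<in> S'" using \<kappa> by (simp add: S'_def)
        moreover have "\<nu> \<in> S" using \<nu> by (simp add: S'_def)
        ultimately have "alternant agen n \<kappa> (special_point \<nu>) = 0"
          using S(2) \<nu>(2) \<kappa> by (intro alternant_special_zero) auto
        then show ?thesis by simp
      qed simp
    qed
  qed (rule S(1))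
  finally have "cst (c \<nu>) = 0"
    using alternant_special_nonzero[of \<nu> n] S(2)[of \<nu>] \<nu>(1) by (simp add: S'_def)
  then show False using \<nu>(1) cst_eq_iff[of "c \<nu>" 0] by (simp add: S'_def)
qed

lemma double_schur_independent:
  assumes \<tau>: "is_shift \<tau>" and S: "finite S" "\<And>\<nu>. \<nu> \<in> S \<Longrightarrow> is_partition \<nu>"
    and eq: "(\<Sum>\<nu>\<in>S. scalar (c \<nu>) * double_schur \<tau> \<nu>) = (\<Sum>\<nu>\<in>S. scalar (c' \<nu>) * double_schur \<tau> \<nu>)"
    and \<nu>: "\<nu> \<in> S"
  shows "c \<nu> = c' \<nu>"
proof -
  define n where "n = Max (insert 0 (len ` S))"
  have n: "len \<kappa> \<le> n" if "\<kappa> \<in> S" for \<kappa> using S(1) that by (auto simp: n_def)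
  have val: "(\<Sum>\<nu>\<in>S. scalar (c \<nu>) * double_schur \<tau> \<nu>) n * alternant agen n (\<lambda>_. 0) xgen =
      (\<Sum>\<nu>\<in>S. cst (c \<nu>) * alternant agen n \<nu> xgen)" for c
  proof -
    have app: "(\<Sum>\<nu>\<in>S. F \<nu>) n = (\<Sum>\<nu>\<in>S. F \<nu> n)" for F :: "(nat \<Rightarrow> nat) \<Rightarrow> xseq"
      by (induction S rule: infinite_finite_induct) auto
    show ?thesis unfolding app sum_distrib_right
    proof (rule sum.cong[OF refl])
      fix \<kappa> assume k: "\<kappa> \<in> S"
      show "(scalar (c \<kappa>) * double_schur \<tau> \<kappa>) n * alternant agen n (\<lambda>_. 0) xgen = cst (c \<kappa>) * alternant agen n \<kappa> xgen"
        using double_schur_bialternant[OF \<tau> _ n[OF k]] S(2)[OF k] by (simp add: scalar_def is_partition_def mult.assoc)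
    qed
  qed
  have "(\<Sum>\<nu>\<in>S. cst (c \<nu> - c' \<nu>) * alternant agen n \<nu> xgen) = 0"
    using val[of c] val[of c'] eq by (simp add: cst_hom.hom_minus left_diff_distrib sum_subtractf)
  then have "\<forall>\<nu>\<in>S. c \<nu> - c' \<nu> = 0"
    by (intro alternants_independent[OF S(1), of n "\<lambda>\<nu>. c \<nu> - c' \<nu>"]) (use S(2) n in auto)
  then show ?thesis using \<nu> by simp
qed

lemma LR_poly_eqI:
  assumes \<tau>: "is_shift \<tau>" and fin: "finite {\<nu>. c \<nu> \<noteq> 0}" and part: "\<forall>\<nu>. c \<nu> \<noteq> 0 \<longrightarrow> is_partition \<nu>"
    and eq: "double_schur \<tau> lam * double_schur \<tau> \<mu> = (\<Sum>\<nu> | c \<nu> \<noteq> 0. scalar (c \<nu>) * double_schur \<tau> \<nu>)"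
  shows "LR_poly \<tau> lam \<mu> = c"
  unfolding LR_poly_def
proof (rule the_equality)
  fix c' assume c': "finite {\<nu>. c' \<nu> \<noteq> 0} \<and> (\<forall>\<nu>. c' \<nu> \<noteq> 0 \<longrightarrow> is_partition \<nu>) \<and>
    double_schur \<tau> lam * double_schur \<tau> \<mu> = (\<Sum>\<nu> | c' \<nu> \<noteq> 0. scalar (c' \<nu>) * double_schur \<tau> \<nu>)"
  let ?S = "{\<nu>. c \<nu> \<noteq> 0} \<union> {\<nu>. c' \<nu> \<noteq> 0}"
  have ext: "(\<Sum>\<nu> | c \<nu> \<noteq> 0. scalar (c \<nu>) * double_schur \<tau> \<nu>) = (\<Sum>\<nu>\<in>?S. scalar (c \<nu>) * double_schur \<tau> \<nu>)"
    "(\<Sum>\<nu> | c' \<nu> \<noteq> 0. scalar (c' \<nu>) * double_schur \<tau> \<nu>) = (\<Sum>\<nu>\<in>?S. scalar (c' \<nu>) * double_schur \<tau> \<nu>)"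
    using fin c' by (auto intro!: sum.mono_neutral_left simp: scalar_0)
  have "c \<nu> = c' \<nu>" if "\<nu> \<in> ?S" for \<nu>
    by (rule double_schur_independent[OF \<tau> _ _ _ that]) (use fin part c' eq ext in auto)
  then show "c' = c" by (auto simp: fun_eq_iff) metis
qed (use assms in blast)

text \<open>
  A Yamanouchi word can open a new row only directly below the existing ones.
\<close>

lemma apply_word_eq_0:
  assumes "is_composition \<mu>"
  shows "yamanouchi S \<mu> \<Longrightarrow> len \<mu> + length S < K \<Longrightarrow> apply_word S \<mu> K = 0"
proof (induction S arbitrary: K rule: rev_induct)
  case Nil
  then show ?case using row_le_len[OF assms, of K] by (fastforce simp: apply_word_def)
next
  case (snoc k S)
  then have y: "yamanouchi S \<mu>" and part: "is_partition (add_box k (apply_word S \<mu>))"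
    by (auto simp: yamanouchi_snoc apply_word_append) (simp add: apply_word_def)
  have z: "apply_word S \<mu> K = 0" "apply_word S \<mu> (K - 1) = 0"
    using snoc.IH[OF y] snoc.prems(2) by auto
  have "k \<noteq> K"
  proof
    assume k: "k = K"
    have "add_box k (apply_word S \<mu>) (Suc (K - 1)) \<le> add_box k (apply_word S \<mu>) (K - 1)"
      using part snoc.prems(2) unfolding is_partition_def by (elim conjE allE[of _ "K - 1"]) simp
    moreover have "K - 1 \<noteq> K" "Suc (K - 1) = K" using snoc.prems(2) by auto
    ultimately show False using z k by (simp add: add_box_def)
  qed
  then show ?case using z by (simp add: apply_word_append) (simp add: apply_word_def add_box_def)
qed

lemma mem_barred_word_iff: "k \<in> set (barred_word T xs) \<longleftrightarrow> (\<exists>\<beta>\<in>set xs. is_barred (T \<beta>) \<and> val (T \<beta>) = k)"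
  by (auto simp: barred_word_def)

lemma length_column_word: "is_partition lam \<Longrightarrow> length (column_word lam T) \<le> card (diagram lam)"
proof -
  assume lam: "is_partition lam"
  have "length (column_word lam T) \<le> length (column_order lam)"
    unfolding column_word_def barred_word_def length_map using length_filter_le[of is_barred "map T (column_order lam)"] by simp
  also have "\<dots> = card (diagram lam)"
    using distinct_card[OF distinct_column_order, of lam] by (simp add: set_column_order[OF lam])
  finally show ?thesis .
qed

lemma weight_agen: "barring_weight agen lam \<mu> T = cst (tableau_weight lam \<mu> T)"
  by (simp add: tableau_weight_def barring_weight_def cst_hom.hom_prod cst_hom.hom_minus)

context
  fixes lam \<mu> :: "nat \<Rightarrow> nat"
  assumes lam: "is_partition lam" and \<mu>: "is_partition \<mu>"
begin

lemma mu_composition: "is_composition \<mu>" and lam_composition: "is_composition lam"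
  using lam \<mu> by (simp_all add: is_partition_def)

text \<open>
  The entry in the corner \<open>(1, 1)\<close> is the largest. If it exceeded the bound, it could not be barred;
  unbarred, it would meet an empty row, and \<open>0\<close> is the content of the corner, so the weight would vanish.
\<close>

lemma LR_tableau_entry_bound:
  assumes T: "T \<in> LR_tableaux lam \<mu> \<nu>" and w: "tableau_weight lam \<mu> T \<noteq> 0" and \<beta>: "\<beta> \<in> diagram lam"
  shows "val (T \<beta>) \<le> len \<mu> + card (diagram lam)"
proof (rule ccontr)
  assume neg: "\<not> ?thesis"
  have T': "T \<in> reverse_tableaux lam" "yamanouchi (column_word lam T) \<mu>" "column_strict lam T"
    using T by (auto simp: LR_tableaux_def)
  obtain i j where ij: "\<beta> = (i, j)" by (cases \<beta>)
  have pos: "1 \<le> i" "1 \<le> j" using \<beta> ij by (auto simp: diagram_def)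
  have d: "(1, 1) \<in> diagram lam" "(1, j) \<in> diagram lam"
    using diagram_down_closed[OF lam \<beta>[unfolded ij]] pos by auto
  let ?K = "val (T (1, 1))"
  have "val (T (i, j)) \<le> val (T (1, j))"
    using T'(3) d(2) \<beta> ij pos unfolding column_strict_def by (cases "i = 1") (auto simp: less_imp_le)
  moreover have "val (T (1, j)) \<le> ?K"
    using T'(1) d pos unfolding reverse_tableaux_def by (cases "j = 1") auto
  ultimately have K: "len \<mu> + card (diagram lam) < ?K" using neg ij by simp
  then have zero: "apply_word (column_word lam T) \<mu> ?K = 0"
    using length_column_word[OF lam, of T] by (intro apply_word_eq_0[OF mu_composition T'(2)]) simp
  then have cnt: "\<mu> ?K = 0" "count_list (column_word lam T) ?K = 0" by (simp_all add: apply_word_eq_count)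
  have none: "\<not> (is_barred (T \<gamma>) \<and> val (T \<gamma>) = ?K)" if "\<gamma> \<in> diagram lam" for \<gamma>
  proof
    assume "is_barred (T \<gamma>) \<and> val (T \<gamma>) = ?K"
    then have "?K \<in> set (column_word lam T)"
      using that unfolding column_word_def mem_barred_word_iff set_column_order[OF lam] by blast
    then show False using cnt(2) by (simp add: count_list_0_iff)
  qed
  have nb: "\<not> is_barred (T (1, 1))" using none[OF d(1)] by simp
  have "?K \<notin> set (row_word_upto lam T (1, 1))"
  proof
    assume "?K \<in> set (row_word_upto lam T (1, 1))"
    then obtain \<gamma> where "\<gamma> \<in> set (takeWhile (\<lambda>\<beta>. \<beta> \<noteq> (1, 1)) (row_order lam) @ [(1, 1)])" "is_barred (T \<gamma>)" "val (T \<gamma>) = ?K"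
      unfolding row_word_upto_def mem_barred_word_iff by blast
    moreover from this have "\<gamma> \<in> diagram lam"
      using d(1) set_row_order[OF lam_composition] by (auto dest: set_takeWhileD)
    ultimately show False using none by blast
  qed
  then have "rho_row lam \<mu> T (1, 1) ?K = 0"
    using cnt(1) by (simp add: rho_row_def apply_word_eq_count count_notin)
  then have "tableau_weight lam \<mu> T = 0"
    unfolding tableau_weight_def using d(1) nb finite_diagram_partition[OF lam]
    by (intro prod_zero bexI[of _ "(1, 1)"]) (simp_all add: content_def)
  then show False using w by simp
qed

lemma LR_tableaux_eq_yamanouchi:
  assumes n: "len \<mu> + card (diagram lam) \<le> n"
  shows "{T \<in> LR_tableaux lam \<mu> \<nu>. tableau_weight lam \<mu> T \<noteq> 0} =
    {T \<in> yamanouchi_tableaux n lam \<mu>. content_word lam T \<mu> = \<nu> \<and> tableau_weight lam \<mu> T \<noteq> 0}"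
  using LR_tableau_entry_bound n
  by (fastforce simp: LR_tableaux_def yamanouchi_tableaux_def content_word_def)

lemma content_word_partition:
  assumes "T \<in> yamanouchi_tableaux n lam \<mu>"
  shows "is_partition (content_word lam T \<mu>)" "len (content_word lam T \<mu>) \<le> len \<mu> + card (diagram lam)"
proof -
  have y: "yamanouchi (column_word lam T) \<mu>" using assms by (simp add: yamanouchi_tableaux_def)
  then show p: "is_partition (content_word lam T \<mu>)"
    unfolding yamanouchi_def content_word_def by (auto dest: spec[of _ "length (column_word lam T)"])
  have "i \<le> len \<mu> + card (diagram lam)" if "content_word lam T \<mu> i \<noteq> 0" for i
    using apply_word_eq_0[OF mu_composition y, of i] that length_column_word[OF lam, of T]
    unfolding content_word_def by (meson le_less_trans nat_add_left_cancel_le not_le)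
  then show "len (content_word lam T \<mu>) \<le> len \<mu> + card (diagram lam)"
    using p unfolding len_def by (subst Max_le_iff) (auto simp: is_partition_def is_composition_def)
qed

definition LR_sum :: "(nat \<Rightarrow> nat) \<Rightarrow> apoly" where
  "LR_sum \<nu> = (\<Sum>T | T \<in> LR_tableaux lam \<mu> \<nu> \<and> tableau_weight lam \<mu> T \<noteq> 0. tableau_weight lam \<mu> T)"

lemma LR_sum_nonzero: "LR_sum \<nu> \<noteq> 0 \<Longrightarrow> {T \<in> LR_tableaux lam \<mu> \<nu>. tableau_weight lam \<mu> T \<noteq> 0} \<noteq> {}"
  unfolding LR_sum_def by (erule contrapos_nn) (simp only: sum.empty)

lemma finite_LR_tableaux: "finite {T \<in> LR_tableaux lam \<mu> \<nu>. tableau_weight lam \<mu> T \<noteq> 0}"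
  unfolding LR_tableaux_eq_yamanouchi[OF order_refl]
  by (rule finite_subset[OF _ finite_yamanouchi_tableaux[OF lam]]) auto

lemma LR_sum_support: "{\<nu>. LR_sum \<nu> \<noteq> 0} \<subseteq> (\<lambda>T. content_word lam T \<mu>) ` yamanouchi_tableaux (len \<mu> + card (diagram lam)) lam \<mu>"
proof
  fix \<nu> assume "\<nu> \<in> {\<nu>. LR_sum \<nu> \<noteq> 0}"
  then have "{T \<in> LR_tableaux lam \<mu> \<nu>. tableau_weight lam \<mu> T \<noteq> 0} \<noteq> {}" using LR_sum_nonzero by simp
  then show "\<nu> \<in> (\<lambda>T. content_word lam T \<mu>) ` yamanouchi_tableaux (len \<mu> + card (diagram lam)) lam \<mu>"
    unfolding LR_tableaux_eq_yamanouchi[OF order_refl] by auto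
qed

lemma finite_LR_sum_support: "finite {\<nu>. LR_sum \<nu> \<noteq> 0}"
  by (rule finite_subset[OF LR_sum_support]) (simp add: finite_yamanouchi_tableaux[OF lam])

lemma LR_sum_support_partition: "LR_sum \<nu> \<noteq> 0 \<Longrightarrow> is_partition \<nu> \<and> len \<nu> \<le> len \<mu> + card (diagram lam)"
  using LR_sum_support content_word_partition by blast

lemma sum_yamanouchi_by_content:
  assumes n: "len \<mu> + card (diagram lam) \<le> n"
  shows "(\<Sum>T\<in>yamanouchi_tableaux n lam \<mu>. barring_weight agen lam \<mu> T * F (content_word lam T \<mu>)) =
    (\<Sum>\<nu> | LR_sum \<nu> \<noteq> 0. cst (LR_sum \<nu>) * F \<nu>)"
proof -
  let ?Y = "yamanouchi_tableaux n lam \<mu>"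
  let ?c = "\<lambda>T. content_word lam T \<mu>"
  have fin: "finite ?Y" by (rule finite_yamanouchi_tableaux[OF lam])
  have fib: "(\<Sum>T | T \<in> ?Y \<and> ?c T = \<nu>. barring_weight agen lam \<mu> T * F (?c T)) = cst (LR_sum \<nu>) * F \<nu>" for \<nu>
  proof -
    have "(\<Sum>T | T \<in> ?Y \<and> ?c T = \<nu>. barring_weight agen lam \<mu> T * F (?c T)) =
        (\<Sum>T | T \<in> ?Y \<and> ?c T = \<nu>. cst (tableau_weight lam \<mu> T)) * F \<nu>"
      unfolding sum_distrib_right weight_agen by (rule sum.cong) auto
    also have "(\<Sum>T | T \<in> ?Y \<and> ?c T = \<nu>. cst (tableau_weight lam \<mu> T)) =
        (\<Sum>T | T \<in> ?Y \<and> ?c T = \<nu> \<and> tableau_weight lam \<mu> T \<noteq> 0. cst (tableau_weight lam \<mu> T))"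
      using fin by (intro sum.mono_neutral_right) auto
    also have "\<dots> = cst (LR_sum \<nu>)"
      unfolding LR_sum_def cst_hom.hom_sum LR_tableaux_eq_yamanouchi[OF n] ..
    finally show ?thesis .
  qed
  have "(\<Sum>T\<in>?Y. barring_weight agen lam \<mu> T * F (?c T)) = (\<Sum>\<nu>\<in>?c ` ?Y. cst (LR_sum \<nu>) * F \<nu>)"
    unfolding sum.image_gen[OF fin, of _ ?c] fib ..
  also have "\<dots> = (\<Sum>\<nu> | LR_sum \<nu> \<noteq> 0. cst (LR_sum \<nu>) * F \<nu>)"
  proof (rule sum.mono_neutral_right)
    show "{\<nu>. LR_sum \<nu> \<noteq> 0} \<subseteq> ?c ` ?Y"
    proof
      fix \<nu> assume "\<nu> \<in> {\<nu>. LR_sum \<nu> \<noteq> 0}"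
      then have "{T \<in> LR_tableaux lam \<mu> \<nu>. tableau_weight lam \<mu> T \<noteq> 0} \<noteq> {}" using LR_sum_nonzero by simp
      then show "\<nu> \<in> ?c ` ?Y" unfolding LR_tableaux_eq_yamanouchi[OF n] by auto
    qed
  qed (use fin in auto)
  finally show ?thesis .
qed

theorem LR_poly_eq_LR_sum:
  assumes \<tau>: "is_shift \<tau>"
  shows "LR_poly \<tau> lam \<mu> = LR_sum"
proof (rule LR_poly_eqI[OF \<tau> finite_LR_sum_support])
  let ?S = "{\<nu>. LR_sum \<nu> \<noteq> 0}"
  show "\<forall>\<nu>. LR_sum \<nu> \<noteq> 0 \<longrightarrow> is_partition \<nu>" using LR_sum_support_partition by blast
  \<comment> \<open>Large enough for the bialternant formulas of all partitions involved.\<close>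
  define N where "N = len lam + len \<mu> + card (diagram lam)"
  show "double_schur \<tau> lam * double_schur \<tau> \<mu> = (\<Sum>\<nu>\<in>?S. scalar (LR_sum \<nu>) * double_schur \<tau> \<nu>)"
  proof (rule Lambda_eqI)
    show "double_schur \<tau> lam * double_schur \<tau> \<mu> \<in> Lambda"
      by (intro Lambda_mult double_schur_Lambda[OF \<tau>])
    show "(\<Sum>\<nu>\<in>?S. scalar (LR_sum \<nu>) * double_schur \<tau> \<nu>) \<in> Lambda"
      by (intro Lambda_sum Lambda_mult Lambda_scalar double_schur_Lambda[OF \<tau>])
    fix n assume n: "N \<le> n"
    let ?A = "\<lambda>\<nu>. alternant agen n \<nu> xgen"
    have A0: "?A (\<lambda>_. 0) \<noteq> 0" by (rule alternant_nonzero[OF zero_partition])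
    have "double_schur \<tau> lam n * ?A (\<lambda>_. 0) = tableau_polynomial n lam agen xgen * ?A (\<lambda>_. 0)"
      using double_schur_bialternant[OF \<tau> lam_composition, of n] tableau_polynomial_times_denominator[OF lam, of n agen xgen] n
      by (simp add: N_def)
    then have tab: "double_schur \<tau> lam n = tableau_polynomial n lam agen xgen" using A0 by simp
    have "(double_schur \<tau> lam * double_schur \<tau> \<mu>) n * ?A (\<lambda>_. 0) = tableau_polynomial n lam agen xgen * ?A \<mu>"
      using double_schur_bialternant[OF \<tau> mu_composition, of n] n by (simp add: tab N_def mult.assoc)
    also have "\<dots> = (\<Sum>T\<in>yamanouchi_tableaux n lam \<mu>. barring_weight agen lam \<mu> T * ?A (content_word lam T \<mu>))"
      by (rule tableau_polynomial_times_alternant_tableaux[OF lam \<mu>])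
    also have "\<dots> = (\<Sum>\<nu>\<in>?S. cst (LR_sum \<nu>) * ?A \<nu>)"
      by (rule sum_yamanouchi_by_content) (use n in \<open>simp add: N_def\<close>)
    also have "\<dots> = (\<Sum>\<nu>\<in>?S. scalar (LR_sum \<nu>) * double_schur \<tau> \<nu>) n * ?A (\<lambda>_. 0)"
    proof -
      have app: "(\<Sum>\<nu>\<in>S. G \<nu>) n = (\<Sum>\<nu>\<in>S. G \<nu> n)" for G :: "(nat \<Rightarrow> nat) \<Rightarrow> xseq" and S
        by (induction S rule: infinite_finite_induct) auto
      show ?thesis unfolding app sum_distrib_right
      proof (rule sum.cong[OF refl])
        fix \<nu> assume "\<nu> \<in> ?S"
        then have "is_composition \<nu>" "len \<nu> \<le> n"
          using LR_sum_support_partition[of \<nu>] n by (auto simp: N_def is_partition_def)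
        then show "cst (LR_sum \<nu>) * ?A \<nu> = (scalar (LR_sum \<nu>) * double_schur \<tau> \<nu>) n * ?A (\<lambda>_. 0)"
          using double_schur_bialternant[OF \<tau>, of \<nu> n] by (simp add: scalar_def mult.assoc)
      qed
    qed
    finally show "(double_schur \<tau> lam * double_schur \<tau> \<mu>) n = (\<Sum>\<nu>\<in>?S. scalar (LR_sum \<nu>) * double_schur \<tau> \<nu>) n"
      using A0 by simp
  qed
qed

lemma LR_tableaux_not_contained: "\<not> contained \<mu> \<nu> \<Longrightarrow> LR_tableaux lam \<mu> \<nu> = {}"
  by (auto simp: LR_tableaux_def contained_def apply_word_eq_count)

end

theorem theorem4p2:
  fixes \<tau> :: "xseq \<Rightarrow> xseq" and lam \<mu> \<nu> :: "nat \<Rightarrow> nat"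
  assumes "is_shift \<tau>"
    and "is_partition lam" and "is_partition \<mu>" and "is_partition \<nu>"
  shows "(\<not> contained \<mu> \<nu> \<longrightarrow> LR_poly \<tau> lam \<mu> \<nu> = 0) \<and>
         (contained \<mu> \<nu> \<longrightarrow>
            finite {T \<in> LR_tableaux lam \<mu> \<nu>. tableau_weight lam \<mu> T \<noteq> 0} \<and>
            LR_poly \<tau> lam \<mu> \<nu> =
              (\<Sum>T | T \<in> LR_tableaux lam \<mu> \<nu> \<and> tableau_weight lam \<mu> T \<noteq> 0.
                 tableau_weight lam \<mu> T))"
  using LR_poly_eq_LR_sum[OF assms(2,3,1)] finite_LR_tableaux[OF assms(2,3)]
    LR_tableaux_not_contained[OF assms(2,3), of \<nu>]
  by (simp add: LR_sum_def[OF assms(2,3)])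

end
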